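(* Assume there are constants $M\ge m>0$ with $m\|\varrho(G)x\|\le\|Ax\|\le M\|\varrho(G)x\|$ for all $x\in X$, and that $x^\dagger-x_0=G^pv$ with $v\in X$, $\|v\|\le E$, for some positive constants $p,E$. Assume moreover: (i) in the case of high order regularization ($s\ge p$), that $w^2=1/h^2$ is operator monotone; (ii) in the case of low order regularization ($s\le p$), that $h^2$ is operator monotone and $h(t)/\sqrt t$ is decreasing. Let $\sigma_n$ be chosen a priori by $$\sigma_n^{-1}=\frac{\delta^2}{E^2}\Big[\psi_p^{-1}\Big(\frac{\delta}{mE}\Big)\Big]^{2(s-p)} .$$ If the function $\xi_p(t):=\psi_p^2(t^{1/(2p)})$ is convex, then $x_n^\delta$ is order optimal on the set $M_{p,E}=\{x\in X:\|x-x_0\|_p\le E\}$ in both cases of high order regularization $s\ge p$ and low order regularization $s\le p$. In fact, in both cases, $$\|x_n^\delta-x^\dagger\|\le c_1\big[\psi_p^{-1}(c_2\delta)\big]^p$$ with some constants $c_1$ and $c_2$ (which can be extracted from the proof).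
   Context: Setting. $X,Y$ are Hilbert spaces; $A\in\mathcal L(X,Y)$ is linear, injective and bounded with non-closed range; $y\in\mathcal R(A)$, $x^\dagger\in X$ is the unique solution of $Ax=y$, and $y^\delta\in Y$ satisfies $\|y-y^\delta\|\le\delta$; $x_0\in X$ is a starting value. $B:\mathcal D(B)\subset X\to X$ is an unbounded densely defined self-adjoint strictly positive definite operator, $G:=B^{-1}$ (bounded, linear, injective, self-adjoint, with non-closed range), $a:=\|G\|$, and $\|x\|_r:=\|G^{-r}x\|$ for $r\in\mathbb R$. Method. $s$ is a (generally nonnegative) real number, $T:=AG^s$, $\alpha_1,\dots,\alpha_n>0$, $\sigma_n:=\sum_{k=1}^n1/\alpha_k$ (the regularization parameter), and $$x_n^\delta:=x_0+G^sg_n(T^*T)T^*(y^\delta-Ax_0),\qquad g_n(\lambda)=\frac1\lambda\Big(1-\prod_{k=1}^n\frac{\alpha_k}{\lambda+\alpha_k}\Big).$$ Functions. An index function is a continuous, strictly increasing function $(0,a]\to(0,b]$ with limit $0$ at $0+$. $\varrho:(0,a]\to(0,b]$ is an index function with $a=\|G\|$, $b=\varrho(a)$. $\psi_r(\lambda):=\lambda^r\varrho(\lambda)$, $\psi_r:(0,a]\to(0,a^r\varrho(a)]$, for constants $r$ for which $\lambda^r\varrho(\lambda)$ is monotonically increasing. $h(t):=[\psi_s^{-1}(\sqrt t)]^{p-s}$ and $w(t):=1/h(t)$. An index function $f$ on an interval $(0,c]$ is operator monotone if for any pair of self-adjoint linear operators $S_1,S_2$ with spectra in $(0,c]$, $S_1\le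 S_2$ implies $f(S_1)\le f(S_2)$; here $S_1\le S_2$ means $(S_1x,x)\le(S_2x,x)$ for all $x\in X$. Order optimality. The benchmark is the lower bound for the best possible worst case error over all methods $R:Y\to X$: if $\|Ax\|\le M\|\varrho(G)x\|$ for all $x$, then $\inf_R\sup\{\|Ry^\delta-x^\dagger\|: y^\delta\in Y,\ \|y-y^\delta\|\le\delta,\ x^\dagger\in M_{p,E}\}\ge E[\psi_p^{-1}(\delta/(ME))]^p$, provided $\delta/(ME)$ is an element of the spectrum of $\psi_p(G)$. *)

theory Defs
  imports
    "HOL-Analysis.Analysis"
    "HOL-Computational_Algebra.Polynomial"
begin

section \<open>Operators on a Hilbert space\<close>

text \<open>Hilbert spaces are types of class \<open>{real_inner, complete_space}\<close>; a complex Hilbert space is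
  covered through its underlying real one.\<close>

definition bounded_selfadjoint :: "('a::real_inner \<Rightarrow> 'a) \<Rightarrow> bool" where
  "bounded_selfadjoint S \<longleftrightarrow> bounded_linear S \<and> (\<forall>x y. S x \<bullet> y = x \<bullet> S y)"

definition op_le :: "('a::real_inner \<Rightarrow> 'a) \<Rightarrow> ('a \<Rightarrow> 'a) \<Rightarrow> bool" where
  "op_le S1 S2 \<longleftrightarrow> (\<forall>x. S1 x \<bullet> x \<le> S2 x \<bullet> x)"

text \<open>Only used for self-adjoint operators, whose spectrum is real.\<close>

definition spectrum_op :: "('a::real_inner \<Rightarrow> 'a) \<Rightarrow> real set" where
  "spectrum_op S = {t. \<not> (\<exists>R. bounded_linear R \<and> (\<forall>x. R (S x - t *\<^sub>R x) = x) \<and>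
                               (\<forall>x. S (R x) - t *\<^sub>R R x = x))}"

text \<open>A possibly unbounded operator is a function together with its domain. The last clause says
  that the graph of the operator is the graph of its adjoint, domains included.\<close>

definition selfadjoint_on :: "'a::real_inner set \<Rightarrow> ('a \<Rightarrow> 'a) \<Rightarrow> bool" where
  "selfadjoint_on D B \<longleftrightarrow> subspace D \<and> closure D = UNIV \<and>
     (\<forall>x\<in>D. \<forall>y\<in>D. B (x + y) = B x + B y) \<and> (\<forall>c. \<forall>x\<in>D. B (c *\<^sub>R x) = c *\<^sub>R B x) \<and>
     (\<forall>y z. (y \<in> D \<and> B y = z) \<longleftrightarrow> (\<forall>x\<in>D. B x \<bullet> y = x \<bullet> z))"

definition strictly_positive_on :: "'a::real_inner set \<Rightarrow> ('a \<Rightarrow> 'a) \<Rightarrow> bool" where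
  "strictly_positive_on D B \<longleftrightarrow> (\<exists>\<gamma>>0. \<forall>x\<in>D. \<gamma> * (norm x)\<^sup>2 \<le> B x \<bullet> x)"

definition unbounded_on :: "'a::real_inner set \<Rightarrow> ('a \<Rightarrow> 'a) \<Rightarrow> bool" where
  "unbounded_on D B \<longleftrightarrow> \<not> (\<exists>K. \<forall>x\<in>D. norm (B x) \<le> K * norm x)"


section \<open>Continuous functional calculus\<close>

definition poly_op :: "real poly \<Rightarrow> ('a::real_inner \<Rightarrow> 'a) \<Rightarrow> 'a \<Rightarrow> 'a" where
  "poly_op q S x = (\<Sum>i\<le>degree q. coeff q i *\<^sub>R (S ^^ i) x)"

text \<open>\<open>f(S)\<close> for a bounded self-adjoint \<open>S\<close> and \<open>f\<close> continuous on the spectrum of \<open>S\<close>: the norm limit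
  of \<open>q(S)\<close> for polynomials \<open>q\<close> tending to \<open>f\<close> uniformly on the spectrum.\<close>

definition fun_calc :: "(real \<Rightarrow> real) \<Rightarrow> ('a::real_inner \<Rightarrow> 'a) \<Rightarrow> 'a \<Rightarrow> 'a" where
  "fun_calc f S = (THE F. bounded_linear F \<and>
     (\<forall>\<epsilon>>0. \<exists>q. (\<forall>t\<in>spectrum_op S. \<bar>poly q t - f t\<bar> \<le> \<epsilon>) \<and>
               (\<forall>x. norm (poly_op q S x - F x) \<le> \<epsilon> * norm x)))"

text \<open>An index function lives on \<open>(0, a]\<close> and tends to \<open>0\<close> at \<open>0\<close>, whereas \<open>0\<close> may lie in the spectrum
  of the operator it is applied to; it is extended continuously.\<close>

definition ext0 :: "(real \<Rightarrow> real) \<Rightarrow> real \<Rightarrow> real" where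
  "ext0 f t = (if 0 < t then f t else 0)"

text \<open>Real powers of an injective positive operator. The case \<open>r = 0\<close> is separate because
  \<open>0 powr 0 = 0\<close>. For \<open>r < 0\<close> the power is unbounded: it inverts \<open>G\<^sup>-\<^sup>r\<close> and is meaningful only
  on the range of that operator, which is its domain.\<close>

definition op_powr :: "('a::real_inner \<Rightarrow> 'a) \<Rightarrow> real \<Rightarrow> 'a \<Rightarrow> 'a" where
  "op_powr G r = (if r = 0 then id
                  else if 0 < r then fun_calc (\<lambda>t. t powr r) G
                  else inv (fun_calc (\<lambda>t. t powr (- r)) G))"

definition op_powr_dom :: "('a::real_inner \<Rightarrow> 'a) \<Rightarrow> real \<Rightarrow> 'a set" where
  "op_powr_dom G r = (if 0 \<le> r then UNIV else range (op_powr G (- r)))"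

text \<open>The norm of the Hilbert scale, for \<open>x\<close> in \<open>op_powr_dom G (- r)\<close>.\<close>

definition scale_norm :: "('a::real_inner \<Rightarrow> 'a) \<Rightarrow> real \<Rightarrow> 'a \<Rightarrow> real" where
  "scale_norm G r x = norm (op_powr G (- r) x)"

definition source_set :: "('a::real_inner \<Rightarrow> 'a) \<Rightarrow> 'a \<Rightarrow> real \<Rightarrow> real \<Rightarrow> 'a set" where
  "source_set G x0 p E = {x. x - x0 \<in> op_powr_dom G (- p) \<and> scale_norm G p (x - x0) \<le> E}"


section \<open>Index functions and operator monotonicity\<close>

definition index_function :: "real \<Rightarrow> (real \<Rightarrow> real) \<Rightarrow> bool" where
  "index_function a f \<longleftrightarrow> continuous_on {0<..a} f \<and> strict_mono_on {0<..a} f \<and>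
     (\<forall>t\<in>{0<..a}. 0 < f t) \<and> (f \<longlongrightarrow> 0) (at_right 0)"

text \<open>A self-adjoint operator whose spectrum lies in \<open>(0, c]\<close> is bounded, so restricting to bounded
  operators loses nothing.\<close>

definition operator_monotone :: "'a::real_inner itself \<Rightarrow> real \<Rightarrow> (real \<Rightarrow> real) \<Rightarrow> bool" where
  "operator_monotone X c f \<longleftrightarrow>
     (\<forall>S1 S2 :: 'a \<Rightarrow> 'a. bounded_selfadjoint S1 \<longrightarrow> bounded_selfadjoint S2 \<longrightarrow>
        spectrum_op S1 \<subseteq> {0<..c} \<longrightarrow> spectrum_op S2 \<subseteq> {0<..c} \<longrightarrow>
        op_le S1 S2 \<longrightarrow> op_le (fun_calc f S1) (fun_calc f S2))"

definition psi :: "(real \<Rightarrow> real) \<Rightarrow> real \<Rightarrow> real \<Rightarrow> real" where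
  "psi \<rho> r t = t powr r * \<rho> t"

definition psi_inv :: "(real \<Rightarrow> real) \<Rightarrow> real \<Rightarrow> real \<Rightarrow> real \<Rightarrow> real" where
  "psi_inv \<rho> a r = the_inv_into {0<..a} (psi \<rho> r)"

definition h_fun :: "(real \<Rightarrow> real) \<Rightarrow> real \<Rightarrow> real \<Rightarrow> real \<Rightarrow> real \<Rightarrow> real" where
  "h_fun \<rho> a s p t = psi_inv \<rho> a s (sqrt t) powr (p - s)"

definition w_fun :: "(real \<Rightarrow> real) \<Rightarrow> real \<Rightarrow> real \<Rightarrow> real \<Rightarrow> real \<Rightarrow> real" where
  "w_fun \<rho> a s p t = 1 / h_fun \<rho> a s p t"


section \<open>The regularization method\<close>

text \<open>For \<open>s \<ge> 0\<close> this is the composition \<open>A G\<^sup>s\<close>. For \<open>s < 0\<close> that composition is only densely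
  defined and is replaced by its bounded extension.\<close>

definition T_op :: "('a::real_inner \<Rightarrow> 'b::real_inner) \<Rightarrow> ('a \<Rightarrow> 'a) \<Rightarrow> real \<Rightarrow> 'a \<Rightarrow> 'b" where
  "T_op A G s = (THE T. bounded_linear T \<and> (\<forall>x\<in>op_powr_dom G s. T x = A (op_powr G s x)))"

definition sigma_reg :: "(nat \<Rightarrow> real) \<Rightarrow> nat \<Rightarrow> real" where
  "sigma_reg \<alpha> n = (\<Sum>k=1..n. 1 / \<alpha> k)"

text \<open>The value at \<open>0\<close>, a point of the spectrum of \<open>T\<^sup>*T\<close>, is the limit as \<open>t\<close> tends to \<open>0\<close>.\<close>

definition g_reg :: "(nat \<Rightarrow> real) \<Rightarrow> nat \<Rightarrow> real \<Rightarrow> real" where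
  "g_reg \<alpha> n t = (if t = 0 then sigma_reg \<alpha> n
                  else 1 / t * (1 - (\<Prod>k=1..n. \<alpha> k / (t + \<alpha> k))))"

definition x_reg :: "('a::real_inner \<Rightarrow> 'b::real_inner) \<Rightarrow> ('a \<Rightarrow> 'a) \<Rightarrow> real \<Rightarrow> 'a \<Rightarrow>
    (nat \<Rightarrow> real) \<Rightarrow> nat \<Rightarrow> 'b \<Rightarrow> 'a" where
  "x_reg A G s x0 \<alpha> n y\<delta> =
     (let T = T_op A G s
      in x0 + op_powr G s (fun_calc (g_reg \<alpha> n) (adjoint T \<circ> T) (adjoint T (y\<delta> - A x0))))"


section \<open>Worst case errors\<close>

text \<open>Values in \<^typ>\<open>ennreal\<close>, since an arbitrary \<open>R\<close> may have infinite worst case error.\<close>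

definition worst_case_error ::
    "('a::real_inner \<Rightarrow> 'b::real_inner) \<Rightarrow> 'a set \<Rightarrow> real \<Rightarrow> ('b \<Rightarrow> 'a) \<Rightarrow> ennreal" where
  "worst_case_error A K \<delta> R = (SUP x\<in>K. SUP y\<delta>\<in>{z. norm (A x - z) \<le> \<delta>}. ennreal (norm (R y\<delta> - x)))"

definition best_worst_case_error ::
    "('a::real_inner \<Rightarrow> 'b::real_inner) \<Rightarrow> 'a set \<Rightarrow> real \<Rightarrow> ennreal" where
  "best_worst_case_error A K \<delta> = (INF R. worst_case_error A K \<delta> R)"

end

theory Submission
  imports Defs "HOL-Computational_Algebra.Fundamental_Theorem_Algebra"
begin

text \<open>
  Put \<open>\<Psi> = \<psi>\<^sub>s(G)\<close>, \<open>Q = G\<^bsup>|p - s|\<^esup>\<close> and let \<open>F(t) = [\<psi>\<^sub>s\<^sup>-\<^sup>1(\<surd>t)]\<^bsup>2|p - s|\<^esup>\<close>, so that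
  \<open>F(\<Psi>\<^sup>2) = Q\<^sup>2\<close>; \<open>F\<close> is \<open>w\<^sup>2\<close> or \<open>h\<^sup>2\<close>, hence operator monotone. The link condition says
  \<open>(m/M)\<^sup>2 \<Psi>\<^sup>2 \<le> T\<^sup>*T / M\<^sup>2 \<le> \<Psi>\<^sup>2\<close>. Operator monotonicity also forces
  \<open>t F(\<tau>) \<le> K \<tau> F(t)\<close> for \<open>t \<le> \<tau>\<close>, so \<open>\<parallel>Qz\<parallel>\<^sup>2\<close> is equivalent to
  \<open>(F(T\<^sup>*T / M\<^sup>2) z, z)\<close>, and filter functions of \<open>T\<^sup>*T\<close> can be estimated pointwise against \<open>F\<close>,
  splitting at \<open>1/\<sigma>\<^sub>n\<close>. With the stated \<open>\<sigma>\<^sub>n\<close> the error is \<open>G\<^sup>p w\<close> with \<open>\<parallel>w\<parallel> = O(E)\<close> and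
  \<open>\<parallel>A G\<^sup>p w\<parallel> = O(\<delta>)\<close>. Since \<open>\<rho>\<close> is increasing,
  \<open>u\<^bsup>2p\<^esup> \<le> t\<^bsup>2p\<^esup> + u\<^bsup>2p\<^esup> \<rho>(u)\<^sup>2 / \<rho>(t)\<^sup>2\<close> for all \<open>u\<close>, and evaluating this at \<open>u = G\<close> with
  \<open>t = \<psi>\<^sub>p\<^sup>-\<^sup>1(\<delta>/(mE))\<close> turns the two bounds into the rate. The matching lower bound comes from
  approximate eigenvectors of \<open>\<psi>\<^sub>p(G)\<close>.
\<close>

section \<open>Variational principles and dense ranges\<close>

lemma coercive_variational:
  fixes S :: "'a::{real_inner, complete_space} \<Rightarrow> 'a" and f :: "'a \<Rightarrow> real"
  assumes S: "bounded_selfadjoint S" and coer: "\<And>x. \<gamma> * (norm x)\<^sup>2 \<le> S x \<bullet> x" and \<gamma>: "0 < \<gamma>"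
    and f: "bounded_linear f" and W: "subspace W"
  obtains z where "z \<in> closure W" "\<And>x. x \<in> W \<Longrightarrow> S z \<bullet> x = f x"
proof -
  interpret S: bounded_linear S using S by (simp add: bounded_selfadjoint_def)
  interpret f: bounded_linear f by fact
  have sym: "S x \<bullet> y = S y \<bullet> x" for x y
    using S by (metis bounded_selfadjoint_def inner_commute)
  define J where "J x = S x \<bullet> x - 2 * f x" for x
  have J_add: "J (x + t *\<^sub>R y) = J x + 2 * t * (S x \<bullet> y - f y) + t\<^sup>2 * (S y \<bullet> y)" for x y t
    using sym[of x y] unfolding J_def
    by (simp add: S.add S.scaleR f.add f.scaleR inner_add_left inner_add_right algebra_simps power2_eq_square)
  obtain K where K: "\<And>x. norm (f x) \<le> norm x * K" using f.bounded by blast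
  have lower: "- (K\<^sup>2 / \<gamma>) \<le> J x" for x
  proof -
    have "2 * f x \<le> 2 * (norm x * K)" using K[of x] by (auto simp: abs_le_iff)
    also have "\<dots> \<le> \<gamma> * (norm x)\<^sup>2 + K\<^sup>2 / \<gamma>"
    proof -
      have "0 \<le> (\<gamma> * norm x - K)\<^sup>2 / \<gamma>" using \<gamma> by simp
      also have "\<dots> = \<gamma> * (norm x)\<^sup>2 + K\<^sup>2 / \<gamma> - 2 * (norm x * K)"
        using \<gamma> by (simp add: field_simps power2_eq_square)
      finally show ?thesis by simp
    qed
    finally show ?thesis using coer[of x] by (simp add: J_def)
  qed
  define d where "d = (INF x\<in>W. J x)"
  have bdd: "bdd_below (J ` W)" using lower by (meson bdd_belowI2)
  have W0: "W \<noteq> {}" using W by (auto simp: subspace_def)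
  have dle: "d \<le> J x" if "x \<in> W" for x
    unfolding d_def using bdd that by (rule cINF_lower)
  have "\<exists>x\<in>W. J x < d + 1 / real (Suc n)" for n
    using cINF_less_iff[OF W0 bdd, of "d + 1 / real (Suc n)"] by (auto simp: d_def)
  then obtain X where X: "\<And>n. X n \<in> W" "\<And>n. J (X n) < d + 1 / real (Suc n)" by metis
  have mid: "\<gamma> / 2 * (norm (x - y))\<^sup>2 \<le> J x + J y - 2 * d" if "x \<in> W" "y \<in> W" for x y
  proof -
    have "x + (1/2) *\<^sub>R (y - x) \<in> W" using that W
      by (simp add: subspace_add subspace_diff subspace_scale)
    then have "d \<le> J (x + (1/2) *\<^sub>R (y - x))" by (rule dle)
    moreover have "J y = J (x + 1 *\<^sub>R (y - x))" by simp
    then have "J y = J x + 2 * (S x \<bullet> (y - x) - f (y - x)) + S (y - x) \<bullet> (y - x)"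
      by (simp only: J_add) simp
    moreover have "J (x + (1/2) *\<^sub>R (y - x)) = J x + (S x \<bullet> (y - x) - f (y - x)) + (S (y - x) \<bullet> (y - x)) / 4"
      by (simp only: J_add) (simp add: power2_eq_square)
    moreover have "\<gamma> * (norm (x - y))\<^sup>2 \<le> S (y - x) \<bullet> (y - x)"
      using coer[of "y - x"] by (simp add: norm_minus_commute)
    ultimately show ?thesis by argo
  qed
  have "Cauchy X"
  proof (rule metric_CauchyI)
    fix e :: real assume e: "0 < e"
    obtain n0 where n0: "4 / (\<gamma> * e\<^sup>2) < real (Suc n0)"
      using reals_Archimedean2 by (metis less_Suc_eq of_nat_less_iff order_less_trans)
    have *: "1 / real (Suc n) < \<gamma> * e\<^sup>2 / 4" if "n \<ge> n0" for n
    proof -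
      have "4 / (\<gamma> * e\<^sup>2) < real (Suc n)" using n0 that by linarith
      then show ?thesis using \<gamma> e by (simp add: field_simps)
    qed
    have "dist (X i) (X j) < e" if "i \<ge> n0" "j \<ge> n0" for i j
    proof -
      have "\<gamma> / 2 * (norm (X i - X j))\<^sup>2 < \<gamma> / 2 * e\<^sup>2"
        using mid[OF X(1) X(1), of i j] X(2)[of i] X(2)[of j] *[OF that(1)] *[OF that(2)] by argo
      then have "(norm (X i - X j))\<^sup>2 < e\<^sup>2" using \<gamma> by simp
      then show ?thesis using e by (simp add: dist_norm power_less_imp_less_base)
    qed
    then show "\<exists>M. \<forall>m\<ge>M. \<forall>n\<ge>M. dist (X m) (X n) < e" by blast
  qed
  then obtain z where z: "X \<longlonglongrightarrow> z" using Cauchy_convergent convergent_def by blast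
  have zW: "z \<in> closure W" using X(1) z by (auto simp: closure_sequential)
  have Jz: "(\<lambda>n. J (X n + y)) \<longlonglongrightarrow> J (z + y)" for y
    unfolding J_def by (intro tendsto_intros S.tendsto f.tendsto z)
  have "J z \<le> d"
  proof (rule LIMSEQ_le)
    show "(\<lambda>n. J (X n)) \<longlonglongrightarrow> J z" using Jz[of 0] by simp
    show "(\<lambda>n. d + 1 / real (Suc n)) \<longlonglongrightarrow> d"
      using LIMSEQ_inverse_real_of_nat_add[of d] by (simp add: inverse_eq_divide)
    show "\<exists>N. \<forall>n\<ge>N. J (X n) \<le> d + 1 / real (Suc n)" using X(2) less_imp_le by blast
  qed
  have min: "J z \<le> J (z + y)" if "y \<in> W" for y
  proof -
    have "d \<le> J (z + y)"
      by (rule LIMSEQ_le_const[OF Jz]) (use X(1) that W in \<open>auto intro!: dle subspace_add\<close>)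
    with \<open>J z \<le> d\<close> show ?thesis by simp
  qed
  have "S z \<bullet> x = f x" if "x \<in> W" for x
  proof (rule ccontr)
    assume ne: "S z \<bullet> x \<noteq> f x"
    define u where "u = S z \<bullet> x - f x"
    define q where "q = S x \<bullet> x + 1"
    have q: "q > 0" using coer[of x] \<gamma> unfolding q_def
      by (smt (verit) mult_nonneg_nonneg zero_le_power2)
    have "J z \<le> J (z + (- u / q) *\<^sub>R x)"
      using subspace_scale[OF W that, of "- u / q"] by (rule min)
    then have "0 \<le> 2 * (- u / q) * u + (- u / q)\<^sup>2 * (S x \<bullet> x)"
      by (simp add: J_add u_def)
    also have "\<dots> = - (u\<^sup>2 / q\<^sup>2) * (q + 1)"
    proof -
      have *: "S x \<bullet> x = q - 1" by (simp add: q_def)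
      show ?thesis unfolding * using q by (simp add: field_simps power2_eq_square)
    qed
    finally show False using ne q by (simp add: u_def mult_le_0_iff divide_le_0_iff)
  qed
  with zW show ?thesis using that by blast
qed

lemma bounded_selfadjoint_id: "bounded_selfadjoint (\<lambda>x. x)"
  by (simp add: bounded_selfadjoint_def bounded_linear_ident)

lemma riesz:
  fixes f :: "'a::{real_inner, complete_space} \<Rightarrow> real"
  assumes "bounded_linear f"
  obtains z where "\<And>x. f x = z \<bullet> x"
proof -
  obtain z where "\<And>x. x \<in> UNIV \<Longrightarrow> z \<bullet> x = f x"
    by (rule coercive_variational[of "\<lambda>x. x" 1 f UNIV])
       (use assms in \<open>auto simp: bounded_selfadjoint_id power2_norm_eq_inner\<close>)
  then show ?thesis using that[of z] by simp
qed

lemma dense_subspaceI: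
  fixes W :: "'a::{real_inner, complete_space} set"
  assumes W: "subspace W" and orth: "\<And>z. (\<And>x. x \<in> W \<Longrightarrow> x \<bullet> z = 0) \<Longrightarrow> z = 0"
  shows "closure W = UNIV"
proof -
  have "y \<in> closure W" for y
  proof -
    obtain z where z: "z \<in> closure W" "\<And>x. x \<in> W \<Longrightarrow> z \<bullet> x = y \<bullet> x"
      by (rule coercive_variational[of "\<lambda>x. x" 1 "\<lambda>x. y \<bullet> x" W])
         (use W in \<open>auto simp: bounded_selfadjoint_id power2_norm_eq_inner bounded_linear_inner_right\<close>)
    have "y - z = 0" by (rule orth) (use z(2) in \<open>simp add: inner_diff_right inner_commute\<close>)
    with z(1) show ?thesis by simp
  qed
  then show ?thesis by auto
qed

lemma dense_induct:
  assumes "closure W = UNIV" "closed {x. P x}" "\<And>x. x \<in> W \<Longrightarrow> P x"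
  shows "P x"
proof -
  have "closure W \<subseteq> {x. P x}" using assms(2,3) by (intro closure_minimal) auto
  then show ?thesis using assms(1) by auto
qed

lemma zero_if_orthogonal_dense:
  fixes z :: "'a::real_inner"
  assumes "closure W = UNIV" "\<And>x. x \<in> W \<Longrightarrow> x \<bullet> z = 0"
  shows "z = 0"
proof -
  have "z \<bullet> z = 0"
    by (rule dense_induct[OF assms(1), where P = "\<lambda>x. x \<bullet> z = 0"])
       (auto intro!: closed_Collect_eq continuous_intros assms(2))
  then show ?thesis by simp
qed

lemma bounded_linear_adjoint:
  fixes T :: "'a::{real_inner, complete_space} \<Rightarrow> 'b::real_inner"
  assumes "bounded_linear T"
  shows inner_adjoint: "T x \<bullet> y = x \<bullet> adjoint T y" and "bounded_linear (adjoint T)"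
proof -
  interpret T: bounded_linear T by fact
  have "\<exists>z. \<forall>x. T x \<bullet> y = x \<bullet> z" for y
  proof -
    have "bounded_linear (\<lambda>x. T x \<bullet> y)"
      by (rule bounded_linear_compose[OF bounded_linear_inner_left assms])
    then show ?thesis by (metis riesz inner_commute)
  qed
  then have ex: "\<exists>f. \<forall>x y. T x \<bullet> y = x \<bullet> f y" by metis
  show adj: "T x \<bullet> y = x \<bullet> adjoint T y" for x y
    unfolding adjoint_def by (rule someI_ex[OF ex, THEN spec, THEN spec])
  have ext: "u = v" if "\<And>x. x \<bullet> u = x \<bullet> v" for u v :: 'a
    using that[of "u - v"] by (metis inner_diff_right inner_eq_zero_iff right_minus_eq)
  obtain K where K: "\<And>x. norm (T x) \<le> norm x * K" "0 < K" using T.pos_bounded by auto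
  show "bounded_linear (adjoint T)"
  proof (rule bounded_linear_intro)
    show "adjoint T (x + y) = adjoint T x + adjoint T y" for x y
      by (rule ext) (simp add: adj[symmetric] inner_add_right)
    show "adjoint T (r *\<^sub>R x) = r *\<^sub>R adjoint T x" for r x
      by (rule ext) (simp add: adj[symmetric])
    fix y
    have "(norm (adjoint T y))\<^sup>2 = T (adjoint T y) \<bullet> y" by (simp add: adj power2_norm_eq_inner)
    also have "\<dots> \<le> norm (T (adjoint T y)) * norm y" by (rule norm_cauchy_schwarz)
    also have "\<dots> \<le> norm (adjoint T y) * K * norm y" by (intro mult_right_mono K) auto
    finally show "norm (adjoint T y) \<le> norm y * K"
      by (cases "norm (adjoint T y) = 0") (use K in \<open>auto simp: power2_eq_square mult_ac\<close>)
  qed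
qed

lemma bounded_linear_extension:
  fixes U :: "'c \<Rightarrow> 'a::real_normed_vector"
    and V :: "'c \<Rightarrow> 'b::{real_normed_vector, complete_space}"
  assumes dense: "closure (U ` Z) = UNIV"
    and add: "\<And>x y. x \<in> Z \<Longrightarrow> y \<in> Z \<Longrightarrow> \<exists>z\<in>Z. U z = U x + U y \<and> V z = V x + V y"
    and scale: "\<And>c x. x \<in> Z \<Longrightarrow> \<exists>z\<in>Z. U z = c *\<^sub>R U x \<and> V z = c *\<^sub>R V x"
    and bound: "\<And>x. x \<in> Z \<Longrightarrow> norm (V x) \<le> K * norm (U x)"
  obtains W where "bounded_linear W" "\<And>x. x \<in> Z \<Longrightarrow> W (U x) = V x" "\<And>x. norm (W x) \<le> K * norm x"
proof -
  have diff: "norm (V x - V y) \<le> K * norm (U x - U y)" if xy: "x \<in> Z" "y \<in> Z" for x y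
  proof -
    obtain y' where y': "y' \<in> Z" "U y' = (-1) *\<^sub>R U y" "V y' = (-1) *\<^sub>R V y"
      using scale[OF xy(2), of "-1"] by blast
    obtain z where "z \<in> Z" "U z = U x + U y'" "V z = V x + V y'"
      using add[OF xy(1) y'(1)] by blast
    then show ?thesis using bound[of z] y' by simp
  qed
  have "\<exists>X. (\<forall>n. X n \<in> Z) \<and> (\<lambda>n. U (X n)) \<longlonglongrightarrow> x" for x
  proof -
    have "x \<in> closure (U ` Z)" using dense by simp
    then obtain Y where Y: "\<And>n. Y n \<in> U ` Z" "Y \<longlonglongrightarrow> x" unfolding closure_sequential by blast
    from Y(1) obtain X where "\<And>n. X n \<in> Z" "\<And>n. Y n = U (X n)" unfolding image_iff by metis
    moreover from this have "Y = (\<lambda>n. U (X n))" by auto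
    ultimately show ?thesis using Y(2) by auto
  qed
  then obtain X where X: "\<And>x n. X x n \<in> Z" "\<And>x. (\<lambda>n. U (X x n)) \<longlonglongrightarrow> x" by metis
  have K1: "norm (V x - V y) \<le> (\<bar>K\<bar> + 1) * norm (U x - U y)" if "x \<in> Z" "y \<in> Z" for x y
    by (rule order_trans[OF diff[OF that]]) (intro mult_right_mono, auto)
  have conv: "convergent (\<lambda>n. V (Y n))" if Y: "\<And>n. Y n \<in> Z" "(\<lambda>n. U (Y n)) \<longlonglongrightarrow> x" for Y x
  proof -
    have "Cauchy (\<lambda>n. V (Y n))"
    proof (rule metric_CauchyI)
      fix e :: real assume "0 < e"
      then have "0 < e / (\<bar>K\<bar> + 1)" by simp
      then obtain n0 where n0: "\<And>i j. i \<ge> n0 \<Longrightarrow> j \<ge> n0 \<Longrightarrow> dist (U (Y i)) (U (Y j)) < e / (\<bar>K\<bar> + 1)"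
        using LIMSEQ_imp_Cauchy[OF Y(2)] unfolding Cauchy_def by blast
      have "dist (V (Y i)) (V (Y j)) < e" if "i \<ge> n0" "j \<ge> n0" for i j
      proof -
        have "norm (U (Y i) - U (Y j)) * (\<bar>K\<bar> + 1) < e"
          using n0[OF that] by (simp add: dist_norm field_simps)
        then show ?thesis using K1[OF Y(1) Y(1), of i j] by (simp add: dist_norm mult.commute)
      qed
      then show "\<exists>M. \<forall>m\<ge>M. \<forall>n\<ge>M. dist (V (Y m)) (V (Y n)) < e" by blast
    qed
    then show ?thesis by (simp add: Cauchy_convergent)
  qed
  define W where "W x = lim (\<lambda>n. V (X x n))" for x
  have W0: "(\<lambda>n. V (X x n)) \<longlonglongrightarrow> W x" for x
    unfolding W_def using conv[OF X(1) X(2)] by (simp add: convergent_LIMSEQ_iff)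
  have Wlim: "(\<lambda>n. V (Y n)) \<longlonglongrightarrow> W x" if Y: "\<And>n. Y n \<in> Z" "(\<lambda>n. U (Y n)) \<longlonglongrightarrow> x" for Y x
  proof -
    have "(\<lambda>n. V (Y n) - V (X x n)) \<longlonglongrightarrow> 0"
    proof (rule Lim_null_comparison)
      show "\<forall>\<^sub>F n in sequentially. norm (V (Y n) - V (X x n)) \<le> K * norm (U (Y n) - U (X x n))"
        using diff Y(1) X(1) by simp
      show "(\<lambda>n. K * norm (U (Y n) - U (X x n))) \<longlonglongrightarrow> 0"
        using tendsto_mult_left[OF tendsto_norm[OF tendsto_diff[OF Y(2) X(2)[of x]]], of K] by simp
    qed
    from tendsto_add[OF this W0[of x]] show ?thesis by simp
  qed
  have WU: "W (U x) = V x" if "x \<in> Z" for x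
  proof -
    have "(\<lambda>_. V x) \<longlonglongrightarrow> W (U x)" by (rule Wlim) (use that in auto)
    then show ?thesis by (simp add: LIMSEQ_const_iff)
  qed
  have Wb: "norm (W x) \<le> K * norm x" for x
  proof (rule LIMSEQ_le)
    show "(\<lambda>n. norm (V (X x n))) \<longlonglongrightarrow> norm (W x)" by (intro tendsto_norm W0)
    show "(\<lambda>n. K * norm (U (X x n))) \<longlonglongrightarrow> K * norm x" by (intro tendsto_intros X(2))
    show "\<exists>N. \<forall>n\<ge>N. norm (V (X x n)) \<le> K * norm (U (X x n))" using bound X(1) by blast
  qed
  have "bounded_linear W"
  proof (rule bounded_linear_intro[where K = K])
    fix x y
    have "\<forall>n. \<exists>z\<in>Z. U z = U (X x n) + U (X y n) \<and> V z = V (X x n) + V (X y n)"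
      using add X(1) by blast
    then obtain Y where Y: "\<And>n. Y n \<in> Z" "\<And>n. U (Y n) = U (X x n) + U (X y n)"
      "\<And>n. V (Y n) = V (X x n) + V (X y n)" by metis
    have "(\<lambda>n. V (Y n)) \<longlonglongrightarrow> W (x + y)"
      by (rule Wlim) (use Y X(2) in \<open>auto intro: tendsto_add\<close>)
    moreover have "(\<lambda>n. V (Y n)) \<longlonglongrightarrow> W x + W y"
      using tendsto_add[OF W0[of x] W0[of y]] Y(3) by simp
    ultimately show "W (x + y) = W x + W y" by (rule LIMSEQ_unique)
  next
    fix c x
    have "\<forall>n. \<exists>z\<in>Z. U z = c *\<^sub>R U (X x n) \<and> V z = c *\<^sub>R V (X x n)"
      using scale X(1) by blast
    then obtain Y where Y: "\<And>n. Y n \<in> Z" "\<And>n. U (Y n) = c *\<^sub>R U (X x n)"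
      "\<And>n. V (Y n) = c *\<^sub>R V (X x n)" by metis
    have "(\<lambda>n. V (Y n)) \<longlonglongrightarrow> W (c *\<^sub>R x)"
      by (rule Wlim) (use Y X(2) in \<open>auto intro: tendsto_intros\<close>)
    moreover have "(\<lambda>n. V (Y n)) \<longlonglongrightarrow> c *\<^sub>R W x"
      using tendsto_scaleR[OF tendsto_const W0[of x], of c] Y(3) by simp
    ultimately show "W (c *\<^sub>R x) = c *\<^sub>R W x" by (rule LIMSEQ_unique)
  next
    show "norm (W x) \<le> norm x * K" for x using Wb by (simp add: mult.commute)
  qed
  then show ?thesis using that WU Wb by blast
qed

section \<open>Spectra and polynomials of self-adjoint operators\<close>

definition invertible_op :: "('a::real_inner \<Rightarrow> 'a) \<Rightarrow> bool" where
  "invertible_op S \<longleftrightarrow> (\<exists>R. bounded_linear R \<and> (\<forall>x. R (S x) = x) \<and> (\<forall>x. S (R x) = x))"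

lemma mem_spectrum_iff: "t \<in> spectrum_op S \<longleftrightarrow> \<not> invertible_op (\<lambda>x. S x - t *\<^sub>R x)"
  by (simp add: spectrum_op_def invertible_op_def)

lemma bounded_selfadjoint_linear: "bounded_selfadjoint S \<Longrightarrow> bounded_linear S"
  and bounded_selfadjoint_sym: "bounded_selfadjoint S \<Longrightarrow> S x \<bullet> y = x \<bullet> S y"
  by (simp_all add: bounded_selfadjoint_def)

lemma bounded_selfadjoint_add:
  "bounded_selfadjoint S \<Longrightarrow> bounded_selfadjoint T \<Longrightarrow> bounded_selfadjoint (\<lambda>x. S x + T x)"
  by (simp add: bounded_selfadjoint_def bounded_linear_add inner_add_left inner_add_right)

lemma bounded_selfadjoint_scaleR:
  "bounded_selfadjoint S \<Longrightarrow> bounded_selfadjoint (\<lambda>x. c *\<^sub>R S x)"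
  by (simp add: bounded_selfadjoint_def bounded_linear_const_scaleR)

lemma bounded_selfadjoint_diff_scaleR:
  assumes "bounded_selfadjoint S" shows "bounded_selfadjoint (\<lambda>x. S x - c *\<^sub>R x)"
  using bounded_selfadjoint_add[OF assms bounded_selfadjoint_scaleR[OF bounded_selfadjoint_id, of "- c"]]
  by simp

lemma bounded_selfadjoint_commuting_compose:
  assumes "bounded_selfadjoint S" "bounded_selfadjoint T" "\<And>x. S (T x) = T (S x)"
  shows "bounded_selfadjoint (\<lambda>x. S (T x))"
  using assms bounded_linear_compose[of S T] by (simp add: bounded_selfadjoint_def)

lemma norm_eq_zero_if_all_le:
  fixes x :: "'a::real_normed_vector"
  assumes "\<And>\<epsilon>. 0 < \<epsilon> \<Longrightarrow> norm x \<le> \<epsilon> * C" shows "x = 0"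
proof (rule ccontr)
  assume x: "x \<noteq> 0"
  have "norm x \<le> norm x / (2 * (\<bar>C\<bar> + 1)) * C" using x by (intro assms) simp
  also have "\<dots> \<le> norm x / (2 * (\<bar>C\<bar> + 1)) * (\<bar>C\<bar> + 1)" by (intro mult_left_mono) auto
  also have "\<dots> = norm x / 2" by (simp add: field_simps)
  finally show False using x by simp
qed

lemma invertible_op_bounded_below:
  assumes "invertible_op S"
  obtains \<gamma> where "0 < \<gamma>" "\<And>x. \<gamma> * norm x \<le> norm (S x)"
proof -
  obtain R where R: "bounded_linear R" "\<And>x. R (S x) = x" using assms by (auto simp: invertible_op_def)
  then obtain K where K: "K > 0" "\<And>x. norm (R x) \<le> norm x * K" using bounded_linear.pos_bounded by blast
  have "1 / K * norm x \<le> norm (S x)" for x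
    using K(2)[of "S x"] K(1) by (simp add: R field_simps)
  then show ?thesis using that[of "1 / K"] K by simp
qed

lemma invertible_op_if_bounded_below:
  fixes S :: "'a::{real_inner, complete_space} \<Rightarrow> 'a"
  assumes S: "bounded_selfadjoint S" and \<gamma>: "0 < \<gamma>" and below: "\<And>x. \<gamma> * norm x \<le> norm (S x)"
  shows "invertible_op S"
proof -
  interpret S: bounded_linear S using S by (simp add: bounded_selfadjoint_def)
  have SS: "bounded_selfadjoint (\<lambda>x. S (S x))" by (rule bounded_selfadjoint_commuting_compose) (use S in auto)
  have surj: "\<exists>x. S x = y" for y
  proof -
    obtain z where "\<And>x. x \<in> UNIV \<Longrightarrow> S (S z) \<bullet> x = y \<bullet> x"
    proof (rule coercive_variational[OF SS, where \<gamma> = "\<gamma>\<^sup>2" and W = UNIV and f = "\<lambda>x. y \<bullet> x"])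
      show "\<gamma>\<^sup>2 * (norm x)\<^sup>2 \<le> S (S x) \<bullet> x" for x
      proof -
        have "(\<gamma> * norm x)\<^sup>2 \<le> (norm (S x))\<^sup>2" using below \<gamma> by (intro power_mono) auto
        then show ?thesis
          using bounded_selfadjoint_sym[OF S, of "S x" x] by (simp add: power_mult_distrib power2_norm_eq_inner)
      qed
    qed (use \<gamma> in \<open>auto simp: bounded_linear_inner_right\<close>)
    then have "S (S z) = y" by (metis UNIV_I inner_diff_left inner_eq_zero_iff right_minus_eq)
    then show ?thesis by blast
  qed
  then obtain R where R: "\<And>y. S (R y) = y" by metis
  have inj: "x = y" if "S x = S y" for x y
    using below[of "x - y"] \<gamma> that by (simp add: S.diff mult_le_0_iff)
  have "bounded_linear R"
  proof (rule bounded_linear_intro)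
    show "R (x + y) = R x + R y" for x y by (rule inj) (simp add: R S.add)
    show "R (c *\<^sub>R x) = c *\<^sub>R R x" for c x by (rule inj) (simp add: R S.scaleR)
    show "norm (R x) \<le> norm x * (1 / \<gamma>)" for x
      using below[of "R x"] \<gamma> by (simp add: R field_simps)
  qed
  then show ?thesis unfolding invertible_op_def using R inj by blast
qed

lemma invertible_op_compose:
  assumes "invertible_op S" "invertible_op T"
  shows "invertible_op (\<lambda>x. S (T x))"
proof -
  obtain R where R: "bounded_linear R" "\<And>x. R (S x) = x" "\<And>x. S (R x) = x"
    using assms(1) by (auto simp: invertible_op_def)
  obtain Q where Q: "bounded_linear Q" "\<And>x. Q (T x) = x" "\<And>x. T (Q x) = x"
    using assms(2) by (auto simp: invertible_op_def)
  show ?thesis unfolding invertible_op_def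
    by (rule exI[of _ "\<lambda>x. Q (R x)"]) (use R Q bounded_linear_compose[of Q R] in auto)
qed

lemma approximate_eigenvector:
  fixes S :: "'a::{real_inner, complete_space} \<Rightarrow> 'a"
  assumes S: "bounded_selfadjoint S" and t: "t \<in> spectrum_op S" and e: "0 < \<epsilon>"
  obtains x where "norm x = 1" "norm (S x - t *\<^sub>R x) < \<epsilon>"
proof -
  let ?P = "\<lambda>x. S x - t *\<^sub>R x"
  have P: "bounded_selfadjoint ?P" using S by (rule bounded_selfadjoint_diff_scaleR)
  interpret P: bounded_linear ?P using P by (rule bounded_selfadjoint_linear)
  have "\<not> (\<forall>x. \<epsilon> * norm x \<le> norm (?P x))"
    using invertible_op_if_bounded_below[OF P e] t by (auto simp: mem_spectrum_iff)
  then obtain x where x: "norm (?P x) < \<epsilon> * norm x" by (meson not_le)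
  then have "x \<noteq> 0" by auto
  have "norm (?P ((1 / norm x) *\<^sub>R x)) = norm (?P x) / norm x"
    by (simp only: P.scaleR norm_scaleR, simp)
  also have "\<dots> < \<epsilon>" using x \<open>x \<noteq> 0\<close> by (simp add: field_simps)
  finally have "norm (?P ((1 / norm x) *\<^sub>R x)) < \<epsilon>" .
  then show ?thesis using \<open>x \<noteq> 0\<close> by (intro that[of "(1 / norm x) *\<^sub>R x"]) auto
qed

text \<open>By \<open>approximate_eigenvector\<close> these bounds confine the spectrum to \<open>{l..u}\<close>, and unlike an
  inclusion of spectra they are easily checked and passed to sums and limits.\<close>

definition selfadjoint_between :: "real \<Rightarrow> real \<Rightarrow> ('a::real_inner \<Rightarrow> 'a) \<Rightarrow> bool" where
  "selfadjoint_between l u S \<longleftrightarrow> bounded_selfadjoint S \<and>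
     (\<forall>x. l * (x \<bullet> x) \<le> S x \<bullet> x \<and> S x \<bullet> x \<le> u * (x \<bullet> x))"

lemma selfadjoint_between_selfadjoint: "selfadjoint_between l u S \<Longrightarrow> bounded_selfadjoint S"
  by (simp add: selfadjoint_between_def)

lemma spectrum_subset_if_between:
  fixes S :: "'a::{real_inner, complete_space} \<Rightarrow> 'a"
  assumes S: "selfadjoint_between l u S"
  shows "spectrum_op S \<subseteq> {l..u}"
proof
  fix t assume t: "t \<in> spectrum_op S"
  have SA: "bounded_selfadjoint S" using S by (rule selfadjoint_between_selfadjoint)
  have *: "l - \<epsilon> \<le> t \<and> t \<le> u + \<epsilon>" if e: "0 < \<epsilon>" for \<epsilon>
  proof -
    obtain x where x: "norm x = 1" "norm (S x - t *\<^sub>R x) < \<epsilon>"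
      using approximate_eigenvector[OF SA t e] by blast
    have xx: "x \<bullet> x = 1" using x by (simp add: norm_eq_1)
    have "\<bar>(S x - t *\<^sub>R x) \<bullet> x\<bar> \<le> norm (S x - t *\<^sub>R x) * norm x" by (rule Cauchy_Schwarz_ineq2)
    then have "\<bar>S x \<bullet> x - t\<bar> < \<epsilon>" using x xx by (simp add: inner_diff_left)
    moreover have "l \<le> S x \<bullet> x \<and> S x \<bullet> x \<le> u" using S xx by (metis mult.right_neutral selfadjoint_between_def)
    ultimately show ?thesis by linarith
  qed
  have "l \<le> t" by (rule field_le_epsilon) (use * in \<open>force simp: algebra_simps\<close>)
  moreover have "t \<le> u" by (rule field_le_epsilon) (use * in force)
  ultimately show "t \<in> {l..u}" by simp
qed

lemma norm_le_if_spectrum_subset: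
  fixes P :: "'a::{real_inner, complete_space} \<Rightarrow> 'a"
  assumes P: "bounded_selfadjoint P" and e: "0 \<le> \<epsilon>" and spec: "spectrum_op P \<subseteq> {-\<epsilon>..\<epsilon>}"
  shows "norm (P x) \<le> \<epsilon> * norm x"
proof (rule ccontr)
  assume neg: "\<not> norm (P x) \<le> \<epsilon> * norm x"
  interpret P: bounded_linear P using P by (rule bounded_selfadjoint_linear)
  define k where "k = onorm P"
  have nle: "norm (P x) \<le> k * norm x" for x unfolding k_def by (rule onorm[OF P.bounded_linear_axioms])
  have "x \<noteq> 0" using neg by (auto simp: P.zero)
  have k: "\<epsilon> < k"
  proof (rule ccontr)
    assume "\<not> \<epsilon> < k"
    then have "k * norm x \<le> \<epsilon> * norm x" by (intro mult_right_mono) auto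
    with nle[of x] neg show False by simp
  qed
  have inv: "invertible_op (\<lambda>x. P x - t *\<^sub>R x)" if "t = k \<or> t = - k" for t
  proof -
    have "t \<notin> spectrum_op P" using spec that k e by auto
    then show ?thesis using mem_spectrum_iff by blast
  qed
  have "invertible_op (\<lambda>x. (\<lambda>x. P x - k *\<^sub>R x) ((\<lambda>x. P x - (- k) *\<^sub>R x) x))"
    by (rule invertible_op_compose) (rule inv, simp)+
  then obtain \<gamma> where g: "0 < \<gamma>" "\<And>x. \<gamma> * norm x \<le> norm (P (P x) - (k * k) *\<^sub>R x)"
    by (rule invertible_op_bounded_below) (simp add: P.add P.scaleR algebra_simps)
  have main: "(norm (P x))\<^sup>2 \<le> (k\<^sup>2 - \<gamma>\<^sup>2 / k\<^sup>2) * (norm x)\<^sup>2" for x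
  proof -
    have "(\<gamma> * norm x)\<^sup>2 \<le> (norm (P (P x) - (k * k) *\<^sub>R x))\<^sup>2"
      using g by (intro power_mono) auto
    also have "\<dots> = (norm (P (P x)))\<^sup>2 - 2 * k\<^sup>2 * (P (P x) \<bullet> x) + k^4 * (norm x)\<^sup>2"
      by (simp add: power2_norm_eq_inner inner_diff_left inner_diff_right inner_commute)
        (simp add: algebra_simps power2_eq_square power4_eq_xxxx)
    also have "P (P x) \<bullet> x = (norm (P x))\<^sup>2"
      by (simp add: bounded_selfadjoint_sym[OF P] power2_norm_eq_inner)
    also have "(norm (P (P x)))\<^sup>2 \<le> (k * norm (P x))\<^sup>2" using nle by (intro power_mono) auto
    finally have "\<gamma>\<^sup>2 * (norm x)\<^sup>2 \<le> k\<^sup>2 * (k\<^sup>2 * (norm x)\<^sup>2 - (norm (P x))\<^sup>2)"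
      by (simp add: power_mult_distrib algebra_simps power2_eq_square power4_eq_xxxx)
    then show ?thesis using k e by (simp add: field_simps power2_eq_square)
  qed
  define b where "b = sqrt (max 0 (k\<^sup>2 - \<gamma>\<^sup>2 / k\<^sup>2))"
  have "norm (P x) \<le> b * norm x" for x
  proof (rule power2_le_imp_le)
    have "(k\<^sup>2 - \<gamma>\<^sup>2 / k\<^sup>2) * (norm x)\<^sup>2 \<le> (max 0 (k\<^sup>2 - \<gamma>\<^sup>2 / k\<^sup>2)) * (norm x)\<^sup>2"
      by (intro mult_right_mono) auto
    then show "(norm (P x))\<^sup>2 \<le> (b * norm x)\<^sup>2"
      using main[of x] by (simp add: b_def power_mult_distrib)
  qed (simp add: b_def)
  then have "k \<le> b" unfolding k_def by (intro onorm_bound) (auto simp: b_def)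
  then have "k\<^sup>2 \<le> b\<^sup>2" using k e by (intro power_mono) auto
  also have "\<dots> = max 0 (k\<^sup>2 - \<gamma>\<^sup>2 / k\<^sup>2)" by (simp add: b_def)
  also have "\<dots> < k\<^sup>2" using k e g by simp
  finally show False by simp
qed

lemma spectrum_nonempty:
  fixes P :: "'a::{real_inner, complete_space} \<Rightarrow> 'a"
  assumes P: "bounded_selfadjoint P" and "(x::'a) \<noteq> 0"
  shows "spectrum_op P \<noteq> {}"
proof
  assume empty: "spectrum_op P = {}"
  have "P y = 0" for y using norm_le_if_spectrum_subset[OF P, of 0 y] empty by simp
  moreover have "invertible_op (\<lambda>x. P x - 0 *\<^sub>R x)" using empty mem_spectrum_iff by blast
  ultimately show False using assms(2) by (auto simp: invertible_op_def)
qed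

lemma poly_op_altdef:
  assumes "degree q \<le> n" shows "poly_op q S x = (\<Sum>i\<le>n. coeff q i *\<^sub>R (S ^^ i) x)"
  unfolding poly_op_def
  by (rule sum.mono_neutral_left) (use assms in \<open>auto simp: coeff_eq_0\<close>)

lemma poly_op_0 [simp]: "poly_op 0 S x = 0"
  by (simp add: poly_op_def)

lemma poly_op_pCons:
  assumes "bounded_linear S"
  shows "poly_op (pCons c q) S x = c *\<^sub>R x + S (poly_op q S x)"
proof -
  interpret S: bounded_linear S by fact
  have "poly_op (pCons c q) S x = (\<Sum>i\<le>Suc (degree q). coeff (pCons c q) i *\<^sub>R (S ^^ i) x)"
    by (rule poly_op_altdef) (rule degree_pCons_le)
  also have "\<dots> = c *\<^sub>R x + (\<Sum>i\<le>degree q. coeff q i *\<^sub>R (S ^^ Suc i) x)"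
    by (subst sum.atMost_Suc_shift) simp
  also have "(\<Sum>i\<le>degree q. coeff q i *\<^sub>R (S ^^ Suc i) x) = S (poly_op q S x)"
    by (simp add: poly_op_def S.sum S.scaleR)
  finally show ?thesis .
qed

lemma bounded_linear_poly_op: 
  assumes "bounded_linear S" shows "bounded_linear (poly_op q S)"
proof (induction q)
  case 0
  then show ?case by (simp add: poly_op_def bounded_linear_zero)
next
  case (pCons c q)
  have "poly_op (pCons c q) S = (\<lambda>x. c *\<^sub>R x + S (poly_op q S x))"
    using poly_op_pCons[OF assms] by blast
  moreover have "bounded_linear (\<lambda>x. c *\<^sub>R x + S (poly_op q S x))"
    by (intro bounded_linear_add bounded_linear_scaleR_right bounded_linear_compose[OF assms pCons.IH])
  ultimately show ?case by simp
qed

lemma poly_op_add: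
  assumes "bounded_linear S"
  shows "poly_op (p + q) S x = poly_op p S x + poly_op q S x"
proof (induction p q rule: poly_induct2)
  case 0
  then show ?case by simp
next
  case (pCons a p b q)
  then show ?case
    by (simp add: poly_op_pCons[OF assms] algebra_simps
        bounded_linear.linear[OF assms, THEN linear_add])
qed

lemma poly_op_smult:
  assumes "bounded_linear S"
  shows "poly_op (smult c q) S x = c *\<^sub>R poly_op q S x"
  by (induction q) (simp_all add: poly_op_pCons[OF assms] algebra_simps
        bounded_linear.linear[OF assms, THEN linear_scale])

lemma poly_op_diff:
  assumes "bounded_linear S"
  shows "poly_op (p - q) S x = poly_op p S x - poly_op q S x"
  using poly_op_add[OF assms, of p "- q"] poly_op_smult[OF assms, of "-1" q x] by simp

lemma poly_op_mult:
  assumes "bounded_linear S"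
  shows "poly_op (p * q) S x = poly_op p S (poly_op q S x)"
  by (induction p) (simp_all add: poly_op_pCons[OF assms] poly_op_add[OF assms] poly_op_smult[OF assms])

lemma poly_op_const: "poly_op [:c:] S x = c *\<^sub>R x"
  by (simp add: poly_op_def)

lemma poly_op_linear:
  assumes "bounded_linear S" shows "poly_op [:b, c:] S x = b *\<^sub>R x + c *\<^sub>R S x"
  using assms by (simp add: poly_op_pCons poly_op_const bounded_linear.linear linear_scale linear_0)

lemma poly_op_commute:
  assumes "bounded_linear S"
  shows "S (poly_op q S x) = poly_op q S (S x)"
  using poly_op_mult[OF assms, of "[:0, 1:]" q x] poly_op_mult[OF assms, of q "[:0, 1:]" x]
  by (simp add: poly_op_linear[OF assms] mult.commute)

lemma bounded_selfadjoint_poly_op: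
  assumes S: "bounded_selfadjoint S" shows "bounded_selfadjoint (poly_op q S)"
proof (induction q)
  case 0
  then show ?case by (simp add: poly_op_def bounded_selfadjoint_def bounded_linear_zero)
next
  case (pCons c q)
  note lin = bounded_selfadjoint_linear[OF S]
  have "poly_op (pCons c q) S = (\<lambda>x. c *\<^sub>R x + S (poly_op q S x))"
    using poly_op_pCons[OF lin] by blast
  moreover have "bounded_selfadjoint (\<lambda>x. S (poly_op q S x))"
    by (rule bounded_selfadjoint_commuting_compose[OF S pCons.IH]) (rule poly_op_commute[OF lin])
  then have "bounded_selfadjoint (\<lambda>x. c *\<^sub>R x + S (poly_op q S x))"
    by (rule bounded_selfadjoint_add[OF bounded_selfadjoint_scaleR[OF bounded_selfadjoint_id]])
  ultimately show ?case by (simp only:)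
qed

lemma real_poly_linear_or_quadratic_factor:
  fixes q :: "real poly"
  assumes "0 < degree q"
  obtains b r where "q = [:- b, 1:] * r"
  | b c r where "c \<noteq> 0" "q = [:b\<^sup>2 + c\<^sup>2, - 2 * b, 1:] * r"
proof -
  define ev where "ev q z = poly (map_poly complex_of_real q) z" for q z
  have ev_pCons: "ev (pCons c q) z = complex_of_real c + z * ev q z" for c q z
    by (simp add: ev_def map_poly_pCons)
  have ev_add: "ev (p + q) z = ev p z + ev q z" for p q z
    by (induction p q rule: poly_induct2) (simp_all add: ev_pCons algebra_simps, simp add: ev_def)
  have ev_smult: "ev (smult c q) z = complex_of_real c * ev q z" for c q z
    by (induction q) (simp_all add: ev_pCons algebra_simps, simp add: ev_def)
  have ev_0: "ev 0 z = 0" for z by (simp add: ev_def)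
  have ev_mult: "ev (p * q) z = ev p z * ev q z" for p q z
    by (induction p) (simp_all add: ev_pCons ev_add ev_smult ev_0 algebra_simps)
  have "\<not> constant (poly (map_poly complex_of_real q))"
    using assms by (simp add: constant_degree degree_map_poly)
  then obtain z where z: "ev q z = 0" using fundamental_theorem_of_algebra by (auto simp: ev_def)
  show ?thesis
  proof (cases "Im z = 0")
    case True
    have "ev q (complex_of_real t) = complex_of_real (poly q t)" for t
      by (induction q) (simp_all add: ev_pCons ev_0)
    then have "poly q (Re z) = 0" using z True by (metis complex_is_Real_iff of_real_Re of_real_eq_0_iff)
    then have "[:- Re z, 1:] dvd q" by (simp add: poly_eq_0_iff_dvd)
    then show ?thesis using that(1) by (auto elim!: dvdE)
  next
    case False
    define d where "d = [:(Re z)\<^sup>2 + (Im z)\<^sup>2, - 2 * Re z, 1:]"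
    have dz: "ev d z = 0"
      by (simp add: d_def ev_pCons ev_0 complex_eq_iff algebra_simps power2_eq_square)
    have "degree d = 2" "d \<noteq> 0" by (simp_all add: d_def)
    then have "q mod d = 0 \<or> degree (q mod d) < 2" using degree_mod_less[of d q] by simp
    then have "degree (q mod d) \<le> 1" by auto
    then obtain b c where bc: "q mod d = [:b, c:]"
      by (metis degree1_coeffs degree_eq_zeroE le_neq_implies_less less_one pCons_0_0 pCons_eq_iff)
    have "ev q z = ev (d * (q div d) + q mod d) z" by simp
    then have "ev (q mod d) z = 0" using z dz by (simp only: ev_add ev_mult) simp
    then have "b = 0 \<and> c = 0" using False
      by (auto simp: bc ev_pCons ev_0 complex_eq_iff)
    then have "d dvd q" using bc by (simp add: mod_eq_0_iff_dvd)
    then show ?thesis using that(2)[of "Im z" "Re z"] False by (auto simp: d_def elim!: dvdE)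
  qed
qed

lemma invertible_poly_op:
  fixes S :: "'a::{real_inner, complete_space} \<Rightarrow> 'a"
  assumes S: "bounded_selfadjoint S" and q: "q \<noteq> 0" "\<And>t. t \<in> spectrum_op S \<Longrightarrow> poly q t \<noteq> 0"
  shows "invertible_op (poly_op q S)"
  using q
proof (induction "degree q" arbitrary: q rule: less_induct)
  case less
  note lin = bounded_selfadjoint_linear[OF S]
  have step: "invertible_op (poly_op q S)"
    if d: "q = d * r" "0 < degree d" and inv: "invertible_op (poly_op d S)" for d r
  proof -
    have "d \<noteq> 0" "r \<noteq> 0" using less.prems d by auto
    then have "invertible_op (poly_op r S)"
      using d less.prems by (intro less.hyps) (auto simp: degree_mult_eq)
    moreover have "poly_op q S = (\<lambda>x. poly_op d S (poly_op r S x))"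
      using poly_op_mult[OF lin] d by blast
    ultimately show ?thesis using invertible_op_compose[OF inv] by simp
  qed
  show ?case
  proof (cases "degree q = 0")
    case True
    then obtain c where c: "q = [:c:]" by (rule degree_eq_zeroE)
    then have "c \<noteq> 0" using less.prems by auto
    then show ?thesis unfolding invertible_op_def c
      by (intro exI[of _ "\<lambda>x. (1 / c) *\<^sub>R x"]) (auto simp: poly_op_const bounded_linear_scaleR_right)
  next
    case False
    then have "0 < degree q" by simp
    then show ?thesis
    proof (cases rule: real_poly_linear_or_quadratic_factor)
      case (1 b r)
      have "poly q b = 0" using 1 by simp
      then have "b \<notin> spectrum_op S" using less.prems by blast
      moreover have "poly_op [:- b, 1:] S = (\<lambda>x. S x - b *\<^sub>R x)"
        by (rule ext) (simp add: poly_op_linear[OF lin])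
      ultimately show ?thesis by (intro step[OF 1]) (auto simp: mem_spectrum_iff)
    next
      case (2 b c r)
      let ?P = "\<lambda>x. S x - b *\<^sub>R x"
      have P: "bounded_selfadjoint ?P" using S by (rule bounded_selfadjoint_diff_scaleR)
      have lin_b: "poly_op [:- b, 1:] S x = ?P x" for x by (simp add: poly_op_linear[OF lin])
      have "[:b\<^sup>2 + c\<^sup>2, - 2 * b, 1:] = [:- b, 1:] * [:- b, 1:] + [:c\<^sup>2:]"
        by (simp add: power2_eq_square)
      then have eq: "poly_op [:b\<^sup>2 + c\<^sup>2, - 2 * b, 1:] S x = ?P (?P x) + c\<^sup>2 *\<^sub>R x" for x
        by (simp only: poly_op_add[OF lin] poly_op_mult[OF lin] lin_b poly_op_const)
      have "invertible_op (poly_op [:b\<^sup>2 + c\<^sup>2, - 2 * b, 1:] S)"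
      proof (rule invertible_op_if_bounded_below)
        show "bounded_selfadjoint (poly_op [:b\<^sup>2 + c\<^sup>2, - 2 * b, 1:] S)"
          using S by (rule bounded_selfadjoint_poly_op)
        show "0 < c\<^sup>2" using 2 by simp
        fix x
        let ?y = "poly_op [:b\<^sup>2 + c\<^sup>2, - 2 * b, 1:] S x"
        have "c\<^sup>2 * (norm x)\<^sup>2 \<le> (norm (?P x))\<^sup>2 + c\<^sup>2 * (norm x)\<^sup>2" by simp
        also have "\<dots> = ?y \<bullet> x"
          unfolding eq using bounded_selfadjoint_sym[OF P, of "?P x" x]
          by (simp add: inner_add_left power2_norm_eq_inner)
        also have "\<dots> \<le> norm ?y * norm x" by (rule norm_cauchy_schwarz)
        finally show "c\<^sup>2 * norm x \<le> norm ?y"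
          by (cases "x = 0") (auto simp: power2_eq_square)
      qed
      then show ?thesis by (intro step[OF 2(2)]) auto
    qed
  qed
qed

lemma norm_poly_op_le:
  fixes S :: "'a::{real_inner, complete_space} \<Rightarrow> 'a"
  assumes S: "bounded_selfadjoint S" and e: "0 \<le> \<epsilon>" and q: "\<And>t. t \<in> spectrum_op S \<Longrightarrow> \<bar>poly q t\<bar> \<le> \<epsilon>"
  shows "norm (poly_op q S x) \<le> \<epsilon> * norm x"
proof (rule norm_le_if_spectrum_subset)
  note lin = bounded_selfadjoint_linear[OF S]
  show "bounded_selfadjoint (poly_op q S)" using S by (rule bounded_selfadjoint_poly_op)
  show "spectrum_op (poly_op q S) \<subseteq> {-\<epsilon>..\<epsilon>}"
  proof
    fix t assume t: "t \<in> spectrum_op (poly_op q S)"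
    have ne: "\<exists>x::'a. x \<noteq> 0"
    proof (rule ccontr)
      assume "\<nexists>x::'a. x \<noteq> 0"
      then have eq: "x = y" for x y :: 'a by metis
      have "invertible_op (\<lambda>x::'a. poly_op q S x - t *\<^sub>R x)"
        unfolding invertible_op_def
        by (intro exI[of _ "\<lambda>x. 0"] conjI allI bounded_linear_zero) (rule eq)+
      with t show False by (simp add: mem_spectrum_iff)
    qed
    have "poly_op (q - [:t:]) S = (\<lambda>x. poly_op q S x - t *\<^sub>R x)"
      by (rule ext) (simp add: poly_op_diff[OF lin] poly_op_const)
    then have "\<not> invertible_op (poly_op (q - [:t:]) S)" using t by (simp add: mem_spectrum_iff)
    then consider "q = [:t:]" | s where "s \<in> spectrum_op S" "poly (q - [:t:]) s = 0"
      using invertible_poly_op[OF S, of "q - [:t:]"] by auto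
    then have "\<exists>s\<in>spectrum_op S. poly q s = t"
      using ne spectrum_nonempty[OF S] by cases auto
    then show "t \<in> {-\<epsilon>..\<epsilon>}" using q by fastforce
  qed
qed fact

section \<open>The continuous functional calculus\<close>

lemma real_polynomial_function_poly:
  fixes g :: "real \<Rightarrow> real"
  assumes "real_polynomial_function g"
  obtains q where "\<And>t. g t = poly q t"
proof -
  obtain a n where g: "g = (\<lambda>x. \<Sum>i\<le>n. a i * x ^ i)"
    using assms by (auto simp: real_polynomial_function_iff_sum)
  show ?thesis
    by (rule that[of "\<Sum>i\<le>n. monom (a i) i"]) (simp add: g poly_sum poly_monom)
qed

lemma poly_uniform_approximation:
  fixes f :: "real \<Rightarrow> real"
  assumes "continuous_on {l..u} f" "0 < \<epsilon>"
  obtains q where "\<And>t. t \<in> {l..u} \<Longrightarrow> \<bar>poly q t - f t\<bar> < \<epsilon>"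
proof -
  obtain g where g: "real_polynomial_function g" "\<And>t. t \<in> {l..u} \<Longrightarrow> \<bar>f t - g t\<bar> < \<epsilon>"
    using Stone_Weierstrass_real_polynomial_function[OF _ assms] by (metis compact_Icc)
  obtain q where "\<And>t. g t = poly q t" using real_polynomial_function_poly[OF g(1)] by blast
  then show ?thesis using g(2) that[of q] by (simp add: abs_minus_commute)
qed

lemma poly_uniform_limit:
  fixes f :: "real \<Rightarrow> real"
  assumes f: "continuous_on {l..u} f"
  obtains q where "uniform_limit {l..u} (\<lambda>n. poly (q n)) f sequentially"
proof -
  have "\<exists>q. \<forall>t\<in>{l..u}. \<bar>poly q t - f t\<bar> < 1 / real (Suc n)" for n
    using poly_uniform_approximation[OF f, of "1 / real (Suc n)"] by (metis of_nat_0_less_iff zero_less_Suc zero_less_divide_1_iff)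
  then obtain q where q: "\<And>n t. t \<in> {l..u} \<Longrightarrow> \<bar>poly (q n) t - f t\<bar> < 1 / real (Suc n)" by metis
  have "uniform_limit {l..u} (\<lambda>n. poly (q n)) f sequentially"
  proof (rule uniform_limitI)
    fix e :: real assume "0 < e"
    then have "\<forall>\<^sub>F n in sequentially. 1 / real (Suc n) < e"
      using order_tendstoD(2)[OF LIMSEQ_inverse_real_of_nat] by (simp add: inverse_eq_divide)
    then show "\<forall>\<^sub>F n in sequentially. \<forall>t\<in>{l..u}. dist (poly (q n) t) (f t) < e"
      by eventually_elim (auto simp: dist_real_def intro: less_trans[OF q])
  qed
  then show ?thesis by (rule that)
qed

lemma fun_calc_unique:
  fixes S :: "'a::{real_inner, complete_space} \<Rightarrow> 'a"
  assumes S: "bounded_selfadjoint S" and F: "bounded_linear F"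
    and approx: "\<And>\<epsilon>. 0 < \<epsilon> \<Longrightarrow> \<exists>q. (\<forall>t\<in>spectrum_op S. \<bar>poly q t - f t\<bar> \<le> \<epsilon>) \<and>
               (\<forall>x. norm (poly_op q S x - F x) \<le> \<epsilon> * norm x)"
  shows "fun_calc f S = F"
  unfolding fun_calc_def
proof (rule the_equality)
  fix F' assume F': "bounded_linear F' \<and> (\<forall>\<epsilon>>0. \<exists>q. (\<forall>t\<in>spectrum_op S. \<bar>poly q t - f t\<bar> \<le> \<epsilon>) \<and>
               (\<forall>x. norm (poly_op q S x - F' x) \<le> \<epsilon> * norm x))"
  show "F' = F"
  proof
    fix x
    have "F' x - F x = 0"
    proof (rule norm_eq_zero_if_all_le[where C = "4 * norm x"])
      fix \<epsilon> :: real assume e: "0 < \<epsilon>"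
      obtain q where q: "\<And>t. t \<in> spectrum_op S \<Longrightarrow> \<bar>poly q t - f t\<bar> \<le> \<epsilon>"
        "norm (poly_op q S x - F x) \<le> \<epsilon> * norm x" using approx[OF e] by blast
      obtain r where r: "\<And>t. t \<in> spectrum_op S \<Longrightarrow> \<bar>poly r t - f t\<bar> \<le> \<epsilon>"
        "norm (poly_op r S x - F' x) \<le> \<epsilon> * norm x" using F' e by blast
      have "norm (poly_op (q - r) S x) \<le> (2 * \<epsilon>) * norm x"
      proof (rule norm_poly_op_le[OF S])
        fix t assume "t \<in> spectrum_op S"
        then show "\<bar>poly (q - r) t\<bar> \<le> 2 * \<epsilon>" using q(1)[of t] r(1)[of t] by (simp add: abs_le_iff)
      qed (use e in simp)
      then have "norm (poly_op q S x - poly_op r S x) \<le> (2 * \<epsilon>) * norm x"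
        by (simp add: poly_op_diff[OF bounded_selfadjoint_linear[OF S]])
      moreover have "F' x - F x = (poly_op q S x - F x) - (poly_op r S x - F' x) - (poly_op q S x - poly_op r S x)"
        by simp
      then have "norm (F' x - F x) \<le> norm (poly_op q S x - F x) + norm (poly_op r S x - F' x)
          + norm (poly_op q S x - poly_op r S x)"
        by (metis (no_types, lifting) norm_triangle_ineq4 order_trans add_right_mono)
      ultimately show "norm (F' x - F x) \<le> \<epsilon> * (4 * norm x)" using q(2) r(2) by simp
    qed
    then show "F' x = F x" by simp
  qed
qed (use F approx in blast)

lemma fun_calc_approx:
  fixes S :: "'a::{real_inner, complete_space} \<Rightarrow> 'a"
  assumes S: "selfadjoint_between l u S" and f: "continuous_on {l..u} f"
  shows bounded_linear_fun_calc: "bounded_linear (fun_calc f S)"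
    and norm_poly_op_diff_fun_calc: "\<And>q \<epsilon> x. 0 \<le> \<epsilon> \<Longrightarrow> (\<And>t. t \<in> {l..u} \<Longrightarrow> \<bar>poly q t - f t\<bar> \<le> \<epsilon>) \<Longrightarrow>
          norm (poly_op q S x - fun_calc f S x) \<le> \<epsilon> * norm x"
proof -
  have SA: "bounded_selfadjoint S" using S by (rule selfadjoint_between_selfadjoint)
  note lin = bounded_selfadjoint_linear[OF SA]
  have spec: "spectrum_op S \<subseteq> {l..u}" using S by (rule spectrum_subset_if_between)
  have close: "norm (poly_op q S x - poly_op r S x) \<le> (\<epsilon> + \<eta>) * norm x"
    if "\<And>t. t \<in> {l..u} \<Longrightarrow> \<bar>poly q t - f t\<bar> \<le> \<epsilon>" "\<And>t. t \<in> {l..u} \<Longrightarrow> \<bar>poly r t - f t\<bar> \<le> \<eta>" "0 \<le> \<epsilon>" "0 \<le> \<eta>"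
    for q r \<epsilon> \<eta> x
  proof -
    have "norm (poly_op (q - r) S x) \<le> (\<epsilon> + \<eta>) * norm x"
    proof (rule norm_poly_op_le[OF SA])
      fix t assume "t \<in> spectrum_op S"
      then have "t \<in> {l..u}" using spec by blast
      then show "\<bar>poly (q - r) t\<bar> \<le> \<epsilon> + \<eta>" using that(1)[of t] that(2)[of t] by (simp add: abs_le_iff)
    qed (use that in simp)
    then show ?thesis by (simp add: poly_op_diff[OF lin])
  qed
  define e :: "nat \<Rightarrow> real" where "e n = 1 / real (Suc n)" for n
  have e: "0 < e n" for n by (simp add: e_def)
  have e0: "e \<longlonglongrightarrow> 0" unfolding e_def using LIMSEQ_inverse_real_of_nat by (simp add: inverse_eq_divide)
  have "\<exists>q. \<forall>t\<in>{l..u}. \<bar>poly q t - f t\<bar> \<le> e n" for n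
  proof -
    obtain q where "\<And>t. t \<in> {l..u} \<Longrightarrow> \<bar>poly q t - f t\<bar> < e n"
      using poly_uniform_approximation[OF f e] by blast
    then show ?thesis by (intro exI[of _ q]) (auto intro: less_imp_le)
  qed
  then obtain q where q: "\<And>n t. t \<in> {l..u} \<Longrightarrow> \<bar>poly (q n) t - f t\<bar> \<le> e n" by metis
  have "Cauchy (\<lambda>n. poly_op (q n) S x)" for x
  proof (rule metric_CauchyI)
    fix d :: real assume d: "0 < d"
    have "(\<lambda>n. e n * norm x) \<longlonglongrightarrow> 0" using tendsto_mult_right[OF e0, of "norm x"] by simp
    then have "\<forall>\<^sub>F n in sequentially. e n * norm x < d / 2" using d by (intro order_tendstoD(2)) auto
    then obtain N where N: "\<And>n. n \<ge> N \<Longrightarrow> e n * norm x < d / 2" by (auto simp: eventually_sequentially)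
    have "dist (poly_op (q i) S x) (poly_op (q j) S x) < d" if "i \<ge> N" "j \<ge> N" for i j
      using close[OF q q, of i j x] e[of i] e[of j] N[OF that(1)] N[OF that(2)]
      by (simp add: dist_norm algebra_simps)
    then show "\<exists>M. \<forall>m\<ge>M. \<forall>n\<ge>M. dist (poly_op (q m) S x) (poly_op (q n) S x) < d" by blast
  qed
  then have "\<exists>y. (\<lambda>n. poly_op (q n) S x) \<longlonglongrightarrow> y" for x using Cauchy_convergent convergent_def by blast
  then obtain F where F: "\<And>x. (\<lambda>n. poly_op (q n) S x) \<longlonglongrightarrow> F x" by metis
  have Fclose: "norm (poly_op r S x - F x) \<le> \<epsilon> * norm x"
    if "\<And>t. t \<in> {l..u} \<Longrightarrow> \<bar>poly r t - f t\<bar> \<le> \<epsilon>" "0 \<le> \<epsilon>" for r \<epsilon> x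
  proof (rule LIMSEQ_le)
    show "(\<lambda>n. norm (poly_op r S x - poly_op (q n) S x)) \<longlonglongrightarrow> norm (poly_op r S x - F x)"
      by (intro tendsto_intros F)
    have "(\<lambda>n. (\<epsilon> + e n) * norm x) \<longlonglongrightarrow> (\<epsilon> + 0) * norm x" by (intro tendsto_intros e0)
    then show "(\<lambda>n. (\<epsilon> + e n) * norm x) \<longlonglongrightarrow> \<epsilon> * norm x" by simp
    show "\<exists>N. \<forall>n\<ge>N. norm (poly_op r S x - poly_op (q n) S x) \<le> (\<epsilon> + e n) * norm x"
      using close[OF that(1) q that(2)] e by (simp add: less_imp_le)
  qed
  have lin_n: "bounded_linear (poly_op (q n) S)" for n using lin by (rule bounded_linear_poly_op)
  obtain K where K: "\<And>x. norm (poly_op (q 0) S x) \<le> norm x * K" using lin_n bounded_linear.bounded by blast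
  have blF: "bounded_linear F"
  proof (rule bounded_linear_intro)
    fix x y
    have "(\<lambda>n. poly_op (q n) S (x + y)) \<longlonglongrightarrow> F x + F y"
      using tendsto_add[OF F[of x] F[of y]] lin_n by (simp add: linear_add bounded_linear.linear)
    then show "F (x + y) = F x + F y" using F LIMSEQ_unique by blast
  next
    fix c x
    have "(\<lambda>n. poly_op (q n) S (c *\<^sub>R x)) \<longlonglongrightarrow> c *\<^sub>R F x"
      using tendsto_scaleR[OF tendsto_const F[of x], of c] lin_n by (simp add: linear_scale bounded_linear.linear)
    then show "F (c *\<^sub>R x) = c *\<^sub>R F x" using F LIMSEQ_unique by blast
  next
    fix x
    have "norm (F x) \<le> norm (poly_op (q 0) S x) + norm (poly_op (q 0) S x - F x)"
      by (metis norm_triangle_sub norm_minus_commute)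
    also have "\<dots> \<le> norm x * K + e 0 * norm x" using K[of x] Fclose[OF q, of 0 x] e[of 0] by simp
    finally show "norm (F x) \<le> norm x * (K + e 0)" by (simp add: algebra_simps)
  qed
  have eq: "fun_calc f S = F"
  proof (rule fun_calc_unique[OF SA blF])
    fix \<epsilon> :: real assume "0 < \<epsilon>"
    then obtain r where r: "\<And>t. t \<in> {l..u} \<Longrightarrow> \<bar>poly r t - f t\<bar> < \<epsilon>"
      using poly_uniform_approximation[OF f] by blast
    then have "\<bar>poly r t - f t\<bar> \<le> \<epsilon>" if "t \<in> {l..u}" for t using that by (simp add: less_imp_le)
    then show "\<exists>q. (\<forall>t\<in>spectrum_op S. \<bar>poly q t - f t\<bar> \<le> \<epsilon>) \<and>
               (\<forall>x. norm (poly_op q S x - F x) \<le> \<epsilon> * norm x)"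
      using Fclose[of r \<epsilon>] spec \<open>0 < \<epsilon>\<close> by (intro exI[of _ r]) auto
  qed
  show "bounded_linear (fun_calc f S)" using eq blF by simp
  show "norm (poly_op q S x - fun_calc f S x) \<le> \<epsilon> * norm x"
    if "0 \<le> \<epsilon>" "\<And>t. t \<in> {l..u} \<Longrightarrow> \<bar>poly q t - f t\<bar> \<le> \<epsilon>" for q \<epsilon> x
    unfolding eq using that by (intro Fclose)
qed

lemma fun_calc_tendsto:
  fixes S :: "'a::{real_inner, complete_space} \<Rightarrow> 'a"
  assumes S: "selfadjoint_between l u S" and f: "continuous_on {l..u} f"
    and q: "uniform_limit {l..u} (\<lambda>n. poly (q n)) f sequentially" and X: "X \<longlonglongrightarrow> x"
  shows "(\<lambda>n. poly_op (q n) S (X n)) \<longlonglongrightarrow> fun_calc f S x"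
proof -
  interpret F: bounded_linear "fun_calc f S" using S f by (rule bounded_linear_fun_calc)
  have "(\<lambda>n. poly_op (q n) S (X n) - fun_calc f S (X n)) \<longlonglongrightarrow> 0"
  proof (rule tendstoI)
    fix e :: real assume e: "0 < e"
    define C where "C = norm x + 1"
    have C: "C > 0" by (simp add: C_def add_nonneg_pos)
    have "\<forall>\<^sub>F n in sequentially. norm (X n) < C"
      using tendsto_norm[OF X] by (rule order_tendstoD) (simp add: C_def)
    moreover have "\<forall>\<^sub>F n in sequentially. \<forall>t\<in>{l..u}. dist (poly (q n) t) (f t) < e / C"
      using q by (rule uniform_limitD) (use e C in simp)
    ultimately show "\<forall>\<^sub>F n in sequentially. dist (poly_op (q n) S (X n) - fun_calc f S (X n)) 0 < e"
    proof eventually_elim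
      case (elim n)
      have "norm (poly_op (q n) S (X n) - fun_calc f S (X n)) \<le> e / C * norm (X n)"
        by (rule norm_poly_op_diff_fun_calc[OF S f]) (use elim e C in \<open>auto simp: dist_real_def less_imp_le\<close>)
      also have "\<dots> < e / C * C" using elim e C by (intro mult_strict_left_mono) auto
      finally show ?case using C by simp
    qed
  qed
  from tendsto_add[OF this F.tendsto[OF X]] show ?thesis by simp
qed

lemma fun_calc_eqI:
  fixes S :: "'a::{real_inner, complete_space} \<Rightarrow> 'a"
  assumes "selfadjoint_between l u S" "continuous_on {l..u} f"
    and "uniform_limit {l..u} (\<lambda>n. poly (q n)) f sequentially" "(\<lambda>n. poly_op (q n) S x) \<longlonglongrightarrow> y"
  shows "fun_calc f S x = y"
  using fun_calc_tendsto[OF assms(1-3) tendsto_const] assms(4) by (rule LIMSEQ_unique)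

lemma fun_calc_cong:
  fixes S :: "'a::{real_inner, complete_space} \<Rightarrow> 'a"
  assumes "selfadjoint_between l u S" "\<And>t. t \<in> {l..u} \<Longrightarrow> f t = g t"
  shows "fun_calc f S = fun_calc g S"
proof -
  have "\<And>t. t \<in> spectrum_op S \<Longrightarrow> f t = g t" using assms spectrum_subset_if_between by blast
  then show ?thesis unfolding fun_calc_def by (simp cong: ball_cong)
qed

lemma fun_calc_poly:
  fixes S :: "'a::{real_inner, complete_space} \<Rightarrow> 'a"
  assumes "selfadjoint_between l u S"
  shows "fun_calc (poly q) S x = poly_op q S x"
  by (rule fun_calc_eqI[OF assms, where q = "\<lambda>_. q"]) (auto intro: continuous_intros uniform_limit_const)

lemma fun_calc_const:
  fixes S :: "'a::{real_inner, complete_space} \<Rightarrow> 'a"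
  assumes "selfadjoint_between l u S"
  shows "fun_calc (\<lambda>t. c) S x = c *\<^sub>R x"
proof -
  have "poly [:c:] = (\<lambda>t. c)" by auto
  then show ?thesis using fun_calc_poly[OF assms, of "[:c:]" x] by (simp add: poly_op_const)
qed

lemma fun_calc_ident:
  fixes S :: "'a::{real_inner, complete_space} \<Rightarrow> 'a"
  assumes "selfadjoint_between l u S"
  shows "fun_calc (\<lambda>t. t) S x = S x"
proof -
  have "poly [:0, 1:] = (\<lambda>t::real. t)" by auto
  then show ?thesis using fun_calc_poly[OF assms, of "[:0, 1:]" x]
    by (simp add: poly_op_linear[OF bounded_selfadjoint_linear[OF selfadjoint_between_selfadjoint[OF assms]]])
qed

lemma fun_calc_add:
  fixes S :: "'a::{real_inner, complete_space} \<Rightarrow> 'a"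
  assumes S: "selfadjoint_between l u S" and f: "continuous_on {l..u} f" and g: "continuous_on {l..u} g"
  shows "fun_calc (\<lambda>t. f t + g t) S x = fun_calc f S x + fun_calc g S x"
proof -
  obtain p where p: "uniform_limit {l..u} (\<lambda>n. poly (p n)) f sequentially"
    using poly_uniform_limit[OF f] by blast
  obtain q where q: "uniform_limit {l..u} (\<lambda>n. poly (q n)) g sequentially"
    using poly_uniform_limit[OF g] by blast
  show ?thesis
  proof (rule fun_calc_eqI[OF S, where q = "\<lambda>n. p n + q n"])
    show "uniform_limit {l..u} (\<lambda>n. poly (p n + q n)) (\<lambda>t. f t + g t) sequentially"
      using uniform_limit_add[OF p q] by (simp add: poly_add[abs_def])
    show "(\<lambda>n. poly_op (p n + q n) S x) \<longlonglongrightarrow> fun_calc f S x + fun_calc g S x"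
      using tendsto_add[OF fun_calc_tendsto[OF S f p tendsto_const, of x] fun_calc_tendsto[OF S g q tendsto_const, of x]]
      by (simp add: poly_op_add[OF bounded_selfadjoint_linear[OF selfadjoint_between_selfadjoint[OF S]]])
  qed (intro continuous_intros f g)
qed

lemma fun_calc_mult:
  fixes S :: "'a::{real_inner, complete_space} \<Rightarrow> 'a"
  assumes S: "selfadjoint_between l u S" and f: "continuous_on {l..u} f" and g: "continuous_on {l..u} g"
  shows "fun_calc (\<lambda>t. f t * g t) S x = fun_calc f S (fun_calc g S x)"
proof -
  obtain p where p: "uniform_limit {l..u} (\<lambda>n. poly (p n)) f sequentially"
    using poly_uniform_limit[OF f] by blast
  obtain q where q: "uniform_limit {l..u} (\<lambda>n. poly (q n)) g sequentially"
    using poly_uniform_limit[OF g] by blast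
  have bounded: "bounded (f ` {l..u})" "bounded (g ` {l..u})"
    using f g by (auto intro!: compact_imp_bounded compact_continuous_image)
  show ?thesis
  proof (rule fun_calc_eqI[OF S, where q = "\<lambda>n. p n * q n"])
    show "uniform_limit {l..u} (\<lambda>n. poly (p n * q n)) (\<lambda>t. f t * g t) sequentially"
      using uniform_lim_mult[OF p q bounded] by (simp add: poly_mult[abs_def])
    show "(\<lambda>n. poly_op (p n * q n) S x) \<longlonglongrightarrow> fun_calc f S (fun_calc g S x)"
      using fun_calc_tendsto[OF S f p fun_calc_tendsto[OF S g q tendsto_const, of x]]
      by (simp add: poly_op_mult[OF bounded_selfadjoint_linear[OF selfadjoint_between_selfadjoint[OF S]]])
  qed (intro continuous_intros f g)
qed

lemma fun_calc_scale:
  fixes S :: "'a::{real_inner, complete_space} \<Rightarrow> 'a"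
  assumes S: "selfadjoint_between l u S" and f: "continuous_on {l..u} f"
  shows "fun_calc (\<lambda>t. c * f t) S x = c *\<^sub>R fun_calc f S x"
  using fun_calc_mult[OF S _ f, of "\<lambda>_. c" x] by (simp add: fun_calc_const[OF S])

lemma fun_calc_diff:
  fixes S :: "'a::{real_inner, complete_space} \<Rightarrow> 'a"
  assumes S: "selfadjoint_between l u S" and f: "continuous_on {l..u} f" and g: "continuous_on {l..u} g"
  shows "fun_calc (\<lambda>t. f t - g t) S x = fun_calc f S x - fun_calc g S x"
  using fun_calc_add[OF S f, of "\<lambda>t. - 1 * g t" x] fun_calc_scale[OF S g, of "-1" x] g
  by (simp add: continuous_intros)

lemma bounded_selfadjoint_fun_calc:
  fixes S :: "'a::{real_inner, complete_space} \<Rightarrow> 'a"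
  assumes S: "selfadjoint_between l u S" and f: "continuous_on {l..u} f"
  shows "bounded_selfadjoint (fun_calc f S)"
proof -
  obtain q where q: "uniform_limit {l..u} (\<lambda>n. poly (q n)) f sequentially"
    using poly_uniform_limit[OF f] by blast
  note lim = fun_calc_tendsto[OF S f q tendsto_const]
  have "fun_calc f S x \<bullet> y = x \<bullet> fun_calc f S y" for x y
  proof (rule LIMSEQ_unique)
    show "(\<lambda>n. poly_op (q n) S x \<bullet> y) \<longlonglongrightarrow> fun_calc f S x \<bullet> y" by (intro tendsto_intros lim)
    have "(\<lambda>n. x \<bullet> poly_op (q n) S y) \<longlonglongrightarrow> x \<bullet> fun_calc f S y" by (intro tendsto_intros lim)
    then show "(\<lambda>n. poly_op (q n) S x \<bullet> y) \<longlonglongrightarrow> x \<bullet> fun_calc f S y"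
      by (simp add: bounded_selfadjoint_sym[OF bounded_selfadjoint_poly_op[OF selfadjoint_between_selfadjoint[OF S]]])
  qed
  then show ?thesis using bounded_linear_fun_calc[OF S f] by (simp add: bounded_selfadjoint_def)
qed

lemma norm_fun_calc_square:
  fixes S :: "'a::{real_inner, complete_space} \<Rightarrow> 'a"
  assumes S: "selfadjoint_between l u S" and f: "continuous_on {l..u} f"
  shows "(norm (fun_calc f S x))\<^sup>2 = fun_calc (\<lambda>t. (f t)\<^sup>2) S x \<bullet> x"
proof -
  have "fun_calc f S x \<bullet> fun_calc f S x = fun_calc f S (fun_calc f S x) \<bullet> x"
    by (simp add: bounded_selfadjoint_sym[OF bounded_selfadjoint_fun_calc[OF S f]])
  then show ?thesis
    using fun_calc_mult[OF S f f, of x] unfolding power2_norm_eq_inner by (simp add: power2_eq_square)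
qed

lemma fun_calc_nonneg:
  fixes S :: "'a::{real_inner, complete_space} \<Rightarrow> 'a"
  assumes S: "selfadjoint_between l u S" and f: "continuous_on {l..u} f"
    and nonneg: "\<And>t. t \<in> {l..u} \<Longrightarrow> 0 \<le> f t"
  shows "0 \<le> fun_calc f S x \<bullet> x"
proof -
  have "fun_calc f S = fun_calc (\<lambda>t. (sqrt (f t))\<^sup>2) S"
    by (rule fun_calc_cong[OF S]) (use nonneg in simp)
  moreover have "continuous_on {l..u} (\<lambda>t. sqrt (f t))" by (intro continuous_intros f)
  ultimately show ?thesis using norm_fun_calc_square[OF S, of "\<lambda>t. sqrt (f t)" x] by (metis zero_le_power2)
qed

lemma fun_calc_mono:
  fixes S :: "'a::{real_inner, complete_space} \<Rightarrow> 'a"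
  assumes S: "selfadjoint_between l u S" and f: "continuous_on {l..u} f" and g: "continuous_on {l..u} g"
    and le: "\<And>t. t \<in> {l..u} \<Longrightarrow> f t \<le> g t"
  shows "fun_calc f S x \<bullet> x \<le> fun_calc g S x \<bullet> x"
  using fun_calc_nonneg[OF S, of "\<lambda>t. g t - f t" x] le f g
  by (simp add: continuous_intros fun_calc_diff[OF S g f] inner_diff_left)

lemma norm_fun_calc_mono:
  fixes S :: "'a::{real_inner, complete_space} \<Rightarrow> 'a"
  assumes S: "selfadjoint_between l u S" and f: "continuous_on {l..u} f" and g: "continuous_on {l..u} g"
    and le: "\<And>t. t \<in> {l..u} \<Longrightarrow> \<bar>f t\<bar> \<le> \<bar>g t\<bar>"
  shows "norm (fun_calc f S x) \<le> norm (fun_calc g S x)"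
proof (rule power2_le_imp_le)
  show "(norm (fun_calc f S x))\<^sup>2 \<le> (norm (fun_calc g S x))\<^sup>2"
    unfolding norm_fun_calc_square[OF S f] norm_fun_calc_square[OF S g]
    by (rule fun_calc_mono[OF S]) (use f g le in \<open>auto intro!: continuous_intros simp: abs_le_square_iff\<close>)
qed simp

lemma norm_fun_calc_le:
  fixes S :: "'a::{real_inner, complete_space} \<Rightarrow> 'a"
  assumes S: "selfadjoint_between l u S" and f: "continuous_on {l..u} f"
    and le: "\<And>t. t \<in> {l..u} \<Longrightarrow> \<bar>f t\<bar> \<le> k" and k: "0 \<le> k"
  shows "norm (fun_calc f S x) \<le> k * norm x"
  using norm_fun_calc_mono[OF S f, of "\<lambda>_. k" x] le k by (simp add: fun_calc_const[OF S])

lemma selfadjoint_between_fun_calc: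
  fixes S :: "'a::{real_inner, complete_space} \<Rightarrow> 'a"
  assumes S: "selfadjoint_between l u S" and f: "continuous_on {l..u} f"
    and le: "\<And>t. t \<in> {l..u} \<Longrightarrow> l' \<le> f t \<and> f t \<le> u'"
  shows "selfadjoint_between l' u' (fun_calc f S)"
  using bounded_selfadjoint_fun_calc[OF S f] le
    fun_calc_mono[OF S _ f, of "\<lambda>_. l'"] fun_calc_mono[OF S f, of "\<lambda>_. u'"]
  by (simp add: selfadjoint_between_def fun_calc_const[OF S])

lemma fun_calc_compose:
  fixes S :: "'a::{real_inner, complete_space} \<Rightarrow> 'a"
  assumes S: "selfadjoint_between l u S" and g: "continuous_on {l..u} g"
    and maps: "\<And>t. t \<in> {l..u} \<Longrightarrow> g t \<in> {l'..u'}" and f: "continuous_on {l'..u'} f"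
  shows "fun_calc f (fun_calc g S) x = fun_calc (\<lambda>t. f (g t)) S x"
proof -
  have gS: "selfadjoint_between l' u' (fun_calc g S)"
    by (rule selfadjoint_between_fun_calc[OF S g]) (use maps in auto)
  have fg: "continuous_on {l..u} (\<lambda>t. f (g t))"
    by (rule continuous_on_compose2[OF f g]) (use maps in auto)
  note lin = bounded_linear_fun_calc[OF S g]
  have poly: "poly_op q (fun_calc g S) x = fun_calc (\<lambda>t. poly q (g t)) S x" for q x
  proof (induction q)
    case 0
    then show ?case using fun_calc_const[OF S, of 0 x] by simp
  next
    case (pCons c q)
    have cont: "continuous_on {l..u} (\<lambda>t. poly q (g t))" by (intro continuous_intros g)
    then show ?case
      using fun_calc_add[OF S, of "\<lambda>_. c" "\<lambda>t. g t * poly q (g t)" x] fun_calc_mult[OF S g cont, of x] pCons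
      by (simp add: poly_op_pCons[OF lin] fun_calc_const[OF S] continuous_intros g)
  qed
  obtain q where q: "uniform_limit {l'..u'} (\<lambda>n. poly (q n)) f sequentially"
    using poly_uniform_limit[OF f] by blast
  have "(\<lambda>n. poly_op (q n) (fun_calc g S) x - fun_calc (\<lambda>t. f (g t)) S x) \<longlonglongrightarrow> 0"
  proof (rule tendstoI)
    fix e :: real assume e: "0 < e"
    define C where "C = norm x + 1"
    have C: "C > 0" by (simp add: C_def add_nonneg_pos)
    have "\<forall>\<^sub>F n in sequentially. \<forall>t\<in>{l'..u'}. dist (poly (q n) t) (f t) < e / C"
      using q by (rule uniform_limitD) (use e C in simp)
    then show "\<forall>\<^sub>F n in sequentially. dist (poly_op (q n) (fun_calc g S) x - fun_calc (\<lambda>t. f (g t)) S x) 0 < e"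
    proof eventually_elim
      case (elim n)
      have cont: "continuous_on {l..u} (\<lambda>t. poly (q n) (g t))" by (intro continuous_intros g)
      have "norm (fun_calc (\<lambda>t. poly (q n) (g t) - f (g t)) S x) \<le> e / C * norm x"
        by (rule norm_fun_calc_le[OF S])
           (use elim e C maps in \<open>auto intro!: continuous_intros cont fg simp: dist_real_def less_imp_le\<close>)
      also have "\<dots> < e / C * C" using e C by (intro mult_strict_left_mono) (auto simp: C_def)
      finally show ?case using C by (simp add: poly fun_calc_diff[OF S cont fg])
    qed
  qed
  then have "(\<lambda>n. poly_op (q n) (fun_calc g S) x) \<longlonglongrightarrow> fun_calc (\<lambda>t. f (g t)) S x"
    by (simp add: LIM_zero_iff)
  then show ?thesis by (rule fun_calc_eqI[OF gS f q])
qed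

lemma fun_calc_approximate_eigenvector:
  fixes S :: "'a::{real_inner, complete_space} \<Rightarrow> 'a"
  assumes S: "selfadjoint_between l u S" and f: "continuous_on {l..u} f" and t: "t \<in> {l..u}"
    and X: "\<And>n. norm (X n) = 1" "(\<lambda>n. S (X n) - t *\<^sub>R X n) \<longlonglongrightarrow> 0"
  shows "(\<lambda>n. fun_calc f S (X n) - f t *\<^sub>R X n) \<longlonglongrightarrow> 0"
proof (rule tendstoI)
  fix e :: real assume e: "0 < e"
  have SA: "bounded_selfadjoint S" using S by (rule selfadjoint_between_selfadjoint)
  interpret S: bounded_linear S using SA by (rule bounded_selfadjoint_linear)
  have poly: "(\<lambda>n. poly_op q S (X n) - poly q t *\<^sub>R X n) \<longlonglongrightarrow> 0" for q
  proof (induction q)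
    case 0
    then show ?case by simp
  next
    case (pCons c q)
    have "(\<lambda>n. S (poly_op q S (X n) - poly q t *\<^sub>R X n) + poly q t *\<^sub>R (S (X n) - t *\<^sub>R X n)) \<longlonglongrightarrow> S 0 + poly q t *\<^sub>R 0"
      by (intro tendsto_intros S.tendsto pCons.IH X(2))
    moreover have "poly_op (pCons c q) S (X n) - poly (pCons c q) t *\<^sub>R X n =
        S (poly_op q S (X n) - poly q t *\<^sub>R X n) + poly q t *\<^sub>R (S (X n) - t *\<^sub>R X n)" for n
      by (simp add: poly_op_pCons[OF S.bounded_linear_axioms] S.diff S.scaleR algebra_simps)
    ultimately show ?case by (simp add: S.zero)
  qed
  have "0 < e / 3" using e by simp
  then obtain q where q: "\<And>t. t \<in> {l..u} \<Longrightarrow> \<bar>poly q t - f t\<bar> < e / 3"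
    using poly_uniform_approximation[OF f] by blast
  have "\<forall>\<^sub>F n in sequentially. norm (poly_op q S (X n) - poly q t *\<^sub>R X n) < e / 3"
    using tendstoD[OF poly \<open>0 < e / 3\<close>] by simp
  then show "\<forall>\<^sub>F n in sequentially. dist (fun_calc f S (X n) - f t *\<^sub>R X n) 0 < e"
  proof eventually_elim
    case (elim n)
    have 1: "norm (poly_op q S (X n) - fun_calc f S (X n)) \<le> e / 3 * norm (X n)"
      by (rule norm_poly_op_diff_fun_calc[OF S f]) (use q e in \<open>auto simp: less_imp_le\<close>)
    have 2: "norm (poly q t *\<^sub>R X n - f t *\<^sub>R X n) < e / 3"
      using q[OF t] X(1) by (simp flip: scaleR_diff_left)
    have "fun_calc f S (X n) - f t *\<^sub>R X n = (poly_op q S (X n) - poly q t *\<^sub>R X n)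
        + (poly q t *\<^sub>R X n - f t *\<^sub>R X n) - (poly_op q S (X n) - fun_calc f S (X n))" by simp
    also have "norm \<dots> \<le> norm (poly_op q S (X n) - poly q t *\<^sub>R X n)
        + norm (poly q t *\<^sub>R X n - f t *\<^sub>R X n) + norm (poly_op q S (X n) - fun_calc f S (X n))"
      by (rule order_trans[OF norm_triangle_ineq4]) (intro add_right_mono norm_triangle_ineq)
    finally show ?case using 1 2 elim X(1)[of n] by simp
  qed
qed

lemma rank_one_perturbation:
  fixes e :: "'a::{real_inner, complete_space}"
  assumes e: "norm e = 1"
  defines "S \<equiv> \<lambda>\<alpha> \<beta> x. \<alpha> *\<^sub>R x + (\<beta> * (e \<bullet> x)) *\<^sub>R e"
  shows bounded_selfadjoint_rank_one: "bounded_selfadjoint (S \<alpha> \<beta>)"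
    and spectrum_rank_one: "spectrum_op (S \<alpha> \<beta>) \<subseteq> {\<alpha>, \<alpha> + \<beta>}"
    and fun_calc_rank_one: "\<beta> \<noteq> 0 \<Longrightarrow> fun_calc f (S \<alpha> \<beta>) = S (f \<alpha>) (f (\<alpha> + \<beta>) - f \<alpha>)"
proof -
  have ee: "e \<bullet> e = 1" using e by (simp add: norm_eq_1)
  have lin: "bounded_linear (S \<alpha> \<beta>)" for \<alpha> \<beta>
  proof -
    have "S \<alpha> \<beta> = (\<lambda>x. \<alpha> *\<^sub>R x + \<beta> *\<^sub>R ((x \<bullet> e) *\<^sub>R e))"
      by (rule ext) (simp add: S_def inner_commute)
    then show ?thesis
      by (simp only:) (intro bounded_linear_add bounded_linear_scaleR_right bounded_linear_const_scaleR
          bounded_linear_scaleR_const bounded_linear_inner_left)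
  qed
  show SA: "bounded_selfadjoint (S \<alpha> \<beta>)"
    using lin by (auto simp: bounded_selfadjoint_def S_def inner_add_left inner_add_right inner_commute)
  show spec: "spectrum_op (S \<alpha> \<beta>) \<subseteq> {\<alpha>, \<alpha> + \<beta>}"
  proof (rule ccontr)
    assume "\<not> spectrum_op (S \<alpha> \<beta>) \<subseteq> {\<alpha>, \<alpha> + \<beta>}"
    then obtain t where t: "t \<in> spectrum_op (S \<alpha> \<beta>)" "t \<noteq> \<alpha>" "t \<noteq> \<alpha> + \<beta>" by auto
    define a b where "a = \<alpha> - t" and "b = \<alpha> + \<beta> - t"
    have ab: "a \<noteq> 0" "b \<noteq> 0" using t by (auto simp: a_def b_def)
    have eq: "S \<alpha> \<beta> x - t *\<^sub>R x = S a (b - a) x" for x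
      by (simp add: S_def a_def b_def algebra_simps)
    have inv: "S a (b - a) (S (1 / a) (1 / b - 1 / a) x) = x" "S (1 / a) (1 / b - 1 / a) (S a (b - a) x) = x" for x
    proof -
      have "a * (1 / b - 1 / a) + (b - a) * (1 / a + (1 / b - 1 / a)) = 0"
        "(1 / a) * (b - a) + (1 / b - 1 / a) * (a + (b - a)) = 0"
        using ab by (simp_all add: field_simps)
      then have *: "(a * ((1 / b - 1 / a) * k) + (b - a) * (1 / a * k + (1 / b - 1 / a) * k)) = 0"
        "((1 / a) * ((b - a) * k) + (1 / b - 1 / a) * (a * k + (b - a) * k)) = 0" for k
        by (metis (no_types, opaque_lifting) distrib_right mult.assoc mult_zero_left)+
      show "S a (b - a) (S (1 / a) (1 / b - 1 / a) x) = x"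
        using *(1)[of "e \<bullet> x"] ab
        by (simp add: S_def inner_add_right ee scaleR_add_right add.assoc flip: scaleR_add_left)
      show "S (1 / a) (1 / b - 1 / a) (S a (b - a) x) = x"
        using *(2)[of "e \<bullet> x"] ab
        by (simp add: S_def inner_add_right ee scaleR_add_right add.assoc flip: scaleR_add_left)
    qed
    have "invertible_op (S a (b - a))" unfolding invertible_op_def using lin inv by blast
    then have "invertible_op (\<lambda>x. S \<alpha> \<beta> x - t *\<^sub>R x)" by (simp add: eq)
    then show False using t(1) by (simp add: mem_spectrum_iff)
  qed
  show "fun_calc f (S \<alpha> \<beta>) = S (f \<alpha>) (f (\<alpha> + \<beta>) - f \<alpha>)" if b: "\<beta> \<noteq> 0"
  proof (rule fun_calc_unique[OF SA lin])
    define c where "c = (f (\<alpha> + \<beta>) - f \<alpha>) / \<beta>"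
    have c: "c * \<beta> = f (\<alpha> + \<beta>) - f \<alpha>" using b by (simp add: c_def)
    let ?q = "[:f \<alpha> - c * \<alpha>, c:]"
    have "poly_op ?q (S \<alpha> \<beta>) x = S (f \<alpha>) (f (\<alpha> + \<beta>) - f \<alpha>) x" for x
      unfolding poly_op_linear[OF lin] c[symmetric] by (simp add: S_def algebra_simps)
    moreover have "poly ?q t = f t" if "t \<in> spectrum_op (S \<alpha> \<beta>)" for t
      using spec that c by (auto simp: algebra_simps)
    ultimately show "\<exists>q. (\<forall>t\<in>spectrum_op (S \<alpha> \<beta>). \<bar>poly q t - f t\<bar> \<le> \<epsilon>) \<and>
        (\<forall>x. norm (poly_op q (S \<alpha> \<beta>) x - S (f \<alpha>) (f (\<alpha> + \<beta>) - f \<alpha>) x) \<le> \<epsilon> * norm x)" if "0 < \<epsilon>" for \<epsilon>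
      using that by (intro exI[of _ ?q]) auto
  qed
qed

section \<open>Powers of an injective positive operator\<close>

lemma selfadjoint_inverse:
  fixes B :: "'a::{real_inner, complete_space} \<Rightarrow> 'a"
  assumes B: "selfadjoint_on D B" "strictly_positive_on D B"
  shows "\<exists>\<gamma>>0. selfadjoint_between 0 \<gamma> (inv_into D B)" "closure (range (inv_into D B)) = UNIV"
proof -
  have D: "subspace D" "closure D = UNIV" using B by (simp_all add: selfadjoint_on_def)
  have add: "B (x + y) = B x + B y" if "x \<in> D" "y \<in> D" for x y
    using B that by (simp add: selfadjoint_on_def)
  have scale: "B (c *\<^sub>R x) = c *\<^sub>R B x" if "x \<in> D" for c x
    using B that by (simp add: selfadjoint_on_def)
  have adj: "y \<in> D \<and> B y = z \<longleftrightarrow> (\<forall>x\<in>D. B x \<bullet> y = x \<bullet> z)" for y z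
    using B by (simp add: selfadjoint_on_def)
  obtain \<gamma> where \<gamma>: "0 < \<gamma>" "\<And>x. x \<in> D \<Longrightarrow> \<gamma> * (norm x)\<^sup>2 \<le> B x \<bullet> x"
    using B by (auto simp: strictly_positive_on_def)
  have below: "norm x \<le> 1 / \<gamma> * norm (B x)" if "x \<in> D" for x
  proof -
    have "\<gamma> * (norm x)\<^sup>2 \<le> norm (B x) * norm x"
      using \<gamma>(2)[OF that] norm_cauchy_schwarz[of "B x" x] by simp
    then have "\<gamma> * norm x \<le> norm (B x)" by (cases "x = 0") (auto simp: power2_eq_square)
    then show ?thesis using \<gamma>(1) by (simp add: field_simps)
  qed
  have diff: "B (x - y) = B x - B y" if "x \<in> D" "y \<in> D" for x y
    using add[of x "(-1) *\<^sub>R y"] scale[of y "-1"] that D(1) by (simp add: subspace_neg)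
  have inj: "inj_on B D"
  proof (rule inj_onI)
    fix x y assume "x \<in> D" "y \<in> D" "B x = B y"
    then show "x = y" using below[of "x - y"] diff[of x y] D(1) by (simp add: subspace_diff)
  qed
  have "closure (B ` D) = UNIV"
  proof (rule dense_subspaceI)
    show "subspace (B ` D)"
      unfolding subspace_def
    proof (intro conjI ballI allI)
      have "0 \<in> D" using D(1) by (simp add: subspace_0)
      then have "B 0 = 0" using scale[of 0 0] by simp
      then show "0 \<in> B ` D" using \<open>0 \<in> D\<close> by (metis image_eqI)
      show "x + y \<in> B ` D" if xy: "x \<in> B ` D" "y \<in> B ` D" for x y
      proof -
        obtain u v where "u \<in> D" "v \<in> D" "x = B u" "y = B v" using xy by blast
        then show ?thesis using add D(1) by (intro image_eqI[of _ _ "u + v"]) (auto simp: subspace_add)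
      qed
      show "c *\<^sub>R x \<in> B ` D" if x: "x \<in> B ` D" for c x
      proof -
        obtain u where "u \<in> D" "x = B u" using x by blast
        then show ?thesis using scale D(1) by (intro image_eqI[of _ _ "c *\<^sub>R u"]) (auto simp: subspace_scale)
      qed
    qed
    show "z = 0" if "\<And>x. x \<in> B ` D \<Longrightarrow> x \<bullet> z = 0" for z
    proof -
      have "z \<in> D \<and> B z = 0" using that by (simp add: adj)
      then show ?thesis using below[of z] by simp
    qed
  qed
  then obtain W where W: "bounded_linear W" "\<And>x. x \<in> D \<Longrightarrow> W (B x) = x" "\<And>x. norm (W x) \<le> 1 / \<gamma> * norm x"
  proof (rule bounded_linear_extension[where V = "\<lambda>x. x" and K = "1 / \<gamma>"])
    show "\<exists>z\<in>D. B z = B x + B y \<and> z = x + y" if "x \<in> D" "y \<in> D" for x y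
      using that add D(1) by (auto simp: subspace_add)
    show "\<exists>z\<in>D. B z = c *\<^sub>R B x \<and> z = c *\<^sub>R x" if "x \<in> D" for x c
      using that scale D(1) by (auto simp: subspace_scale)
  qed (use below in auto)
  interpret W: bounded_linear W by (rule W(1))
  have WD: "W y \<in> D \<and> B (W y) = y" for y
  proof -
    have "B x \<bullet> W y = x \<bullet> y" if "x \<in> D" for x
    proof -
      have sym: "B x \<bullet> z = x \<bullet> B z" if "z \<in> D" for z using adj[of z "B z"] that \<open>x \<in> D\<close> by blast
      have "closed {y. B x \<bullet> W y = x \<bullet> y}"
        by (intro closed_Collect_eq continuous_intros linear_continuous_on W(1))
      then show ?thesis
        by (rule dense_induct[OF \<open>closure (B ` D) = UNIV\<close>]) (use sym W(2) in auto)
    qed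
    then show ?thesis by (simp add: adj)
  qed
  have GW: "inv_into D B = W"
    using WD inv_into_f_f[OF inj] by (metis ext)
  have "bounded_selfadjoint W"
    unfolding bounded_selfadjoint_def
  proof (intro conjI allI W(1))
    fix x y
    have "\<forall>v\<in>D. B v \<bullet> W y = v \<bullet> y" using WD[of y] adj by blast
    then show "W x \<bullet> y = x \<bullet> W y" using WD[of x] by metis
  qed
  moreover have "0 \<le> W x \<bullet> x" for x
  proof -
    have "0 \<le> \<gamma> * (norm (W x))\<^sup>2" using \<gamma> by simp
    also have "\<dots> \<le> W x \<bullet> x" using \<gamma>(2)[of "W x"] WD[of x] by (simp add: inner_commute)
    finally show ?thesis .
  qed
  moreover have "W x \<bullet> x \<le> 1 / \<gamma> * (x \<bullet> x)" for x
  proof -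
    have "W x \<bullet> x \<le> norm (W x) * norm x" by (rule norm_cauchy_schwarz)
    also have "\<dots> \<le> 1 / \<gamma> * norm x * norm x" using W(3) by (intro mult_right_mono) auto
    finally show ?thesis by (simp add: dot_square_norm power2_eq_square)
  qed
  ultimately show "\<exists>\<gamma>>0. selfadjoint_between 0 \<gamma> (inv_into D B)"
    unfolding GW using \<gamma>(1) by (intro exI[of _ "1 / \<gamma>"]) (simp add: selfadjoint_between_def)
  have "D \<subseteq> range W" using W(2) by (metis rangeI subsetI)
  then show "closure (range (inv_into D B)) = UNIV" unfolding GW using D(2) closure_mono by blast
qed

lemma selfadjoint_between_onorm:
  fixes S :: "'a::real_inner \<Rightarrow> 'a"
  assumes "selfadjoint_between 0 u S"
  shows "selfadjoint_between 0 (onorm S) S"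
proof -
  have bl: "bounded_linear S"
    using assms by (simp add: selfadjoint_between_def bounded_selfadjoint_def)
  have "S x \<bullet> x \<le> onorm S * (x \<bullet> x)" for x
  proof -
    have "S x \<bullet> x \<le> norm (S x) * norm x" by (rule norm_cauchy_schwarz)
    also have "\<dots> \<le> onorm S * norm x * norm x" using onorm[OF bl] by (intro mult_right_mono) auto
    finally show ?thesis by (simp add: dot_square_norm power2_eq_square)
  qed
  then show ?thesis using assms by (simp add: selfadjoint_between_def)
qed

text \<open>Unlike \<open>t powr r\<close>, this is continuous at \<open>t = 0\<close> also for \<open>r = 0\<close>.\<close>

definition pow0 :: "real \<Rightarrow> real \<Rightarrow> real" where
  "pow0 r t = (if r = 0 then 1 else t powr r)"

lemma continuous_on_pow0: "0 \<le> r \<Longrightarrow> continuous_on {0..} (pow0 r)"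
  unfolding pow0_def
  by (cases "r = 0") (auto intro: continuous_on_powr'[OF continuous_on_id continuous_on_const])

lemma pow0_add: "0 \<le> r \<Longrightarrow> 0 \<le> q \<Longrightarrow> pow0 (r + q) t = pow0 r t * pow0 q t"
  by (auto simp: pow0_def powr_add)

lemma pow0_nonneg: "0 \<le> pow0 r t"
  by (simp add: pow0_def)

lemma pow0_pos: "0 < t \<Longrightarrow> pow0 r t = t powr r"
  by (simp add: pow0_def)

lemma pow0_mono: "0 \<le> r \<Longrightarrow> 0 \<le> x \<Longrightarrow> x \<le> y \<Longrightarrow> pow0 r x \<le> pow0 r y"
  by (simp add: pow0_def powr_mono2)

locale positive_dense =
  fixes G :: "'a::{real_inner, complete_space} \<Rightarrow> 'a" and a :: real
  assumes G: "selfadjoint_between 0 a G" and G_dense: "closure (range G) = UNIV"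
begin

abbreviation Pow :: "real \<Rightarrow> 'a \<Rightarrow> 'a" where
  "Pow r \<equiv> fun_calc (pow0 r) G"

lemma continuous_on_pow0_Icc: "0 \<le> r \<Longrightarrow> continuous_on {0..a} (pow0 r)"
  by (rule continuous_on_subset[OF continuous_on_pow0]) auto

lemma op_powr_eq_Pow: "0 \<le> r \<Longrightarrow> op_powr G r = Pow r"
  by (cases "r = 0") (auto simp: op_powr_def pow0_def[abs_def] fun_calc_const[OF G])

lemma bounded_selfadjoint_Pow: "0 \<le> r \<Longrightarrow> bounded_selfadjoint (Pow r)"
  by (rule bounded_selfadjoint_fun_calc[OF G continuous_on_pow0_Icc])

lemma bounded_linear_Pow: "0 \<le> r \<Longrightarrow> bounded_linear (Pow r)"
  by (rule bounded_selfadjoint_linear[OF bounded_selfadjoint_Pow])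

lemma Pow_add: "0 \<le> r \<Longrightarrow> 0 \<le> q \<Longrightarrow> Pow (r + q) x = Pow r (Pow q x)"
  using fun_calc_mult[OF G continuous_on_pow0_Icc continuous_on_pow0_Icc, of r q x]
  by (simp flip: pow0_add)

lemma Pow_eq_0:
  assumes r: "0 \<le> r" and z: "Pow r z = 0" shows "z = 0"
proof -
  have "G z = 0 \<Longrightarrow> z = 0" for z
    using zero_if_orthogonal_dense[OF G_dense, of z]
      bounded_selfadjoint_sym[OF selfadjoint_between_selfadjoint[OF G], of _ z] by auto
  moreover have "Pow 1 z = G z" for z
    using fun_calc_cong[OF G, of "pow0 1" "\<lambda>t. t"] fun_calc_ident[OF G] by (simp add: pow0_def)
  ultimately have "Pow (real n) z = 0 \<Longrightarrow> z = 0" for n z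
  proof (induction n)
    case 0
    then show ?case using op_powr_eq_Pow[of 0] by (simp add: op_powr_def)
  next
    case (Suc n)
    then show ?case using Pow_add[of 1 "real n" z] by simp
  qed
  moreover obtain n where "r \<le> real n" using real_arch_simple by blast
  then have "Pow (real n) z = Pow (real n - r) (Pow r z)"
    using Pow_add[of "real n - r" r z] r by simp
  then have "Pow (real n) z = 0"
    using z \<open>r \<le> real n\<close> bounded_linear_Pow[of "real n - r"] by (simp add: bounded_linear.linear linear_0)
  ultimately show ?thesis by blast
qed

lemma inj_Pow: "0 \<le> r \<Longrightarrow> inj (Pow r)"
  using linear_injective_0[OF bounded_linear.linear[OF bounded_linear_Pow]] Pow_eq_0 by blast

lemma Pow_dense:
  assumes "0 \<le> r" shows "closure (range (Pow r)) = UNIV"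
proof (rule dense_subspaceI)
  show "subspace (range (Pow r))"
    using bounded_linear.linear[OF bounded_linear_Pow[OF assms]] by (simp add: linear_subspace_image)
  fix z assume "\<And>x. x \<in> range (Pow r) \<Longrightarrow> x \<bullet> z = 0"
  then have "Pow r z \<bullet> Pow r z = 0"
    using bounded_selfadjoint_sym[OF bounded_selfadjoint_Pow[OF assms], of "Pow r z" z] by simp
  then show "z = 0" using Pow_eq_0[OF assms] by simp
qed

lemma op_powr_neg_Pow:
  assumes "s < 0" shows "op_powr G s (Pow (- s) u) = u"
proof -
  have "pow0 (- s) = (\<lambda>t. t powr (- s))" using assms by (auto simp: pow0_def)
  then have "op_powr G s = inv (Pow (- s))" using assms by (simp add: op_powr_def)
  then show ?thesis using inj_Pow[of "- s"] assms by simp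
qed

lemma op_powr_dom_eq: "op_powr_dom G s = (if 0 \<le> s then UNIV else range (Pow (- s)))"
  by (simp add: op_powr_dom_def op_powr_eq_Pow)

end

lemma bounded_selfadjoint_range_by_duality:
  fixes Q :: "'a::{real_inner, complete_space} \<Rightarrow> 'a"
  assumes Q: "bounded_selfadjoint Q" and dense: "closure (range Q) = UNIV"
    and bound: "\<And>z. \<bar>y \<bullet> z\<bar> \<le> K * norm (Q z)" and K: "0 \<le> K"
  obtains w where "y = Q w" "norm w \<le> K"
proof -
  have lin: "linear Q" using Q by (simp add: bounded_selfadjoint_def bounded_linear.linear)
  obtain W where W: "bounded_linear W" "\<And>x. x \<in> UNIV \<Longrightarrow> W (Q x) = y \<bullet> x" "\<And>x. norm (W x) \<le> K * norm x"
  proof (rule bounded_linear_extension[where U = Q and Z = UNIV and V = "\<lambda>x. y \<bullet> x" and K = K])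
    show "\<exists>z\<in>UNIV. Q z = Q x + Q x' \<and> y \<bullet> z = y \<bullet> x + y \<bullet> x'" for x x'
      by (intro bexI[of _ "x + x'"]) (auto simp: linear_add[OF lin] inner_add_right)
    show "\<exists>z\<in>UNIV. Q z = c *\<^sub>R Q x \<and> y \<bullet> z = c *\<^sub>R (y \<bullet> x)" for c x
      by (intro bexI[of _ "c *\<^sub>R x"]) (auto simp: linear_scale[OF lin])
  qed (use dense bound in auto)
  obtain w where w: "\<And>x. W x = w \<bullet> x" using riesz[OF W(1)] by blast
  have "Q w \<bullet> z = y \<bullet> z" for z using W(2)[of z] w bounded_selfadjoint_sym[OF Q, of w z] by simp
  then have "Q w = y" by (metis inner_diff_left inner_eq_zero_iff right_minus_eq)
  moreover have "norm w \<le> K"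
  proof (cases "w = 0")
    case False
    have "norm w * norm w \<le> K * norm w"
      using W(3)[of w] w[of w] by (simp add: dot_square_norm power2_eq_square)
    then show ?thesis using False by simp
  qed (use K in simp)
  ultimately show ?thesis using that by blast
qed

section \<open>Index functions\<close>

lemma index_function_pos: "index_function a f \<Longrightarrow> 0 < t \<Longrightarrow> t \<le> a \<Longrightarrow> 0 < f t"
  by (simp add: index_function_def)

lemma index_function_mono: "index_function a f \<Longrightarrow> 0 < t \<Longrightarrow> t \<le> u \<Longrightarrow> u \<le> a \<Longrightarrow> f t \<le> f u"
  unfolding index_function_def by (metis (no_types, lifting) greaterThanAtMost_iff less_le_trans
      order_le_less order_trans strict_mono_onD)

lemma continuous_on_ext0:
  assumes f: "index_function a f" shows "continuous_on {0..a} (ext0 f)"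
  unfolding continuous_on_def
proof
  fix x assume x: "x \<in> {0..a}"
  show "(ext0 f \<longlongrightarrow> ext0 f x) (at x within {0..a})"
  proof (cases "x = 0")
    case True
    have "(ext0 f \<longlongrightarrow> 0) (at_right 0)"
    proof (rule Lim_transform_eventually)
      show "(f \<longlongrightarrow> 0) (at_right 0)" using f by (simp add: index_function_def)
      show "\<forall>\<^sub>F x in at_right 0. f x = ext0 f x"
        by (auto simp: eventually_at_filter ext0_def)
    qed
    moreover have "at 0 within {0..a} \<le> at_right 0"
      unfolding at_within_def by (intro inf_mono) auto
    ultimately show ?thesis using True by (auto simp: ext0_def intro: tendsto_mono)
  next
    case False
    then have x0: "x \<in> {0<..a}" using x by auto
    have "continuous_on {0<..a} (ext0 f)"
      by (rule continuous_on_eq[of _ f]) (use f in \<open>auto simp: index_function_def ext0_def\<close>)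
    then have "(ext0 f \<longlongrightarrow> ext0 f x) (at x within {0<..a})" using x0 by (simp add: continuous_on_def)
    moreover have "at x within {0<..a} = at x within {0..a}"
      by (rule at_within_nhd[of x "{0<..}"]) (use x0 in auto)
    ultimately show ?thesis by simp
  qed
qed

lemma index_function_surj:
  assumes f: "index_function a f" and t: "0 < t" "t \<le> f a" and a: "0 < a"
  obtains u where "0 < u" "u \<le> a" "f u = t"
proof -
  obtain u where u: "0 \<le> u" "u \<le> a" "ext0 f u = t"
    using IVT'[of "ext0 f" 0 t a, OF _ _ _ continuous_on_ext0[OF f]] t a by (auto simp: ext0_def)
  then show ?thesis using t that[of u] by (auto simp: ext0_def split: if_splits)
qed

lemma index_function_inverse:
  assumes f: "index_function a f" and a: "0 < a"
  defines "g \<equiv> the_inv_into {0<..a} f"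
  shows index_function_inverse_left: "\<And>t. 0 < t \<Longrightarrow> t \<le> a \<Longrightarrow> g (f t) = t"
    and index_function_inverse_right: "\<And>t. 0 < t \<Longrightarrow> t \<le> f a \<Longrightarrow> 0 < g t \<and> g t \<le> a \<and> f (g t) = t"
    and continuous_on_inverse_ext0: "continuous_on {0..f a} (ext0 g)"
proof -
  have mono: "strict_mono_on {0<..a} f" using f by (simp add: index_function_def)
  then have inj: "inj_on f {0<..a}" by (rule strict_mono_on_imp_inj_on)
  show left: "g (f t) = t" if "0 < t" "t \<le> a" for t
    using that the_inv_into_f_f[OF inj, of t] by (simp add: g_def)
  show "0 < g t \<and> g t \<le> a \<and> f (g t) = t" if t: "0 < t" "t \<le> f a" for t
  proof -
    obtain u where "0 < u" "u \<le> a" "f u = t" using index_function_surj[OF f t a] .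
    then show ?thesis using left[of u] by auto
  qed
  have "ext0 f ` {0..a} = {0..f a}"
  proof (intro equalityI subsetI)
    fix t assume "t \<in> ext0 f ` {0..a}"
    then show "t \<in> {0..f a}"
      using a by (auto simp: ext0_def index_function_mono[OF f] index_function_pos[OF f]
          intro: less_imp_le)
  next
    fix t assume t: "t \<in> {0..f a}"
    show "t \<in> ext0 f ` {0..a}"
    proof (cases "t = 0")
      case True
      then show ?thesis using a by (intro image_eqI[of _ _ 0]) (auto simp: ext0_def)
    next
      case False
      then obtain u where "0 < u" "u \<le> a" "f u = t" using index_function_surj[OF f _ _ a, of t] t by auto
      then show ?thesis by (intro image_eqI[of _ _ u]) (auto simp: ext0_def)
    qed
  qed
  moreover have "continuous_on (ext0 f ` {0..a}) (ext0 g)"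
  proof (rule continuous_on_inv[OF continuous_on_ext0[OF f]])
    show "\<forall>x\<in>{0..a}. ext0 g (ext0 f x) = x"
      using left index_function_pos[OF f] by (auto simp: ext0_def)
  qed simp
  ultimately show "continuous_on {0..f a} (ext0 g)" by simp
qed

lemma index_function_psi:
  assumes \<rho>: "index_function a \<rho>" and r: "0 < r"
  shows "index_function a (psi \<rho> r)"
  unfolding index_function_def
proof (intro conjI ballI)
  show "continuous_on {0<..a} (psi \<rho> r)"
    unfolding psi_def using \<rho> by (intro continuous_intros) (auto simp: index_function_def)
  show "strict_mono_on {0<..a} (psi \<rho> r)"
  proof (rule strict_mono_onI)
    fix x y assume xy: "x \<in> {0<..a}" "y \<in> {0<..a}" "x < y"
    then have "x powr r < y powr r" using r by (simp add: powr_less_mono2)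
    moreover have "\<rho> x < \<rho> y" using \<rho> xy strict_mono_onD[of "{0<..a}" \<rho> x y] by (simp add: index_function_def)
    ultimately show "psi \<rho> r x < psi \<rho> r y"
      unfolding psi_def using index_function_pos[OF \<rho>] xy by (intro mult_strict_mono) (auto intro: less_imp_le)
  qed
  show "0 < psi \<rho> r t" if "t \<in> {0<..a}" for t
    using that index_function_pos[OF \<rho>] by (simp add: psi_def)
  have "((\<lambda>t. t powr r) \<longlongrightarrow> 0) (at_right 0)"
  proof -
    have "((\<lambda>t. t powr r) \<longlongrightarrow> 0 powr r) (at_right 0)"
      by (rule tendsto_powr') (use r in \<open>auto intro: tendsto_ident_at simp: eventually_at_filter\<close>)
    then show ?thesis using r by simp
  qed
  moreover have "(\<rho> \<longlongrightarrow> 0) (at_right 0)" using \<rho> by (simp add: index_function_def)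
  ultimately have "((\<lambda>t. t powr r * \<rho> t) \<longlongrightarrow> 0 * 0) (at_right 0)" by (rule tendsto_mult)
  then show "(psi \<rho> r \<longlongrightarrow> 0) (at_right 0)" by (simp add: psi_def[abs_def])
qed

section \<open>Operator monotone functions\<close>

lemma operator_monotone_cong:
  assumes "operator_monotone TYPE('a::{real_inner, complete_space}) c f" "\<And>t. 0 < t \<Longrightarrow> t \<le> c \<Longrightarrow> f t = g t"
  shows "operator_monotone TYPE('a) c g"
proof -
  have "fun_calc f S = fun_calc g S" if "spectrum_op S \<subseteq> {0<..c}" for S :: "'a \<Rightarrow> 'a"
  proof -
    have "\<And>t. t \<in> spectrum_op S \<Longrightarrow> f t = g t" using that assms(2) by auto
    then show ?thesis unfolding fun_calc_def by (simp cong: ball_cong)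
  qed
  then show ?thesis using assms(1) by (simp add: operator_monotone_def)
qed

lemma operator_monotone_closed_interval:
  fixes S1 S2 :: "'a::{real_inner, complete_space} \<Rightarrow> 'a"
  assumes mono: "operator_monotone TYPE('a) c f" and f: "continuous_on {0..c} f" and c: "0 < c"
    and S: "selfadjoint_between 0 c S1" "selfadjoint_between 0 c S2" and le: "op_le S1 S2"
  shows "op_le (fun_calc f S1) (fun_calc f S2)"
  unfolding op_le_def
proof (rule allI, rule field_le_epsilon)
  fix x :: 'a and d :: real assume d: "0 < d"
  define q where "q = d / (x \<bullet> x + 1)"
  define \<epsilon> where "\<epsilon> = q / 2"
  have xx: "0 \<le> x \<bullet> x" by simp
  then have "0 < q" using d unfolding q_def by (intro divide_pos_pos add_nonneg_pos) auto
  then have \<epsilon>: "0 < \<epsilon>" by (simp add: \<epsilon>_def)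
  have "q * (x \<bullet> x) \<le> q * (x \<bullet> x + 1)" using \<open>0 < q\<close> by simp
  also have "x \<bullet> x + 1 \<noteq> 0" using xx by linarith
  then have "q * (x \<bullet> x + 1) = d" by (simp add: q_def)
  finally have \<epsilon>d: "2 * (\<epsilon> * (x \<bullet> x)) \<le> d" by (simp add: \<epsilon>_def)
  have "uniformly_continuous_on {0..c} f" by (rule compact_uniformly_continuous[OF f]) simp
  then obtain \<eta>0 where \<eta>0: "0 < \<eta>0" "\<And>t u. t \<in> {0..c} \<Longrightarrow> u \<in> {0..c} \<Longrightarrow> dist u t < \<eta>0 \<Longrightarrow> dist (f u) (f t) < \<epsilon>"
    using \<epsilon> unfolding uniformly_continuous_on_def by metis
  define \<eta> where "\<eta> = min (1 / 2) (\<eta>0 / (2 * c))"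
  have \<eta>: "0 < \<eta>" "\<eta> < 1" using \<eta>0 c by (auto simp: \<eta>_def)
  have "\<eta> \<le> \<eta>0 / (2 * c)" by (simp add: \<eta>_def)
  then have \<eta>c: "\<eta> * c < \<eta>0" using c \<eta>0(1) by (simp add: field_simps)
  define sh where "sh t = (1 - \<eta>) * t + \<eta> * c" for t
  have sh: "sh t \<in> {\<eta> * c..c}" if "t \<in> {0..c}" for t
  proof -
    have "(1 - \<eta>) * t \<le> (1 - \<eta>) * c" "0 \<le> (1 - \<eta>) * t" using that \<eta> by (auto intro: mult_left_mono)
    then show ?thesis by (simp add: sh_def algebra_simps)
  qed
  have shc: "continuous_on {0..c} sh" unfolding sh_def by (intro continuous_intros)
  have \<eta>c0: "0 < \<eta> * c" using \<eta> c by simp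
  have fsub: "continuous_on {\<eta> * c..c} f" by (rule continuous_on_subset[OF f]) (use \<eta>c0 in auto)
  have close: "\<bar>f (sh t) - f t\<bar> \<le> \<epsilon>" if "t \<in> {0..c}" for t
  proof -
    have "sh t - t = \<eta> * (c - t)" by (simp add: sh_def algebra_simps)
    moreover have "\<eta> * (c - t) \<le> \<eta> * c" "0 \<le> \<eta> * (c - t)" using that \<eta> by (auto intro: mult_left_mono)
    ultimately have "dist (sh t) t < \<eta>0" using \<eta>c by (simp add: dist_real_def)
    then have "dist (f (sh t)) (f t) < \<epsilon>" using sh[OF that] that \<eta>c0 by (intro \<eta>0(2)) auto
    then show ?thesis by (simp add: dist_real_def)
  qed
  have fsh: "continuous_on {0..c} (\<lambda>t. f (sh t))"
    by (rule continuous_on_compose2[OF fsub shc]) (use sh in auto)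
  have shift: "fun_calc sh S y = (1 - \<eta>) *\<^sub>R S y + (\<eta> * c) *\<^sub>R y" if "selfadjoint_between 0 c S" for S :: "'a \<Rightarrow> 'a" and y
    unfolding sh_def using that
    by (simp add: fun_calc_add[OF that] fun_calc_scale[OF that] fun_calc_const[OF that] fun_calc_ident[OF that] continuous_intros)
  have spec: "bounded_selfadjoint (fun_calc sh S) \<and> spectrum_op (fun_calc sh S) \<subseteq> {0<..c}"
    if "selfadjoint_between 0 c S" for S :: "'a \<Rightarrow> 'a"
  proof -
    have "selfadjoint_between (\<eta> * c) c (fun_calc sh S)"
      by (rule selfadjoint_between_fun_calc[OF that shc]) (use sh in auto)
    from spectrum_subset_if_between[OF this] selfadjoint_between_selfadjoint[OF this]
    show ?thesis using \<eta>c0 by auto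
  qed
  have "op_le (fun_calc sh S1) (fun_calc sh S2)"
    using le \<eta> by (simp add: op_le_def shift S inner_add_left mult_left_mono)
  then have "op_le (fun_calc f (fun_calc sh S1)) (fun_calc f (fun_calc sh S2))"
    using mono spec[OF S(1)] spec[OF S(2)] by (simp add: operator_monotone_def)
  then have main: "fun_calc (\<lambda>t. f (sh t)) S1 x \<bullet> x \<le> fun_calc (\<lambda>t. f (sh t)) S2 x \<bullet> x"
    using fun_calc_compose[OF S(1) shc sh fsub] fun_calc_compose[OF S(2) shc sh fsub]
    by (simp add: op_le_def)
  have err: "\<bar>fun_calc (\<lambda>t. f (sh t)) S x \<bullet> x - fun_calc f S x \<bullet> x\<bar> \<le> \<epsilon> * (x \<bullet> x)"
    if "selfadjoint_between 0 c S" for S :: "'a \<Rightarrow> 'a"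
  proof -
    have "norm (fun_calc (\<lambda>t. f (sh t) - f t) S x) \<le> \<epsilon> * norm x"
      by (rule norm_fun_calc_le[OF that]) (use close \<epsilon> in \<open>auto intro!: continuous_intros fsh f\<close>)
    then have *: "norm (fun_calc (\<lambda>t. f (sh t)) S x - fun_calc f S x) \<le> \<epsilon> * norm x"
      by (simp add: fun_calc_diff[OF that fsh f])
    have "\<bar>(fun_calc (\<lambda>t. f (sh t)) S x - fun_calc f S x) \<bullet> x\<bar> \<le> \<epsilon> * norm x * norm x"
      by (rule order_trans[OF Cauchy_Schwarz_ineq2 mult_right_mono[OF *]]) simp
    then show ?thesis by (simp add: inner_diff_left dot_square_norm power2_eq_square)
  qed
  show "fun_calc f S1 x \<bullet> x \<le> fun_calc f S2 x \<bullet> x + d"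
    using main err[OF S(1)] err[OF S(2)] \<epsilon>d by linarith
qed

text \<open>Rank-one perturbations of multiples of the identity suffice: compare \<open>S1\<close>, with eigenvalue
  \<open>\<tau>\<close> on a unit vector \<open>u\<close>, to \<open>S2\<close>, with eigenvalue \<open>t\<close> on \<open>e1\<close>, where
  \<open>(u \<bullet> e1)\<^sup>2 = t / (4 * \<tau>)\<close>.\<close>

lemma operator_monotone_quotient_small:
  fixes e1 e2 :: "'a::{real_inner, complete_space}"
  assumes mono: "operator_monotone TYPE('a) c f" and nonneg: "\<And>t. 0 < t \<Longrightarrow> t \<le> c \<Longrightarrow> 0 \<le> f t"
    and e: "norm e1 = 1" "norm e2 = 1" "e1 \<bullet> e2 = 0"
    and t: "0 < t" "t \<le> \<tau>" "\<tau> \<le> c / 3"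
  shows "t * f \<tau> \<le> 4 * \<tau> * f t"
proof -
  have c: "0 < c" "t < c" "\<tau> < c" "t / 2 < \<tau>" "t / 2 < c" using t by auto
  define C where "C = sqrt (t / (4 * \<tau>))"
  define S where "S = sqrt (1 - t / (4 * \<tau>))"
  have C2: "C\<^sup>2 = t / (4 * \<tau>)" and S2: "S\<^sup>2 = 1 - t / (4 * \<tau>)"
    using t by (auto simp: C_def S_def field_simps)
  define u where "u = C *\<^sub>R e1 + S *\<^sub>R e2"
  have ee: "e1 \<bullet> e1 = 1" "e2 \<bullet> e2 = 1" "e2 \<bullet> e1 = 0" using e by (simp_all add: norm_eq_1 inner_commute)
  have uu: "u \<bullet> u = 1" using C2 S2
    by (simp add: u_def inner_add_left inner_add_right ee e(3) power2_eq_square)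
  have ue: "u \<bullet> e1 = C" by (simp add: u_def inner_add_left ee)
  have norm_u: "norm u = 1" using uu by (simp add: norm_eq_1)
  let ?S1 = "\<lambda>x. (t / 2) *\<^sub>R x + ((\<tau> - t / 2) * (u \<bullet> x)) *\<^sub>R u"
  let ?S2 = "\<lambda>x. c *\<^sub>R x + ((t - c) * (e1 \<bullet> x)) *\<^sub>R e1"
  have "op_le ?S1 ?S2"
    unfolding op_le_def
  proof
    fix x
    define a b where "a = e1 \<bullet> x" and "b = e2 \<bullet> x"
    have bessel: "a\<^sup>2 + b\<^sup>2 \<le> x \<bullet> x"
    proof -
      have "0 \<le> (x - a *\<^sub>R e1 - b *\<^sub>R e2) \<bullet> (x - a *\<^sub>R e1 - b *\<^sub>R e2)" by simp
      also have "\<dots> = x \<bullet> x - a\<^sup>2 - b\<^sup>2"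
        by (simp add: inner_diff_left inner_diff_right ee e(3) a_def b_def inner_commute power2_eq_square algebra_simps)
      finally show ?thesis by simp
    qed
    have "0 \<le> (C * a - S * b)\<^sup>2" by simp
    then have "(u \<bullet> x)\<^sup>2 \<le> 2 * (C\<^sup>2 * a\<^sup>2) + 2 * (S\<^sup>2 * b\<^sup>2)"
      by (simp add: u_def inner_add_left a_def b_def power2_eq_square algebra_simps)
    also have "S\<^sup>2 * b\<^sup>2 \<le> 1 * b\<^sup>2" unfolding S2 using t by (intro mult_right_mono) auto
    finally have ux: "(u \<bullet> x)\<^sup>2 \<le> 2 * (C\<^sup>2 * a\<^sup>2) + 2 * b\<^sup>2" by simp
    have "(\<tau> - t / 2) * (u \<bullet> x)\<^sup>2 \<le> \<tau> * (2 * (C\<^sup>2 * a\<^sup>2) + 2 * b\<^sup>2)"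
      using ux t by (intro mult_mono) auto
    also have "\<dots> = t / 2 * a\<^sup>2 + 2 * \<tau> * b\<^sup>2" using t by (simp add: C2 field_simps)
    finally have 1: "(\<tau> - t / 2) * (u \<bullet> x)\<^sup>2 \<le> t / 2 * a\<^sup>2 + 2 * \<tau> * b\<^sup>2" .
    have "2 * \<tau> * b\<^sup>2 \<le> (c - t / 2) * b\<^sup>2" using t by (intro mult_right_mono) auto
    also have "\<dots> \<le> (c - t / 2) * (x \<bullet> x - a\<^sup>2)" using bessel c by (intro mult_left_mono) auto
    finally have 2: "2 * \<tau> * b\<^sup>2 \<le> (c - t / 2) * (x \<bullet> x - a\<^sup>2)" .
    have "?S1 x \<bullet> x = t / 2 * (x \<bullet> x) + (\<tau> - t / 2) * (u \<bullet> x)\<^sup>2"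
      by (simp add: inner_add_left power2_eq_square)
    also have "\<dots> \<le> t / 2 * (x \<bullet> x) + t / 2 * a\<^sup>2 + (c - t / 2) * (x \<bullet> x - a\<^sup>2)" using 1 2 by simp
    also have "\<dots> = c * (x \<bullet> x) + (t - c) * a\<^sup>2" by (simp add: algebra_simps)
    also have "\<dots> = ?S2 x \<bullet> x" by (simp add: inner_add_left power2_eq_square a_def)
    finally show "?S1 x \<bullet> x \<le> ?S2 x \<bullet> x" .
  qed
  moreover have "spectrum_op ?S1 \<subseteq> {0<..c}"
    using spectrum_rank_one[OF norm_u, of "t / 2" "\<tau> - t / 2"] t c by auto
  moreover have "spectrum_op ?S2 \<subseteq> {0<..c}"
    using spectrum_rank_one[OF e(1), of c "t - c"] t c by auto
  ultimately have "op_le (fun_calc f ?S1) (fun_calc f ?S2)"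
    using mono bounded_selfadjoint_rank_one[OF norm_u, of "t / 2" "\<tau> - t / 2"]
      bounded_selfadjoint_rank_one[OF e(1), of c "t - c"] by (simp add: operator_monotone_def)
  then have "fun_calc f ?S1 e1 \<bullet> e1 \<le> fun_calc f ?S2 e1 \<bullet> e1" by (simp add: op_le_def)
  moreover have "fun_calc f ?S2 e1 \<bullet> e1 = f t"
    using c by (simp add: fun_calc_rank_one[OF e(1)] inner_add_left ee)
  moreover have "fun_calc f ?S1 e1 \<bullet> e1 = f (t / 2) * (1 - C\<^sup>2) + f \<tau> * C\<^sup>2"
    using c by (subst fun_calc_rank_one[OF norm_u])
      (auto simp: inner_add_left ee ue power2_eq_square algebra_simps)
  moreover have "0 \<le> f (t / 2) * (1 - C\<^sup>2)"
    using nonneg[of "t / 2"] t c by (intro mult_nonneg_nonneg) (auto simp: C2 field_simps)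
  ultimately have "f \<tau> * C\<^sup>2 \<le> f t" by simp
  then show ?thesis using t by (simp add: C2 field_simps)
qed

lemma operator_monotone_quotient:
  fixes e1 e2 :: "'a::{real_inner, complete_space}"
  assumes mono: "operator_monotone TYPE('a) c f" and pos: "\<And>t. 0 < t \<Longrightarrow> t \<le> c \<Longrightarrow> 0 < f t"
    and incr: "\<And>t u. 0 < t \<Longrightarrow> t \<le> u \<Longrightarrow> u \<le> c \<Longrightarrow> f t \<le> f u"
    and e: "norm e1 = 1" "norm e2 = 1" "e1 \<bullet> e2 = 0" and c: "0 < c"
  obtains K where "1 \<le> K" "\<And>t \<tau>. 0 < t \<Longrightarrow> t \<le> \<tau> \<Longrightarrow> \<tau> \<le> c \<Longrightarrow> t * f \<tau> \<le> K * \<tau> * f t"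
proof -
  define R where "R = f c / f (c / 3)"
  have f3: "0 < f (c / 3)" "f (c / 3) \<le> f c" using pos[of "c / 3"] incr[of "c / 3" c] c by auto
  then have R: "1 \<le> R" "f c = R * f (c / 3)" by (auto simp: R_def)
  note small = operator_monotone_quotient_small[OF mono less_imp_le[OF pos] e]
  show ?thesis
  proof (rule that[of "4 * R"])
    show "1 \<le> 4 * R" using R by simp
    fix t \<tau> assume t: "0 < t" "t \<le> \<tau>" "\<tau> \<le> c"
    have ft: "0 < f t" using pos t by simp
    consider "\<tau> \<le> c / 3" | "t \<le> c / 3" "c / 3 < \<tau>" | "c / 3 < t" by linarith
    then show "t * f \<tau> \<le> 4 * R * \<tau> * f t"
    proof cases
      case 1
      have "t * f \<tau> \<le> 1 * (4 * \<tau> * f t)" using small[of t \<tau>] t 1 by simp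
      also have "\<dots> \<le> R * (4 * \<tau> * f t)" using R ft t by (intro mult_right_mono) auto
      finally show ?thesis by (simp add: mult_ac)
    next
      case 2
      have "t * f \<tau> \<le> t * f c" using incr[of \<tau> c] t by (intro mult_left_mono) auto
      also have "\<dots> = R * (t * f (c / 3))" by (simp add: R)
      also have "\<dots> \<le> R * (4 * (c / 3) * f t)"
        using small[of t "c / 3"] t 2 R by (intro mult_left_mono) auto
      also have "\<dots> \<le> R * (4 * \<tau> * f t)" using R ft t 2 by (intro mult_left_mono mult_right_mono) auto
      finally show ?thesis by (simp add: mult_ac)
    next
      case 3
      have "t * f \<tau> \<le> t * f c" using incr[of \<tau> c] t by (intro mult_left_mono) auto
      also have "\<dots> = R * (t * f (c / 3))" by (simp add: R)
      also have "\<dots> \<le> R * (\<tau> * f t)"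
        using incr[of "c / 3" t] t 3 R c f3 by (intro mult_left_mono mult_mono) auto
      also have "\<dots> \<le> 4 * (R * (\<tau> * f t))" using R ft t by simp
      finally show ?thesis by (simp add: mult_ac)
    qed
  qed
qed

lemma unbounded_on_orthonormal_pair:
  fixes B :: "'a::{real_inner, complete_space} \<Rightarrow> 'a"
  assumes B: "selfadjoint_on D B" "unbounded_on D B"
  obtains e1 e2 :: 'a where "norm e1 = 1" "norm e2 = 1" "e1 \<bullet> e2 = 0"
proof -
  have D: "subspace D" using B by (simp add: selfadjoint_on_def)
  have scale: "B (c *\<^sub>R x) = c *\<^sub>R B x" if "x \<in> D" for c x
    using B that by (simp add: selfadjoint_on_def)
  have "\<not> (\<forall>x\<in>D. x = 0)"
  proof
    assume "\<forall>x\<in>D. x = 0"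
    then have "norm (B x) \<le> 0 * norm x" if "x \<in> D" for x using scale[of 0 0] that by auto
    then show False using B(2) unfolding unbounded_on_def by blast
  qed
  then obtain d where d: "d \<in> D" "d \<noteq> 0" by blast
  define e1 where "e1 = (1 / norm d) *\<^sub>R d"
  have e1: "norm e1 = 1" "e1 \<in> D" using d D by (auto simp: e1_def subspace_scale)
  have "\<exists>x. x - (x \<bullet> e1) *\<^sub>R e1 \<noteq> 0"
  proof (rule ccontr)
    assume "\<nexists>x. x - (x \<bullet> e1) *\<^sub>R e1 \<noteq> 0"
    then have *: "x = (x \<bullet> e1) *\<^sub>R e1" for x by auto
    have "norm (B x) \<le> norm (B e1) * norm x" for x
    proof -
      have "norm (B x) = \<bar>x \<bullet> e1\<bar> * norm (B e1)" by (subst *) (simp add: scale[OF e1(2)])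
      also have "\<dots> \<le> norm x * norm (B e1)"
        using Cauchy_Schwarz_ineq2[of x e1] e1 by (intro mult_right_mono) auto
      finally show ?thesis by (simp add: mult.commute)
    qed
    then show False using B(2) unfolding unbounded_on_def by blast
  qed
  then obtain x where x: "x - (x \<bullet> e1) *\<^sub>R e1 \<noteq> 0" (is "?y \<noteq> 0") by blast
  have "e1 \<bullet> ?y = 0" using e1 by (simp add: inner_diff_right norm_eq_1 inner_commute)
  then show ?thesis using x e1 by (intro that[of e1 "(1 / norm ?y) *\<^sub>R ?y"]) auto
qed

section \<open>The iterated filter\<close>

definition r_reg :: "(nat \<Rightarrow> real) \<Rightarrow> nat \<Rightarrow> real \<Rightarrow> real" where
  "r_reg \<alpha> n t = (\<Prod>k=1..n. \<alpha> k / (t + \<alpha> k))"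

context
  fixes \<alpha> :: "nat \<Rightarrow> real" and n :: nat
  assumes \<alpha>: "\<And>k. 1 \<le> k \<Longrightarrow> k \<le> n \<Longrightarrow> 0 < \<alpha> k"
begin

lemma r_reg_bounds:
  assumes "0 \<le> t" "j \<le> n" shows "0 \<le> r_reg \<alpha> j t" "r_reg \<alpha> j t \<le> 1"
proof -
  have "0 \<le> \<alpha> k / (t + \<alpha> k) \<and> \<alpha> k / (t + \<alpha> k) \<le> 1" if "k \<in> {1..j}" for k
    using \<alpha>[of k] that assms by simp
  then show "0 \<le> r_reg \<alpha> j t" "r_reg \<alpha> j t \<le> 1"
    unfolding r_reg_def by (auto intro!: prod_nonneg prod_le_1)
qed

lemma r_reg_antimono:
  assumes t: "0 \<le> t" and "k \<le> n" shows "r_reg \<alpha> n t \<le> r_reg \<alpha> k t"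
  using assms(2)
proof (induction rule: dec_induct)
  case base
  then show ?case by simp
next
  case (step j)
  have "\<alpha> (Suc j) / (t + \<alpha> (Suc j)) \<le> 1" using \<alpha>[of "Suc j"] step t by simp
  moreover have "r_reg \<alpha> (Suc j) t = r_reg \<alpha> j t * (\<alpha> (Suc j) / (t + \<alpha> (Suc j)))"
    by (simp add: r_reg_def)
  ultimately have "r_reg \<alpha> (Suc j) t \<le> r_reg \<alpha> j t"
    using r_reg_bounds(1)[OF t, of j] step by (simp only: mult_left_le)
  then show ?case using step by simp
qed

text \<open>Telescoping, since \<open>r\<^sub>k\<^sub>-\<^sub>1 - r\<^sub>k = t r\<^sub>k / \<alpha>\<^sub>k\<close>.\<close>

lemma sum_r_reg:
  assumes t: "0 \<le> t" and "j \<le> n"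
  shows "t * (\<Sum>k=1..j. r_reg \<alpha> k t / \<alpha> k) = 1 - r_reg \<alpha> j t"
  using assms(2)
proof (induction j)
  case 0
  then show ?case by (simp add: r_reg_def)
next
  case (Suc j)
  have \<alpha>j: "0 < \<alpha> (Suc j)" using \<alpha> Suc by simp
  have "r_reg \<alpha> (Suc j) t = r_reg \<alpha> j t * (\<alpha> (Suc j) / (t + \<alpha> (Suc j)))" by (simp add: r_reg_def)
  then have "t * (r_reg \<alpha> (Suc j) t / \<alpha> (Suc j)) = r_reg \<alpha> j t - r_reg \<alpha> (Suc j) t"
    using \<alpha>j t by (simp add: field_simps)
  then show ?case using Suc by (simp add: distrib_left)
qed

lemma g_reg_eq_sum:
  assumes "0 \<le> t" shows "g_reg \<alpha> n t = (\<Sum>k=1..n. r_reg \<alpha> k t / \<alpha> k)"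
proof (cases "t = 0")
  case True
  have "r_reg \<alpha> k 0 = 1" if "k \<le> n" for k
    unfolding r_reg_def using that \<alpha> by (intro prod.neutral) force
  then show ?thesis using True by (simp add: g_reg_def sigma_reg_def)
next
  case False
  then show ?thesis using sum_r_reg[OF assms order_refl]
    by (simp add: g_reg_def r_reg_def field_simps)
qed

lemma t_g_reg: "0 \<le> t \<Longrightarrow> t * g_reg \<alpha> n t = 1 - r_reg \<alpha> n t"
  using sum_r_reg[of t n] by (simp add: g_reg_eq_sum)

lemma g_reg_nonneg: "0 \<le> t \<Longrightarrow> 0 \<le> g_reg \<alpha> n t"
  unfolding g_reg_eq_sum using r_reg_bounds(1) \<alpha> by (intro sum_nonneg divide_nonneg_pos) auto

lemma g_reg_le_sigma: "0 \<le> t \<Longrightarrow> g_reg \<alpha> n t \<le> sigma_reg \<alpha> n"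
  unfolding g_reg_eq_sum sigma_reg_def
  by (intro sum_mono divide_right_mono r_reg_bounds(2)) (auto intro: less_imp_le[OF \<alpha>])

lemma t_g_reg_le_1: "0 \<le> t \<Longrightarrow> t * g_reg \<alpha> n t \<le> 1"
  using t_g_reg r_reg_bounds(1)[of t n] by simp

lemma sigma_t_r_reg:
  assumes t: "0 \<le> t" shows "sigma_reg \<alpha> n * t * r_reg \<alpha> n t \<le> 1"
proof -
  have "sigma_reg \<alpha> n * r_reg \<alpha> n t \<le> g_reg \<alpha> n t"
    unfolding g_reg_eq_sum[OF t] sigma_reg_def sum_distrib_right
    by (rule sum_mono) (use r_reg_antimono[OF t] \<alpha> in \<open>auto intro: divide_right_mono less_imp_le\<close>)
  then have "t * (sigma_reg \<alpha> n * r_reg \<alpha> n t) \<le> t * g_reg \<alpha> n t" using t by (rule mult_left_mono)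
  then show ?thesis using t_g_reg_le_1[OF t] by (simp add: mult_ac)
qed

lemma continuous_on_r_reg: "j \<le> n \<Longrightarrow> continuous_on {0..u} (r_reg \<alpha> j)"
  unfolding r_reg_def by (intro continuous_intros) (use \<alpha> in \<open>force simp: add_nonneg_eq_0_iff\<close>)

lemma continuous_on_g_reg: "continuous_on {0..u} (g_reg \<alpha> n)"
proof (rule continuous_on_eq)
  show "continuous_on {0..u} (\<lambda>t. \<Sum>k=1..n. r_reg \<alpha> k t / \<alpha> k)"
    using \<alpha> by (intro continuous_intros continuous_on_r_reg) (auto simp: less_le)
qed (simp add: g_reg_eq_sum)

end

text \<open>Each estimate splits at \<open>t = 1 / \<sigma>\<close>.\<close>

lemma filter_bounds:
  fixes f :: "real \<Rightarrow> real"
  assumes \<alpha>: "\<And>k. 1 \<le> k \<Longrightarrow> k \<le> n \<Longrightarrow> 0 < \<alpha> k" and \<theta>: "1 / sigma_reg \<alpha> n = \<theta>" "0 < \<theta>" "\<theta> \<le> \<Lambda>"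
    and mono: "\<And>t u. 0 \<le> t \<Longrightarrow> t \<le> u \<Longrightarrow> u \<le> \<Lambda> \<Longrightarrow> f t \<le> f u" and f0: "0 \<le> f 0" and f\<theta>: "0 < f \<theta>"
    and quot: "\<And>t \<tau>. 0 \<le> t \<Longrightarrow> t \<le> \<tau> \<Longrightarrow> \<tau> \<le> \<Lambda> \<Longrightarrow> t * f \<tau> \<le> K * \<tau> * f t"
    and K: "1 \<le> K" and t: "0 \<le> t" "t \<le> \<Lambda>"
  shows "t * (g_reg \<alpha> n t)\<^sup>2 \<le> K / (\<theta> * f \<theta>) * f t"
    and "t * (r_reg \<alpha> n t)\<^sup>2 * f t \<le> K * \<theta> * f \<theta>"
    and "t * (g_reg \<alpha> n t)\<^sup>2 * f t \<le> K / \<theta> * f \<theta>"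
    and "t * (r_reg \<alpha> n t)\<^sup>2 \<le> K * \<theta> / f \<theta> * f t"
proof -
  let ?g = "g_reg \<alpha> n t" and ?r = "r_reg \<alpha> n t"
  have \<sigma>: "sigma_reg \<alpha> n = 1 / \<theta>" using \<theta> by (auto simp: field_simps)
  have g: "0 \<le> ?g" "?g \<le> 1 / \<theta>" "t * ?g \<le> 1"
    using g_reg_nonneg[of n \<alpha> t] g_reg_le_sigma[of n \<alpha> t] t_g_reg_le_1[of n \<alpha> t] \<alpha> t \<sigma> by auto
  have r: "0 \<le> ?r" "?r \<le> 1" "t * ?r \<le> \<theta>"
    using r_reg_bounds[of n \<alpha> t n] sigma_t_r_reg[of n \<alpha> t] \<alpha> t \<sigma> \<theta> by (auto simp: field_simps)
  have ft: "0 \<le> f t" using mono[of 0 t] f0 t by simp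
  have tg2: "t * ?g\<^sup>2 \<le> t / \<theta>\<^sup>2"
  proof -
    have "?g\<^sup>2 \<le> (1 / \<theta>)\<^sup>2" using g by (intro power_mono) auto
    then show ?thesis using mult_left_mono[of _ _ t] t by (fastforce simp: power_divide)
  qed
  have tg2': "t * (t * ?g\<^sup>2) \<le> 1"
  proof -
    have "(t * ?g)\<^sup>2 \<le> 1\<^sup>2" using g t by (intro power_mono) auto
    then show ?thesis by (simp add: power2_eq_square mult_ac)
  qed
  have tr2: "t * ?r\<^sup>2 \<le> t"
  proof -
    have "?r\<^sup>2 \<le> 1\<^sup>2" using r by (intro power_mono) auto
    then show ?thesis using mult_left_mono[of "?r\<^sup>2" 1 t] t by simp
  qed
  have tr2': "t * (t * ?r\<^sup>2) \<le> \<theta>\<^sup>2"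
  proof -
    have "(t * ?r)\<^sup>2 \<le> \<theta>\<^sup>2" using r t by (intro power_mono) auto
    then show ?thesis by (simp add: power2_eq_square mult_ac)
  qed
  have "t * ?g\<^sup>2 \<le> K / (\<theta> * f \<theta>) * f t \<and> t * ?r\<^sup>2 * f t \<le> K * \<theta> * f \<theta> \<and>
     t * ?g\<^sup>2 * f t \<le> K / \<theta> * f \<theta> \<and> t * ?r\<^sup>2 \<le> K * \<theta> / f \<theta> * f t"
  proof (cases "t \<le> \<theta>")
    case True
    have q: "t * f \<theta> \<le> K * \<theta> * f t" using quot[of t \<theta>] True t \<theta> by simp
    have m: "f t \<le> f \<theta>" using mono True t \<theta> by simp
    have tf: "t * f t \<le> \<theta> * f \<theta>" using True m t ft by (intro mult_mono) auto
    also have "\<dots> \<le> K * (\<theta> * f \<theta>)" using K \<theta> f\<theta> by simp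
    finally have tfK: "t * f t \<le> K * (\<theta> * f \<theta>)" .
    have "t / \<theta>\<^sup>2 \<le> K / (\<theta> * f \<theta>) * f t"
      using q \<theta> f\<theta> by (simp add: field_simps power2_eq_square)
    moreover have "t * ?r\<^sup>2 * f t \<le> t * f t" using tr2 ft by (rule mult_right_mono)
    moreover have "t * ?g\<^sup>2 * f t \<le> t / \<theta>\<^sup>2 * f t" using tg2 ft by (rule mult_right_mono)
    moreover have "t / \<theta>\<^sup>2 * f t \<le> K / \<theta> * f \<theta>"
      using tfK \<theta> by (simp add: field_simps power2_eq_square)
    moreover have "t \<le> K * \<theta> / f \<theta> * f t" using q f\<theta> by (simp add: field_simps)
    ultimately show ?thesis using tg2 tr2 tfK by (simp add: mult.assoc)
  next
    case False
    then have t0: "0 < t" "\<theta> \<le> t" using \<theta> by auto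
    have q: "\<theta> * f t \<le> K * t * f \<theta>" using quot[of \<theta> t] t0 t \<theta> by simp
    have m: "f \<theta> \<le> f t" using mono t0 t \<theta> by simp
    have g2: "t * ?g\<^sup>2 \<le> 1 / t" using tg2' t0 by (simp add: field_simps)
    have r2: "t * ?r\<^sup>2 \<le> \<theta>\<^sup>2 / t" using tr2' t0 by (simp add: field_simps)
    have ft_t: "f t / t \<le> K * f \<theta> / \<theta>" using q t0 \<theta> by (simp add: field_simps)
    have "1 / t \<le> 1 / \<theta>" using t0 \<theta> by (simp add: field_simps)
    also have "\<dots> \<le> K / (\<theta> * f \<theta>) * f t"
    proof -
      have "f \<theta> \<le> K * f t" using mult_mono[of 1 K "f \<theta>" "f t"] m K f\<theta> by simp
      then show ?thesis using \<theta> f\<theta> by (simp add: field_simps)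
    qed
    finally have 1: "1 / t \<le> K / (\<theta> * f \<theta>) * f t" .
    have 2: "t * ?r\<^sup>2 * f t \<le> K * \<theta> * f \<theta>"
    proof -
      have "t * ?r\<^sup>2 * f t \<le> \<theta>\<^sup>2 / t * f t" using r2 ft by (rule mult_right_mono)
      also have "\<dots> = \<theta>\<^sup>2 * (f t / t)" by simp
      also have "\<dots> \<le> \<theta>\<^sup>2 * (K * f \<theta> / \<theta>)" by (rule mult_left_mono[OF ft_t]) simp
      also have "\<dots> = K * \<theta> * f \<theta>" using \<theta> by (simp add: power2_eq_square)
      finally show ?thesis .
    qed
    have 3: "t * ?g\<^sup>2 * f t \<le> K / \<theta> * f \<theta>"
      using mult_right_mono[OF g2 ft] ft_t by simp
    have "\<theta>\<^sup>2 / t \<le> K * \<theta> / f \<theta> * f t"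
    proof -
      have "\<theta>\<^sup>2 / t \<le> \<theta>" using t0 \<theta> by (simp add: field_simps power2_eq_square)
      also have "\<dots> \<le> K * \<theta> / f \<theta> * f t"
      proof -
        have "f \<theta> \<le> K * f t" using mult_mono[of 1 K "f \<theta>" "f t"] m K f\<theta> by simp
        then show ?thesis using \<theta> f\<theta> by (simp add: field_simps)
      qed
      finally show ?thesis .
    qed
    then show ?thesis using 1 2 3 g2 r2 by simp
  qed
  then show "t * ?g\<^sup>2 \<le> K / (\<theta> * f \<theta>) * f t" "t * ?r\<^sup>2 * f t \<le> K * \<theta> * f \<theta>"
     "t * ?g\<^sup>2 * f t \<le> K / \<theta> * f \<theta>" "t * ?r\<^sup>2 \<le> K * \<theta> / f \<theta> * f t" by auto
qed

section \<open>Error components in terms of \<open>T\<^sup>*T\<close>\<close>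

locale normal_operator =
  fixes T :: "'a::{real_inner, complete_space} \<Rightarrow> 'b::real_inner" and Q :: "'a \<Rightarrow> 'a"
    and \<Lambda> C :: real and f :: "real \<Rightarrow> real"
  assumes T: "bounded_linear T" and N: "selfadjoint_between 0 \<Lambda> (adjoint T \<circ> T)"
    and f: "continuous_on {0..\<Lambda>} f" and f_nonneg: "\<And>t. 0 \<le> t \<Longrightarrow> t \<le> \<Lambda> \<Longrightarrow> 0 \<le> f t"
    and below: "\<And>z. fun_calc f (adjoint T \<circ> T) z \<bullet> z \<le> (norm (Q z))\<^sup>2"
    and above: "\<And>z. (norm (Q z))\<^sup>2 \<le> C * (fun_calc f (adjoint T \<circ> T) z \<bullet> z)"
    and C: "1 \<le> C"
begin

abbreviation calc :: "(real \<Rightarrow> real) \<Rightarrow> 'a \<Rightarrow> 'a" where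
  "calc k \<equiv> fun_calc k (adjoint T \<circ> T)"

lemma inner_calc_sandwich:
  assumes k: "continuous_on {0..\<Lambda>} k" and l: "continuous_on {0..\<Lambda>} l"
  shows "calc l (calc k z) \<bullet> calc k z = calc (\<lambda>t. l t * (k t)\<^sup>2) z \<bullet> z"
proof -
  have "calc l (calc k z) \<bullet> calc k z = calc k (calc l (calc k z)) \<bullet> z"
    by (simp add: bounded_selfadjoint_sym[OF bounded_selfadjoint_fun_calc[OF N k]])
  also have "calc k (calc l (calc k z)) = calc (\<lambda>t. k t * (l t * k t)) z"
    using fun_calc_mult[OF N k, of "\<lambda>t. l t * k t" z] fun_calc_mult[OF N l k, of z]
    by (simp add: continuous_intros k l)
  also have "(\<lambda>t. k t * (l t * k t)) = (\<lambda>t. l t * (k t)\<^sup>2)" by (auto simp: power2_eq_square)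
  finally show ?thesis .
qed

lemma norm_T_calc:
  assumes k: "continuous_on {0..\<Lambda>} k"
  shows "(norm (T (calc k z)))\<^sup>2 = calc (\<lambda>t. t * (k t)\<^sup>2) z \<bullet> z"
proof -
  have "(norm (T y))\<^sup>2 = calc (\<lambda>t. t) y \<bullet> y" for y
    using fun_calc_ident[OF N, of y] inner_adjoint[OF T, of y "T y"]
    by (simp add: power2_norm_eq_inner inner_commute)
  then show ?thesis using inner_calc_sandwich[OF k, of "\<lambda>t. t" z] by (simp add: continuous_intros)
qed

lemma inner_calc_adjoint:
  assumes k: "continuous_on {0..\<Lambda>} k"
  shows "calc k (adjoint T e) \<bullet> z = T (calc k z) \<bullet> e"
proof -
  have "calc k (adjoint T e) \<bullet> z = adjoint T e \<bullet> calc k z"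
    by (rule bounded_selfadjoint_sym[OF bounded_selfadjoint_fun_calc[OF N k]])
  also have "\<dots> = T (calc k z) \<bullet> e"
    using inner_adjoint[OF T, of "calc k z" e] by (simp add: inner_commute)
  finally show ?thesis .
qed

lemma norm_T_calc_le:
  assumes k: "continuous_on {0..\<Lambda>} k" and b: "0 \<le> b"
    and le: "\<And>t. 0 \<le> t \<Longrightarrow> t \<le> \<Lambda> \<Longrightarrow> t * (k t)\<^sup>2 \<le> b * f t"
  shows "(norm (T (calc k z)))\<^sup>2 \<le> b * (norm (Q z))\<^sup>2"
proof -
  have "(norm (T (calc k z)))\<^sup>2 \<le> calc (\<lambda>t. b * f t) z \<bullet> z"
    unfolding norm_T_calc[OF k] by (rule fun_calc_mono[OF N]) (use k f le in \<open>auto intro!: continuous_intros\<close>)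
  also have "\<dots> = b * (calc f z \<bullet> z)" by (simp add: fun_calc_scale[OF N f])
  also have "\<dots> \<le> b * (norm (Q z))\<^sup>2" using below b by (intro mult_left_mono)
  finally show ?thesis .
qed

lemma norm_Q_calc_le:
  assumes k: "continuous_on {0..\<Lambda>} k" and le: "\<And>t. 0 \<le> t \<Longrightarrow> t \<le> \<Lambda> \<Longrightarrow> \<bar>k t\<bar> \<le> 1"
  shows "norm (Q (calc k z)) \<le> C * norm (Q z)"
proof (rule power2_le_imp_le)
  have "(norm (Q (calc k z)))\<^sup>2 \<le> C * (calc f (calc k z) \<bullet> calc k z)" by (rule above)
  also have "\<dots> = C * (calc (\<lambda>t. f t * (k t)\<^sup>2) z \<bullet> z)" by (simp add: inner_calc_sandwich[OF k f])
  also have "\<dots> \<le> C * (calc f z \<bullet> z)"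
  proof (intro mult_left_mono fun_calc_mono[OF N])
    fix t assume t: "t \<in> {0..\<Lambda>}"
    then have "(k t)\<^sup>2 \<le> 1" using le[of t] by (simp add: abs_square_le_1)
    then show "f t * (k t)\<^sup>2 \<le> f t" using f_nonneg[of t] t by (simp add: mult_left_le)
  qed (use k f C in \<open>auto intro!: continuous_intros\<close>)
  also have "\<dots> \<le> C * (norm (Q z))\<^sup>2" using below C by (intro mult_left_mono) auto
  also have "\<dots> \<le> C\<^sup>2 * (norm (Q z))\<^sup>2"
    using C by (intro mult_right_mono) (auto simp: power2_eq_square)
  finally show "(norm (Q (calc k z)))\<^sup>2 \<le> (C * norm (Q z))\<^sup>2" by (simp add: power_mult_distrib)
qed (use C in auto)

lemma norm_Q_calc_adjoint_le:
  assumes k: "continuous_on {0..\<Lambda>} k" and b: "0 \<le> b"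
    and le: "\<And>t. 0 \<le> t \<Longrightarrow> t \<le> \<Lambda> \<Longrightarrow> C * (t * (k t)\<^sup>2 * f t) \<le> b\<^sup>2"
  shows "norm (Q (calc k (adjoint T e))) \<le> b * norm e"
proof -
  let ?h = "\<lambda>t. sqrt (f t)" and ?kh = "\<lambda>t. k t * sqrt (f t)"
  have h: "continuous_on {0..\<Lambda>} ?h" by (intro continuous_intros f)
  have kh: "continuous_on {0..\<Lambda>} ?kh" by (intro continuous_intros h k)
  define Y where "Y = calc ?h (calc k (adjoint T e))"
  have Y: "Y = calc ?kh (adjoint T e)"
    unfolding Y_def using fun_calc_mult[OF N h k] by (simp add: mult.commute)
  have f_eq: "calc f = calc (\<lambda>t. (?h t)\<^sup>2)" by (rule fun_calc_cong[OF N]) (use f_nonneg in auto)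
  have "(norm Y)\<^sup>2 = calc f (calc k (adjoint T e)) \<bullet> calc k (adjoint T e)"
    unfolding Y_def f_eq norm_fun_calc_square[OF N h] ..
  then have QY: "(norm (Q (calc k (adjoint T e))))\<^sup>2 \<le> C * (norm Y)\<^sup>2" by (metis above)
  have "(norm (T (calc ?kh Y)))\<^sup>2 \<le> calc (\<lambda>t. b\<^sup>2 / C) Y \<bullet> Y"
    unfolding norm_T_calc[OF kh]
  proof (rule fun_calc_mono[OF N])
    fix t assume t: "t \<in> {0..\<Lambda>}"
    then show "t * (?kh t)\<^sup>2 \<le> b\<^sup>2 / C"
      using le[of t] f_nonneg[of t] C by (simp add: field_simps power_mult_distrib)
  qed (intro continuous_intros kh)+
  then have "C * (norm (T (calc ?kh Y)))\<^sup>2 \<le> (b * norm Y)\<^sup>2"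
    using C by (simp add: fun_calc_const[OF N] power2_norm_eq_inner power_mult_distrib field_simps)
  moreover have "(norm Y)\<^sup>2 \<le> norm e * norm (T (calc ?kh Y))"
  proof -
    have "(norm Y)\<^sup>2 = calc ?kh (adjoint T e) \<bullet> Y" by (simp add: Y power2_norm_eq_inner)
    also have "\<dots> = T (calc ?kh Y) \<bullet> e" by (rule inner_calc_adjoint[OF kh])
    also have "\<dots> \<le> norm (T (calc ?kh Y)) * norm e" by (rule norm_cauchy_schwarz)
    finally show ?thesis by (simp add: mult.commute)
  qed
  then have "((norm Y)\<^sup>2)\<^sup>2 \<le> (norm e * norm (T (calc ?kh Y)))\<^sup>2" by (intro power_mono) auto
  ultimately have "C * ((norm Y)\<^sup>2 * (norm Y)\<^sup>2) \<le> (norm e)\<^sup>2 * (b\<^sup>2 * (norm Y)\<^sup>2)"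
  proof -
    assume 1: "C * (norm (T (calc ?kh Y)))\<^sup>2 \<le> (b * norm Y)\<^sup>2"
      and 2: "((norm Y)\<^sup>2)\<^sup>2 \<le> (norm e * norm (T (calc ?kh Y)))\<^sup>2"
    have "C * ((norm Y)\<^sup>2)\<^sup>2 \<le> C * (norm e * norm (T (calc ?kh Y)))\<^sup>2" using 2 C by (intro mult_left_mono) auto
    also have "\<dots> = (norm e)\<^sup>2 * (C * (norm (T (calc ?kh Y)))\<^sup>2)" by (simp add: power_mult_distrib)
    also have "\<dots> \<le> (norm e)\<^sup>2 * (b * norm Y)\<^sup>2" using 1 by (intro mult_left_mono) auto
    finally show ?thesis by (simp add: power_mult_distrib power2_eq_square mult_ac)
  qed
  then have "(C * (norm Y)\<^sup>2) * (norm Y)\<^sup>2 \<le> (b * norm e)\<^sup>2 * (norm Y)\<^sup>2"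
    by (simp add: power_mult_distrib mult_ac)
  then have "C * (norm Y)\<^sup>2 \<le> (b * norm e)\<^sup>2" by (cases "Y = 0") auto
  with QY have "(norm (Q (calc k (adjoint T e))))\<^sup>2 \<le> (b * norm e)\<^sup>2" by simp
  then show ?thesis by (rule power2_le_imp_le) (use b in simp)
qed

lemma norm_T_calc_adjoint_le:
  assumes k: "continuous_on {0..\<Lambda>} k"
    and le: "\<And>t. 0 \<le> t \<Longrightarrow> t \<le> \<Lambda> \<Longrightarrow> 0 \<le> k t \<and> t * k t \<le> 1"
  shows "norm (T (calc k (adjoint T e))) \<le> norm e"
proof -
  let ?y = "T (calc k (adjoint T e))"
  have "(norm ?y)\<^sup>2 \<le> calc k (adjoint T e) \<bullet> adjoint T e"
    unfolding norm_T_calc[OF k]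
  proof (rule fun_calc_mono[OF N])
    fix t assume t: "t \<in> {0..\<Lambda>}"
    then have "(t * k t) * k t \<le> 1 * k t" using le[of t] by (intro mult_right_mono) auto
    then show "t * (k t)\<^sup>2 \<le> k t" by (simp add: power2_eq_square mult_ac)
  qed (intro continuous_intros k)+
  also have "\<dots> = ?y \<bullet> e" by (simp add: inner_adjoint[OF T])
  also have "\<dots> \<le> norm ?y * norm e" by (rule norm_cauchy_schwarz)
  finally show ?thesis by (cases "?y = 0") (auto simp: power2_eq_square)
qed

context
  fixes \<alpha> :: "nat \<Rightarrow> real" and n :: nat and \<theta> K a1 b1 :: real
  assumes \<alpha>: "\<And>k. 1 \<le> k \<Longrightarrow> k \<le> n \<Longrightarrow> 0 < \<alpha> k" and \<theta>: "1 / sigma_reg \<alpha> n = \<theta>" "0 < \<theta>" "\<theta> \<le> \<Lambda>"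
    and f_mono: "\<And>t u. 0 \<le> t \<Longrightarrow> t \<le> u \<Longrightarrow> u \<le> \<Lambda> \<Longrightarrow> f t \<le> f u" and f\<theta>: "0 < f \<theta>"
    and quot: "\<And>t \<tau>. 0 \<le> t \<Longrightarrow> t \<le> \<tau> \<Longrightarrow> \<tau> \<le> \<Lambda> \<Longrightarrow> t * f \<tau> \<le> K * \<tau> * f t"
    and K: "1 \<le> K" and dense: "closure (range Q) = UNIV" and Q: "bounded_selfadjoint Q"
    and a1: "0 \<le> a1" and b1: "0 \<le> b1"
begin

lemma \<Lambda>_nonneg: "0 \<le> \<Lambda>" using \<theta> by simp

lemma cont_g: "continuous_on {0..\<Lambda>} (g_reg \<alpha> n)" by (rule continuous_on_g_reg[OF \<alpha>])
lemma cont_r: "continuous_on {0..\<Lambda>} (r_reg \<alpha> n)" by (rule continuous_on_r_reg[OF \<alpha>]) auto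

lemma bounds:
  assumes t: "0 \<le> t" "t \<le> \<Lambda>"
  shows "t * (g_reg \<alpha> n t)\<^sup>2 \<le> K / (\<theta> * f \<theta>) * f t"
    and "t * (r_reg \<alpha> n t)\<^sup>2 * f t \<le> K * \<theta> * f \<theta>"
    and "t * (g_reg \<alpha> n t)\<^sup>2 * f t \<le> K / \<theta> * f \<theta>"
    and "t * (r_reg \<alpha> n t)\<^sup>2 \<le> K * \<theta> / f \<theta> * f t"
proof -
  have f0: "0 \<le> f 0" by (rule f_nonneg[OF order_refl \<Lambda>_nonneg])
  note prems = \<alpha> \<theta> f_mono f0 f\<theta> quot K t
  show "t * (g_reg \<alpha> n t)\<^sup>2 \<le> K / (\<theta> * f \<theta>) * f t"
    by (rule filter_bounds(1)[where \<Lambda> = \<Lambda>]; fact prems)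
  show "t * (r_reg \<alpha> n t)\<^sup>2 * f t \<le> K * \<theta> * f \<theta>"
    by (rule filter_bounds(2)[where \<Lambda> = \<Lambda>]; fact prems)
  show "t * (g_reg \<alpha> n t)\<^sup>2 * f t \<le> K / \<theta> * f \<theta>"
    by (rule filter_bounds(3)[where \<Lambda> = \<Lambda>]; fact prems)
  show "t * (r_reg \<alpha> n t)\<^sup>2 \<le> K * \<theta> / f \<theta> * f t"
    by (rule filter_bounds(4)[where \<Lambda> = \<Lambda>]; fact prems)
qed

lemma linear_facts: "linear T" "linear Q" "linear (adjoint T)" "linear (calc (g_reg \<alpha> n))" "linear (calc (r_reg \<alpha> n))"
  using T Q bounded_linear_adjoint(2)[OF T] bounded_linear_fun_calc[OF N cont_g] bounded_linear_fun_calc[OF N cont_r]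
  by (simp_all add: bounded_linear.linear bounded_selfadjoint_linear)

lemma calc_g_N: "calc (g_reg \<alpha> n) (adjoint T (T z)) = z - calc (r_reg \<alpha> n) z"
proof -
  have "calc (g_reg \<alpha> n) (adjoint T (T z)) = calc (\<lambda>t. g_reg \<alpha> n t * t) z"
    using fun_calc_mult[OF N cont_g, of "\<lambda>t. t" z] fun_calc_ident[OF N, of z] by (simp add: continuous_intros)
  also have "calc (\<lambda>t. g_reg \<alpha> n t * t) = calc (\<lambda>t. 1 - r_reg \<alpha> n t)"
  proof (rule fun_calc_cong[OF N])
    show "g_reg \<alpha> n t * t = 1 - r_reg \<alpha> n t" if "t \<in> {0..\<Lambda>}" for t
      using t_g_reg[of n \<alpha> t] \<alpha> that by (simp add: mult.commute)
  qed
  also have "calc (\<lambda>t. 1 - r_reg \<alpha> n t) z = z - calc (r_reg \<alpha> n) z"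
    using fun_calc_diff[OF N _ cont_r, of "\<lambda>_. 1" z] by (simp add: fun_calc_const[OF N] continuous_intros)
  finally show ?thesis .
qed

lemma norm_Q_r: "norm (Q (calc (r_reg \<alpha> n) z)) \<le> C * norm (Q z)"
  using r_reg_bounds[of n \<alpha> _ n] \<alpha> by (intro norm_Q_calc_le cont_r) (auto simp: abs_le_iff intro: order_trans)

lemma norm_T_g_adjoint: "norm (T (calc (g_reg \<alpha> n) (adjoint T e))) \<le> norm e"
  using g_reg_nonneg[of n \<alpha>] t_g_reg_le_1[of n \<alpha>] \<alpha> by (intro norm_T_calc_adjoint_le cont_g) auto

lemma low_order_error:
  assumes a1': "K / (\<theta> * f \<theta>) \<le> a1\<^sup>2" and b1': "C * (K * \<theta> * f \<theta>) \<le> b1\<^sup>2"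
  obtains w where "calc (g_reg \<alpha> n) (adjoint T (e + T (Q v))) - Q v = Q w"
    "norm w \<le> C * norm v + a1 * norm e" "norm (T (Q w)) \<le> norm e + b1 * norm v"
proof -
  let ?g = "calc (g_reg \<alpha> n)" and ?r = "calc (r_reg \<alpha> n)"
  have "\<bar>?g (adjoint T e) \<bullet> z\<bar> \<le> (a1 * norm e) * norm (Q z)" for z
  proof -
    have "(norm (T (?g z)))\<^sup>2 \<le> a1\<^sup>2 * (norm (Q z))\<^sup>2"
    proof (rule norm_T_calc_le[OF cont_g])
      fix t assume t: "0 \<le> t" "t \<le> \<Lambda>"
      have "t * (g_reg \<alpha> n t)\<^sup>2 \<le> K / (\<theta> * f \<theta>) * f t" using bounds(1)[OF t] .
      also have "\<dots> \<le> a1\<^sup>2 * f t" using a1' f_nonneg[OF t] by (rule mult_right_mono)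
      finally show "t * (g_reg \<alpha> n t)\<^sup>2 \<le> a1\<^sup>2 * f t" .
    qed simp
    then have *: "norm (T (?g z)) \<le> a1 * norm (Q z)"
      by (metis a1 mult_nonneg_nonneg norm_ge_zero power2_le_imp_le power_mult_distrib)
    have "?g (adjoint T e) \<bullet> z = T (?g z) \<bullet> e" by (rule inner_calc_adjoint[OF cont_g])
    then have "\<bar>?g (adjoint T e) \<bullet> z\<bar> \<le> norm (T (?g z)) * norm e" by (simp add: Cauchy_Schwarz_ineq2)
    also have "\<dots> \<le> a1 * norm (Q z) * norm e" using * by (rule mult_right_mono) simp
    finally show ?thesis by (simp add: mult_ac)
  qed
  then obtain w2 where w2: "?g (adjoint T e) = Q w2" "norm w2 \<le> a1 * norm e"
    by (rule bounded_selfadjoint_range_by_duality[OF Q dense]) (use a1 in simp)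
  have "\<bar>?r (Q v) \<bullet> z\<bar> \<le> (C * norm v) * norm (Q z)" for z
  proof -
    have "?r (Q v) \<bullet> z = v \<bullet> Q (?r z)"
      by (simp add: bounded_selfadjoint_sym[OF bounded_selfadjoint_fun_calc[OF N cont_r]] bounded_selfadjoint_sym[OF Q])
    then have "\<bar>?r (Q v) \<bullet> z\<bar> \<le> norm v * norm (Q (?r z))" by (simp add: Cauchy_Schwarz_ineq2)
    also have "\<dots> \<le> norm v * (C * norm (Q z))" using norm_Q_r by (rule mult_left_mono) simp
    finally show ?thesis by (simp add: mult_ac)
  qed
  then obtain w1 where w1: "?r (Q v) = Q w1" "norm w1 \<le> C * norm v"
    by (rule bounded_selfadjoint_range_by_duality[OF Q dense]) (use C in simp)
  have "?g (adjoint T (e + T (Q v))) - Q v = Q (w2 - w1)"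
    by (simp add: linear_add[OF linear_facts(3)] linear_add[OF linear_facts(4)] calc_g_N w1 w2 linear_diff[OF linear_facts(2)])
  moreover have "norm (w2 - w1) \<le> C * norm v + a1 * norm e"
    using norm_triangle_ineq4[of w2 w1] w1 w2 by linarith
  moreover have "norm (T (Q (w2 - w1))) \<le> norm e + b1 * norm v"
  proof -
    have adj: "T (?r (Q v)) \<bullet> u = v \<bullet> Q (?r (adjoint T u))" for u
      by (simp add: inner_adjoint[OF T] bounded_selfadjoint_sym[OF bounded_selfadjoint_fun_calc[OF N cont_r]] bounded_selfadjoint_sym[OF Q])
    have "norm (T (?r (Q v))) \<le> b1 * norm v"
    proof -
      let ?u = "T (?r (Q v))"
      have "norm (Q (?r (adjoint T ?u))) \<le> b1 * norm ?u"
      proof (rule norm_Q_calc_adjoint_le[OF cont_r b1])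
        fix t assume t: "0 \<le> t" "t \<le> \<Lambda>"
        have "C * (t * (r_reg \<alpha> n t)\<^sup>2 * f t) \<le> C * (K * \<theta> * f \<theta>)"
          using bounds(2)[OF t] C by (intro mult_left_mono) auto
        then show "C * (t * (r_reg \<alpha> n t)\<^sup>2 * f t) \<le> b1\<^sup>2" using b1' by simp
      qed
      then have "norm v * norm (Q (?r (adjoint T ?u))) \<le> norm v * (b1 * norm ?u)" by (rule mult_left_mono) simp
      moreover have "(norm ?u)\<^sup>2 \<le> norm v * norm (Q (?r (adjoint T ?u)))"
        using adj[of ?u] norm_cauchy_schwarz[of v "Q (?r (adjoint T ?u))"] by (simp add: power2_norm_eq_inner)
      ultimately have "norm ?u * norm ?u \<le> (b1 * norm v) * norm ?u" by (simp add: power2_eq_square mult_ac)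
      then show ?thesis by (cases "?u = 0") (use b1 in auto)
    qed
    moreover have "T (Q (w2 - w1)) = T (?g (adjoint T e)) - T (?r (Q v))"
      by (simp add: w1 w2 linear_diff[OF linear_facts(2)] linear_diff[OF linear_facts(1)])
    ultimately show ?thesis
      using norm_T_g_adjoint[of e] norm_triangle_ineq4[of "T (?g (adjoint T e))" "T (?r (Q v))"] by simp
  qed
  ultimately show ?thesis by (rule that)
qed

lemma high_order_error:
  fixes v :: 'a and e :: 'b
  assumes L: "bounded_linear L" and TL: "\<And>x. T x = L (Q x)"
    and a1': "C * (K / \<theta> * f \<theta>) \<le> a1\<^sup>2" and b1': "K * \<theta> / f \<theta> \<le> b1\<^sup>2"
  defines "w \<equiv> Q (calc (g_reg \<alpha> n) (adjoint T (e + L v))) - v"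
  shows "norm w \<le> C * norm v + a1 * norm e" "norm (L w) \<le> norm e + b1 * norm v"
proof -
  let ?g = "calc (g_reg \<alpha> n)" and ?r = "calc (r_reg \<alpha> n)"
  have lin: "linear L" using L by (simp add: bounded_linear.linear)
  define W where "W v = Q (?g (adjoint T (L v))) - v" for v
  have W_cont: "continuous_on UNIV W" unfolding W_def
    by (intro continuous_intros linear_continuous_on bounded_linear_compose[OF bounded_selfadjoint_linear[OF Q]]
        bounded_linear_compose[OF bounded_linear_fun_calc[OF N cont_g]]
        bounded_linear_compose[OF bounded_linear_adjoint(2)[OF T]] L)
  have W_Q: "W (Q z) = - Q (?r z)" for z
    by (simp add: W_def TL[symmetric] calc_g_N linear_diff[OF linear_facts(2)])
  have "norm (W v) \<le> C * norm v \<and> norm (L (W v)) \<le> b1 * norm v" for v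
  proof -
    have on_range: "norm (W (Q z)) \<le> C * norm (Q z) \<and> norm (L (W (Q z))) \<le> b1 * norm (Q z)" for z
    proof -
      have "(norm (T (?r z)))\<^sup>2 \<le> b1\<^sup>2 * (norm (Q z))\<^sup>2"
      proof (rule norm_T_calc_le[OF cont_r])
        fix t assume t: "0 \<le> t" "t \<le> \<Lambda>"
        have "t * (r_reg \<alpha> n t)\<^sup>2 \<le> K * \<theta> / f \<theta> * f t" using bounds(4)[OF t] .
        also have "\<dots> \<le> b1\<^sup>2 * f t" using b1' f_nonneg[OF t] by (rule mult_right_mono)
        finally show "t * (r_reg \<alpha> n t)\<^sup>2 \<le> b1\<^sup>2 * f t" .
      qed simp
      then have "norm (T (?r z)) \<le> b1 * norm (Q z)"
        by (metis b1 mult_nonneg_nonneg norm_ge_zero power2_le_imp_le power_mult_distrib)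
      then show "norm (W (Q z)) \<le> C * norm (Q z) \<and> norm (L (W (Q z))) \<le> b1 * norm (Q z)"
        using norm_Q_r[of z] by (simp add: W_Q linear_neg[OF lin] TL[symmetric])
    qed
    have "closed {v. norm (W v) \<le> C * norm v \<and> norm (L (W v)) \<le> b1 * norm v}"
      by (intro closed_Collect_conj closed_Collect_le continuous_intros W_cont
          continuous_on_compose2[OF linear_continuous_on[OF L, of UNIV] W_cont]) auto
    then show ?thesis by (rule dense_induct[OF dense]) (use on_range in auto)
  qed
  moreover have w: "w = Q (?g (adjoint T e)) + W v"
    by (simp add: w_def W_def linear_add[OF linear_facts(3)] linear_add[OF linear_facts(4)] linear_add[OF linear_facts(2)])
  moreover have "norm (Q (?g (adjoint T e))) \<le> a1 * norm e"
  proof (rule norm_Q_calc_adjoint_le[OF cont_g a1])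
    fix t assume t: "0 \<le> t" "t \<le> \<Lambda>"
    have "C * (t * (g_reg \<alpha> n t)\<^sup>2 * f t) \<le> C * (K / \<theta> * f \<theta>)"
      using bounds(3)[OF t] C by (intro mult_left_mono) auto
    then show "C * (t * (g_reg \<alpha> n t)\<^sup>2 * f t) \<le> a1\<^sup>2" using a1' by simp
  qed
  ultimately show "norm w \<le> C * norm v + a1 * norm e"
    using norm_triangle_ineq[of "Q (?g (adjoint T e))" "W v"] by (smt (verit))
  have "L w = T (?g (adjoint T e)) + L (W v)" by (simp add: w linear_add[OF lin] TL)
  moreover have "norm (L (W v)) \<le> b1 * norm v"
    using \<open>\<And>v. norm (W v) \<le> C * norm v \<and> norm (L (W v)) \<le> b1 * norm v\<close> by blast
  ultimately show "norm (L w) \<le> norm e + b1 * norm v"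
    using norm_triangle_ineq[of "T (?g (adjoint T e))" "L (W v)"] norm_T_g_adjoint[of e] by simp
qed

end

end

section \<open>The linked Hilbert scale\<close>

locale linked_scale = positive_dense G a
  for G :: "'a::{real_inner, complete_space} \<Rightarrow> 'a" and a :: real +
  fixes A :: "'a \<Rightarrow> 'b::{real_inner, complete_space}" and \<rho> :: "real \<Rightarrow> real" and s p m M :: real
  assumes a: "0 < a" and A: "bounded_linear A" and \<rho>: "index_function a \<rho>"
    and psi_s: "index_function a (psi \<rho> s)" and m: "0 < m" and mM: "m \<le> M" and p: "0 < p"
    and link_lower: "\<And>x. m * norm (fun_calc (ext0 \<rho>) G x) \<le> norm (A x)"
    and link_upper: "\<And>x. norm (A x) \<le> M * norm (fun_calc (ext0 \<rho>) G x)"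
begin

abbreviation \<Psi> :: "'a \<Rightarrow> 'a" where "\<Psi> \<equiv> fun_calc (ext0 (psi \<rho> s)) G"
abbreviation T :: "'a \<Rightarrow> 'b" where "T \<equiv> T_op A G s"
abbreviation c :: real where "c \<equiv> (psi \<rho> s a)\<^sup>2"
abbreviation Q :: "'a \<Rightarrow> 'a" where "Q \<equiv> Pow \<bar>p - s\<bar>"

definition \<phi> :: "real \<Rightarrow> real" where "\<phi> t = ext0 (psi_inv \<rho> a s) (sqrt t)"
definition F :: "real \<Rightarrow> real" where "F t = pow0 (2 * \<bar>p - s\<bar>) (\<phi> t)"

lemmas cont_\<rho> = continuous_on_ext0[OF \<rho>] and cont_psi_s = continuous_on_ext0[OF psi_s]

lemma psi_s_a: "0 < psi \<rho> s a" using index_function_pos[OF psi_s a] by simp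

lemma M: "0 < M" using m mM by simp

lemma c_pos: "0 < c" using psi_s_a by simp

lemma psi_p: "index_function a (psi \<rho> p)" by (rule index_function_psi[OF \<rho> p])

lemma ext0_psi_le: "0 \<le> t \<Longrightarrow> t \<le> a \<Longrightarrow> 0 \<le> ext0 (psi \<rho> s) t \<and> ext0 (psi \<rho> s) t \<le> psi \<rho> s a"
  using index_function_pos[OF psi_s, of t] index_function_mono[OF psi_s, of t a] psi_s_a by (auto simp: ext0_def)

lemma \<phi>_psi: "0 \<le> t \<Longrightarrow> t \<le> a \<Longrightarrow> \<phi> ((ext0 (psi \<rho> s) t)\<^sup>2) = t"
  using ext0_psi_le[of t] index_function_inverse_left[OF psi_s a, of t] index_function_pos[OF psi_s, of t]
  by (auto simp: \<phi>_def psi_inv_def ext0_def)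

lemma sqrt_le_psi_s_a: "t \<le> c \<Longrightarrow> sqrt t \<le> psi \<rho> s a"
  using psi_s_a by (simp add: real_le_lsqrt)

lemma \<phi>_range: "0 \<le> t \<Longrightarrow> t \<le> c \<Longrightarrow> 0 \<le> \<phi> t \<and> \<phi> t \<le> a"
  and \<phi>_pos: "0 < t \<Longrightarrow> t \<le> c \<Longrightarrow> 0 < \<phi> t"
  and psi_\<phi>: "0 < t \<Longrightarrow> t \<le> c \<Longrightarrow> psi \<rho> s (\<phi> t) = sqrt t"
  using index_function_inverse_right[OF psi_s a, of "sqrt t"] sqrt_le_psi_s_a[of t] a
  by (auto simp: \<phi>_def psi_inv_def ext0_def)

lemma \<phi>_mono:
  assumes "0 \<le> t" "t \<le> u" "u \<le> c" shows "\<phi> t \<le> \<phi> u"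
proof (cases "t = 0")
  case True
  then show ?thesis using \<phi>_range[of u] assms by (simp add: \<phi>_def ext0_def)
next
  case False
  show ?thesis
  proof (rule ccontr)
    assume "\<not> \<phi> t \<le> \<phi> u"
    then have "\<phi> u < \<phi> t" by simp
    moreover have "0 < \<phi> u" "\<phi> t \<le> a" using \<phi>_pos[of u] \<phi>_range[of t] assms False by auto
    ultimately have "psi \<rho> s (\<phi> u) < psi \<rho> s (\<phi> t)"
      using psi_s by (auto simp: index_function_def intro: strict_mono_onD)
    then show False using psi_\<phi>[of t] psi_\<phi>[of u] assms False by simp
  qed
qed

lemma cont_\<phi>: "continuous_on {0..c} \<phi>"
  unfolding \<phi>_def psi_inv_def
  by (rule continuous_on_compose2[OF continuous_on_inverse_ext0[OF psi_s a] continuous_on_real_sqrt[OF continuous_on_id]])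
     (auto simp: sqrt_le_psi_s_a)

lemma cont_F: "continuous_on {0..c} F"
  unfolding F_def by (rule continuous_on_compose2[OF continuous_on_pow0 cont_\<phi>]) (auto simp: \<phi>_range)

lemma F_nonneg: "0 \<le> F t" by (simp add: F_def pow0_nonneg)

lemma F_pos: "0 < t \<Longrightarrow> t \<le> c \<Longrightarrow> 0 < F t"
  using \<phi>_pos[of t] by (simp add: F_def pow0_pos)

lemma F_mono: "0 \<le> t \<Longrightarrow> t \<le> u \<Longrightarrow> u \<le> c \<Longrightarrow> F t \<le> F u"
  unfolding F_def using \<phi>_mono[of t u] \<phi>_range[of t] by (intro pow0_mono) auto

lemma F_psi: "0 < t \<Longrightarrow> t \<le> a \<Longrightarrow> F ((psi \<rho> s t)\<^sup>2) = t powr (2 * \<bar>p - s\<bar>)"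
  using \<phi>_psi[of t] by (simp add: F_def ext0_def pow0_pos)

lemma w_fun_square: "0 < t \<Longrightarrow> t \<le> c \<Longrightarrow> p \<le> s \<Longrightarrow> (w_fun \<rho> a s p t)\<^sup>2 = F t"
  and h_fun_square: "0 < t \<Longrightarrow> t \<le> c \<Longrightarrow> s \<le> p \<Longrightarrow> (h_fun \<rho> a s p t)\<^sup>2 = F t"
proof -
  assume t: "0 < t" "t \<le> c"
  have \<phi>: "0 < \<phi> t" "psi_inv \<rho> a s (sqrt t) = \<phi> t" using \<phi>_pos[OF t] t by (simp_all add: \<phi>_def ext0_def)
  have sq: "(\<phi> t powr x)\<^sup>2 = \<phi> t powr (2 * x)" for x
    using \<phi> by (simp add: power2_eq_square flip: powr_add)
  show "(w_fun \<rho> a s p t)\<^sup>2 = F t" if "p \<le> s"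
  proof -
    have "w_fun \<rho> a s p t = \<phi> t powr (s - p)"
      using \<phi> by (simp add: w_fun_def h_fun_def powr_diff)
    then show ?thesis using that \<phi> by (simp add: F_def pow0_pos sq)
  qed
  show "(h_fun \<rho> a s p t)\<^sup>2 = F t" if "s \<le> p"
    using that \<phi> by (simp add: F_def pow0_pos sq h_fun_def)
qed

lemma psi_sq_maps: "t \<in> {0..a} \<Longrightarrow> (ext0 (psi \<rho> s) t)\<^sup>2 \<in> {0..c}"
  using ext0_psi_le[of t] by (auto intro: power_mono)

lemma norm_Q_square: "(norm (Q z))\<^sup>2 = fun_calc F (fun_calc (\<lambda>t. (ext0 (psi \<rho> s) t)\<^sup>2) G) z \<bullet> z"
proof -
  have "continuous_on {0..a} (\<lambda>t. (ext0 (psi \<rho> s) t)\<^sup>2)" by (intro continuous_intros cont_psi_s)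
  then have "fun_calc F (fun_calc (\<lambda>t. (ext0 (psi \<rho> s) t)\<^sup>2) G) z = fun_calc (\<lambda>t. F ((ext0 (psi \<rho> s) t)\<^sup>2)) G z"
    by (rule fun_calc_compose[OF G _ psi_sq_maps cont_F])
  also have "fun_calc (\<lambda>t. F ((ext0 (psi \<rho> s) t)\<^sup>2)) G = fun_calc (\<lambda>t. (pow0 \<bar>p - s\<bar> t)\<^sup>2) G"
  proof (rule fun_calc_cong[OF G])
    fix t assume "t \<in> {0..a}"
    then show "F ((ext0 (psi \<rho> s) t)\<^sup>2) = (pow0 \<bar>p - s\<bar> t)\<^sup>2"
      using pow0_add[of "\<bar>p - s\<bar>" "\<bar>p - s\<bar>" t] by (simp add: F_def \<phi>_psi) (simp add: power2_eq_square)
  qed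
  finally show ?thesis by (simp add: norm_fun_calc_square[OF G continuous_on_pow0_Icc])
qed

lemma bounded_linear_\<Psi>: "bounded_linear \<Psi>"
  by (rule bounded_linear_fun_calc[OF G cont_psi_s])

lemma norm_\<Psi>_le: "norm (\<Psi> x) \<le> psi \<rho> s a * norm x"
  by (rule norm_fun_calc_le[OF G cont_psi_s]) (use ext0_psi_le psi_s_a in \<open>auto simp: less_imp_le\<close>)

lemma \<rho>_Pow: "0 \<le> s \<Longrightarrow> fun_calc (ext0 \<rho>) G (Pow s x) = \<Psi> x"
proof -
  assume s: "0 \<le> s"
  have "fun_calc (\<lambda>t. ext0 \<rho> t * pow0 s t) G = \<Psi>"
    by (rule fun_calc_cong[OF G]) (auto simp: ext0_def psi_def pow0_pos)
  then show ?thesis using fun_calc_mult[OF G cont_\<rho> continuous_on_pow0_Icc[OF s], of x] by simp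
qed

lemma \<Psi>_Pow: "s < 0 \<Longrightarrow> \<Psi> (Pow (- s) x) = fun_calc (ext0 \<rho>) G x"
proof -
  assume s: "s < 0"
  have "fun_calc (\<lambda>t. ext0 (psi \<rho> s) t * pow0 (- s) t) G = fun_calc (ext0 \<rho>) G"
    by (rule fun_calc_cong[OF G]) (auto simp: ext0_def psi_def pow0_pos powr_minus field_simps)
  moreover have "0 \<le> - s" using s by simp
  ultimately show ?thesis using fun_calc_mult[OF G cont_psi_s continuous_on_pow0_Icc, of "- s" x] by simp
qed

lemma T_spec: "bounded_linear T \<and> (\<forall>x\<in>op_powr_dom G s. T x = A (op_powr G s x))"
proof -
  have dense: "closure (op_powr_dom G s) = UNIV"
    using Pow_dense[of "- s"] by (simp add: op_powr_dom_eq)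
  have "\<exists>W. bounded_linear W \<and> (\<forall>x\<in>op_powr_dom G s. W x = A (op_powr G s x))"
  proof (cases "0 \<le> s")
    case True
    then show ?thesis
      by (intro exI[of _ "\<lambda>x. A (Pow s x)"])
         (auto simp: op_powr_eq_Pow intro!: bounded_linear_compose[OF A] bounded_linear_Pow)
  next
    case False
    then have s: "s < 0" "0 \<le> - s" by auto
    note lin = bounded_linear.linear[OF bounded_linear_Pow[OF s(2)]] and linA = bounded_linear.linear[OF A]
    obtain W where W: "bounded_linear W" "\<And>x. x \<in> UNIV \<Longrightarrow> W (Pow (- s) x) = A x"
    proof (rule bounded_linear_extension[where U = "Pow (- s)" and V = A and Z = UNIV and K = "M * psi \<rho> s a"])
      show "closure (range (Pow (- s))) = UNIV" by (rule Pow_dense[OF s(2)])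
      show "\<exists>z\<in>UNIV. Pow (- s) z = Pow (- s) x + Pow (- s) y \<and> A z = A x + A y" for x y
        by (intro bexI[of _ "x + y"]) (auto simp: linear_add[OF lin] linear_add[OF linA])
      show "\<exists>z\<in>UNIV. Pow (- s) z = r *\<^sub>R Pow (- s) x \<and> A z = r *\<^sub>R A x" for r x
        by (intro bexI[of _ "r *\<^sub>R x"]) (auto simp: linear_scale[OF lin] linear_scale[OF linA])
      show "norm (A x) \<le> M * psi \<rho> s a * norm (Pow (- s) x)" for x
      proof -
        have "norm (A x) \<le> M * norm (\<Psi> (Pow (- s) x))" using link_upper[of x] by (simp add: \<Psi>_Pow[OF s(1)])
        also have "\<dots> \<le> M * (psi \<rho> s a * norm (Pow (- s) x))"
          using norm_\<Psi>_le M by (intro mult_left_mono) auto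
        finally show ?thesis by (simp add: mult.assoc)
      qed
    qed auto
    then show ?thesis using s by (intro exI[of _ W]) (auto simp: op_powr_dom_eq op_powr_neg_Pow)
  qed
  then have "\<exists>!W. bounded_linear W \<and> (\<forall>x\<in>op_powr_dom G s. W x = A (op_powr G s x))"
  proof (rule ex_ex1I)
    fix V W assume V: "bounded_linear V \<and> (\<forall>x\<in>op_powr_dom G s. V x = A (op_powr G s x))"
      and W: "bounded_linear W \<and> (\<forall>x\<in>op_powr_dom G s. W x = A (op_powr G s x))"
    have "closed {x. V x = W x}" using V W by (intro closed_Collect_eq linear_continuous_on) auto
    then have "V x = W x" for x by (rule dense_induct[OF dense]) (use V W in auto)
    then show "V = W" by (rule ext)
  qed
  then show ?thesis unfolding T_op_def by (rule theI')
qed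

lemma T: "bounded_linear T" using T_spec by blast

lemma T_Pow: "s < 0 \<Longrightarrow> T (Pow (- s) x) = A x"
  using T_spec by (auto simp: op_powr_dom_eq op_powr_neg_Pow)

lemma T_nonneg: "0 \<le> s \<Longrightarrow> T x = A (Pow s x)"
  using T_spec by (auto simp: op_powr_dom_eq op_powr_eq_Pow)

lemma T_link: "m * norm (\<Psi> z) \<le> norm (T z) \<and> norm (T z) \<le> M * norm (\<Psi> z)"
proof (cases "0 \<le> s")
  case True
  then show ?thesis using link_lower[of "Pow s z"] link_upper[of "Pow s z"] by (simp add: T_nonneg \<rho>_Pow)
next
  case False
  then have s: "s < 0" "0 \<le> - s" by auto
  have "closed {z. m * norm (\<Psi> z) \<le> norm (T z) \<and> norm (T z) \<le> M * norm (\<Psi> z)}"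
    by (intro closed_Collect_conj closed_Collect_le continuous_intros linear_continuous_on T bounded_linear_\<Psi>)
  then show ?thesis
    by (rule dense_induct[OF Pow_dense[OF s(2)]])
       (use link_lower link_upper in \<open>auto simp: T_Pow[OF s(1)] \<Psi>_Pow[OF s(1)]\<close>)
qed

lemma low_order_factor:
  assumes "s \<le> p"
  shows T_Q_low: "T (Q v) = A (Pow p v)" and op_powr_Q_low: "op_powr G s (Q v) = Pow p v"
proof -
  have "T (Q v) = A (Pow p v) \<and> op_powr G s (Q v) = Pow p v"
  proof (cases "0 \<le> s")
    case True
    then show ?thesis using assms Pow_add[of s "p - s" v] by (simp add: T_nonneg op_powr_eq_Pow)
  next
    case False
    then have "Q v = Pow (- s) (Pow p v)" using assms Pow_add[of "- s" p v] p by simp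
    then show ?thesis using False by (simp add: T_Pow op_powr_neg_Pow)
  qed
  then show "T (Q v) = A (Pow p v)" "op_powr G s (Q v) = Pow p v" by auto
qed

lemma high_order_factor:
  assumes "p \<le> s"
  shows T_Q_high: "T v = A (Pow p (Q v))" and op_powr_Q_high: "op_powr G s v = Pow p (Q v)"
  using assms p Pow_add[of p "s - p" v] by (simp_all add: T_nonneg op_powr_eq_Pow)

lemma N_inner: "(adjoint T \<circ> T) z \<bullet> z = (norm (T z))\<^sup>2"
  using inner_adjoint[OF T, of z "T z"] by (simp add: power2_norm_eq_inner inner_commute)

lemma N_between: "selfadjoint_between 0 (M\<^sup>2 * c) (adjoint T \<circ> T)"
  unfolding selfadjoint_between_def bounded_selfadjoint_def
proof (intro conjI allI)
  show "bounded_linear (adjoint T \<circ> T)"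
    unfolding comp_def by (rule bounded_linear_compose[OF bounded_linear_adjoint(2)[OF T] T])
  show "(adjoint T \<circ> T) x \<bullet> y = x \<bullet> (adjoint T \<circ> T) y" for x y
    using inner_adjoint[OF T, of x "T y"] inner_adjoint[OF T, of y "T x"] by (simp add: inner_commute)
  show "0 * (x \<bullet> x) \<le> (adjoint T \<circ> T) x \<bullet> x" for x unfolding N_inner by simp
  show "(adjoint T \<circ> T) x \<bullet> x \<le> M\<^sup>2 * c * (x \<bullet> x)" for x
  proof -
    have "norm (T x) \<le> M * norm (\<Psi> x)" using T_link by blast
    also have "\<dots> \<le> M * (psi \<rho> s a * norm x)" using M norm_\<Psi>_le by (intro mult_left_mono) auto
    finally have "(norm (T x))\<^sup>2 \<le> (M * (psi \<rho> s a * norm x))\<^sup>2" by (intro power_mono) auto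
    then show ?thesis unfolding N_inner by (simp add: power_mult_distrib power2_norm_eq_inner mult_ac)
  qed
qed

lemma scale_interpolation:
  assumes t: "0 < t" "t \<le> a"
  shows "(norm (Pow p w))\<^sup>2 \<le> (t powr p)\<^sup>2 * (norm w)\<^sup>2 + (norm (A (Pow p w)) / (m * \<rho> t))\<^sup>2"
proof -
  have \<rho>t: "0 < \<rho> t" using index_function_pos[OF \<rho> t] .
  have cont: "continuous_on {0..a} (\<lambda>u. ext0 \<rho> u * pow0 p u)"
    using p by (intro continuous_intros cont_\<rho> continuous_on_pow0_Icc) simp
  have pp: "0 \<le> p" using p by simp
  have "(norm (Pow p w))\<^sup>2 = fun_calc (\<lambda>u. (pow0 p u)\<^sup>2) G w \<bullet> w"
    using p by (simp add: norm_fun_calc_square[OF G continuous_on_pow0_Icc])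
  also have "\<dots> \<le> fun_calc (\<lambda>u. (t powr p)\<^sup>2 + (1 / \<rho> t)\<^sup>2 * (ext0 \<rho> u * pow0 p u)\<^sup>2) G w \<bullet> w"
  proof (rule fun_calc_mono[OF G])
    show "continuous_on {0..a} (\<lambda>u. (pow0 p u)\<^sup>2)" using p by (intro continuous_intros continuous_on_pow0_Icc) simp
    show "continuous_on {0..a} (\<lambda>u. (t powr p)\<^sup>2 + (1 / \<rho> t)\<^sup>2 * (ext0 \<rho> u * pow0 p u)\<^sup>2)"
      by (intro continuous_intros cont)
    fix u assume u: "u \<in> {0..a}"
    show "(pow0 p u)\<^sup>2 \<le> (t powr p)\<^sup>2 + (1 / \<rho> t)\<^sup>2 * (ext0 \<rho> u * pow0 p u)\<^sup>2"
    proof (cases "u \<le> t")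
      case True
      then have "(pow0 p u)\<^sup>2 \<le> (t powr p)\<^sup>2"
        using u p pow0_nonneg[of p u] pow0_mono[of p u t] t by (intro power_mono) (auto simp: pow0_pos)
      then show ?thesis by (simp add: add_increasing2)
    next
      case False
      then have "1 \<le> 1 / \<rho> t * ext0 \<rho> u"
        using index_function_mono[OF \<rho>, of t u] t u \<rho>t by (simp add: ext0_def field_simps)
      then have "1 * pow0 p u \<le> 1 / \<rho> t * ext0 \<rho> u * pow0 p u" using pow0_nonneg by (rule mult_right_mono)
      then have "(pow0 p u)\<^sup>2 \<le> (1 / \<rho> t * (ext0 \<rho> u * pow0 p u))\<^sup>2"
        using pow0_nonneg[of p u] by (intro power_mono) (auto simp: mult.assoc)
      also have "\<dots> = (1 / \<rho> t)\<^sup>2 * (ext0 \<rho> u * pow0 p u)\<^sup>2" by (simp only: power_mult_distrib)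
      finally show ?thesis by (simp add: add_increasing)
    qed
  qed
  also have "\<dots> = (t powr p)\<^sup>2 * (norm w)\<^sup>2 + (1 / \<rho> t)\<^sup>2 * (norm (fun_calc (ext0 \<rho>) G (Pow p w)))\<^sup>2"
  proof -
    have "fun_calc (ext0 \<rho>) G (Pow p w) = fun_calc (\<lambda>u. ext0 \<rho> u * pow0 p u) G w"
      using fun_calc_mult[OF G cont_\<rho> continuous_on_pow0_Icc[OF pp], of w] by simp
    moreover have "continuous_on {0..a} (\<lambda>u. (ext0 \<rho> u * pow0 p u)\<^sup>2)" by (intro continuous_intros cont)
    ultimately show ?thesis
      by (simp add: fun_calc_add[OF G] fun_calc_scale[OF G] fun_calc_const[OF G] continuous_intros
          inner_add_left norm_fun_calc_square[OF G cont] dot_square_norm)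
  qed
  also have "(1 / \<rho> t)\<^sup>2 * (norm (fun_calc (ext0 \<rho>) G (Pow p w)))\<^sup>2 \<le> (norm (A (Pow p w)) / (m * \<rho> t))\<^sup>2"
  proof -
    have "norm (fun_calc (ext0 \<rho>) G (Pow p w)) / \<rho> t \<le> norm (A (Pow p w)) / (m * \<rho> t)"
      using link_lower[of "Pow p w"] m \<rho>t by (simp add: field_simps)
    then have "(norm (fun_calc (ext0 \<rho>) G (Pow p w)) / \<rho> t)\<^sup>2 \<le> (norm (A (Pow p w)) / (m * \<rho> t))\<^sup>2"
      using \<rho>t by (intro power_mono) auto
    then show ?thesis by (simp add: power_divide)
  qed
  finally show ?thesis by simp
qed

end

section \<open>Error bounds and order optimality\<close>

context linked_scale
begin

lemma psi_inv_p:
  assumes "0 < t" "t \<le> psi \<rho> p a"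
  shows "0 < psi_inv \<rho> a p t" "psi_inv \<rho> a p t \<le> a" "psi \<rho> p (psi_inv \<rho> a p t) = t"
  using index_function_inverse_right[OF psi_p a assms] by (simp_all add: psi_inv_def)

lemma op_powr_p: "op_powr G p = Pow p"
  using p by (simp add: op_powr_eq_Pow)

lemma mem_source_set_iff: "x \<in> source_set G x0 p E \<longleftrightarrow> (\<exists>w. x - x0 = Pow p w \<and> norm w \<le> E)"
  using op_powr_neg_Pow[of "- p"] p
  by (auto simp: source_set_def op_powr_dom_eq scale_norm_def)

lemma psi_inv_p_ratio:
  assumes E: "0 < E" and \<delta>: "0 < \<delta>" "\<delta> / (m * E) \<le> psi \<rho> p a"
  shows "\<delta> / (M * E) \<le> psi \<rho> p a"
    "psi_inv \<rho> a p (\<delta> / (m * E)) powr p \<le> M / m * psi_inv \<rho> a p (\<delta> / (M * E)) powr p"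
proof -
  have t: "0 < \<delta> / (M * E)" "0 < \<delta> / (m * E)" using \<delta> E m M by auto
  have Mm: "\<delta> / (M * E) \<le> \<delta> / (m * E)" using \<delta> E m mM by (intro divide_left_mono) auto
  then show le: "\<delta> / (M * E) \<le> psi \<rho> p a" using \<delta> by simp
  define l0 lM where "l0 = psi_inv \<rho> a p (\<delta> / (m * E))" and "lM = psi_inv \<rho> a p (\<delta> / (M * E))"
  note l0 = psi_inv_p[OF t(2) \<delta>(2), folded l0_def] and lM = psi_inv_p[OF t(1) le, folded lM_def]
  have "lM \<le> l0"
  proof (rule ccontr)
    assume "\<not> lM \<le> l0"
    then have "psi \<rho> p l0 < psi \<rho> p lM"
      using psi_p l0 lM strict_mono_onD[of "{0<..a}" "psi \<rho> p" l0 lM] by (simp add: index_function_def)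
    then show False using l0 lM Mm by simp
  qed
  then have \<rho>le: "\<rho> lM \<le> \<rho> l0" using index_function_mono[OF \<rho>] l0 lM by simp
  have \<rho>pos: "0 < \<rho> lM" using index_function_pos[OF \<rho>] lM by simp
  have "l0 powr p * \<rho> lM \<le> l0 powr p * \<rho> l0" using \<rho>le by (intro mult_left_mono) auto
  also have "\<dots> = \<delta> / (m * E)" using l0(3) by (simp add: psi_def)
  also have "\<dots> = M / m * (\<delta> / (M * E))" using M by simp
  also have "\<delta> / (M * E) = lM powr p * \<rho> lM" using lM(3) by (simp add: psi_def)
  finally have "l0 powr p * \<rho> lM \<le> (M / m * lM powr p) * \<rho> lM" by (simp add: mult.assoc)
  then have "l0 powr p \<le> M / m * lM powr p" using \<rho>pos by (rule mult_right_le_imp_le)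
  then show "psi_inv \<rho> a p (\<delta> / (m * E)) powr p \<le> M / m * psi_inv \<rho> a p (\<delta> / (M * E)) powr p"
    by (simp only: l0_def lM_def)
qed

lemma best_worst_case_error_lower_bound:
  assumes E: "0 < E" and \<delta>: "0 < \<delta>" "\<delta> / (M * E) \<le> psi \<rho> p a"
    and spec: "\<delta> / (M * E) \<in> spectrum_op (fun_calc (ext0 (psi \<rho> p)) G)"
  shows "ennreal (E * psi_inv \<rho> a p (\<delta> / (M * E)) powr p)
    \<le> best_worst_case_error A (source_set G x0 p E) \<delta>"
  unfolding best_worst_case_error_def
proof (rule INF_greatest)
  fix R :: "'b \<Rightarrow> 'a"
  define t where "t = \<delta> / (M * E)"
  define l where "l = psi_inv \<rho> a p t"
  have t: "0 < t" "t \<le> psi \<rho> p a" using \<delta> E M by (auto simp: t_def)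
  note l = psi_inv_p[OF t, folded l_def]
  let ?P = "fun_calc (ext0 (psi \<rho> p)) G"
  have cont: "continuous_on {0..a} (ext0 (psi \<rho> p))" by (rule continuous_on_ext0[OF psi_p])
  have range: "ext0 (psi \<rho> p) u \<in> {0..psi \<rho> p a}" if "u \<in> {0..a}" for u
    using that index_function_pos[OF psi_p, of u] index_function_mono[OF psi_p, of u a] index_function_pos[OF psi_p a]
    by (auto simp: ext0_def)
  have P: "selfadjoint_between 0 (psi \<rho> p a) ?P"
    by (rule selfadjoint_between_fun_calc[OF G cont]) (use range in auto)
  have "\<exists>x. norm x = 1 \<and> norm (?P x - t *\<^sub>R x) < 1 / real (Suc n)" for n
    using approximate_eigenvector[OF selfadjoint_between_selfadjoint[OF P] spec, of "1 / real (Suc n)"]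
    by (metis of_nat_0_less_iff t_def zero_less_Suc zero_less_divide_1_iff)
  then obtain X where X: "\<And>n. norm (X n) = 1" "\<And>n. norm (?P (X n) - t *\<^sub>R X n) < 1 / real (Suc n)" by metis
  have lim: "(\<lambda>n. ?P (X n) - t *\<^sub>R X n) \<longlonglongrightarrow> 0"
  proof (rule Lim_null_comparison)
    show "\<forall>\<^sub>F n in sequentially. norm (?P (X n) - t *\<^sub>R X n) \<le> 1 / real (Suc n)"
      using X(2) by (intro always_eventually allI less_imp_le)
    show "(\<lambda>n. 1 / real (Suc n)) \<longlonglongrightarrow> 0"
      using LIMSEQ_inverse_real_of_nat by (simp add: inverse_eq_divide)
  qed
  define \<kappa> where "\<kappa> u = pow0 p (ext0 (psi_inv \<rho> a p) u)" for u
  have \<kappa>: "continuous_on {0..psi \<rho> p a} \<kappa>"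
    unfolding \<kappa>_def psi_inv_def
  proof (rule continuous_on_compose2[OF continuous_on_pow0 continuous_on_inverse_ext0[OF psi_p a]])
    show "ext0 (the_inv_into {0<..a} (psi \<rho> p)) ` {0..psi \<rho> p a} \<subseteq> {0..}"
      using index_function_inverse_right[OF psi_p a] by (auto simp: ext0_def less_imp_le)
  qed (use p in simp)
  have \<kappa>P: "fun_calc \<kappa> ?P x = Pow p x" for x
  proof -
    have "fun_calc \<kappa> ?P x = fun_calc (\<lambda>u. \<kappa> (ext0 (psi \<rho> p) u)) G x"
      by (rule fun_calc_compose[OF G cont range \<kappa>])
    also have "fun_calc (\<lambda>u. \<kappa> (ext0 (psi \<rho> p) u)) G = Pow p"
    proof (rule fun_calc_cong[OF G])
      fix u assume "u \<in> {0..a}"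
      then show "\<kappa> (ext0 (psi \<rho> p) u) = pow0 p u"
        using index_function_inverse_left[OF psi_p a, of u] index_function_pos[OF psi_p, of u]
        by (auto simp: \<kappa>_def ext0_def psi_inv_def)
    qed
    finally show ?thesis .
  qed
  have "(\<lambda>n. fun_calc \<kappa> ?P (X n) - \<kappa> t *\<^sub>R X n) \<longlonglongrightarrow> 0"
    by (rule fun_calc_approximate_eigenvector[OF P \<kappa> _ X(1) lim]) (use t in auto)
  moreover have "\<kappa> t = l powr p" using t l by (simp add: \<kappa>_def ext0_def l_def pow0_pos)
  ultimately have lim': "(\<lambda>n. Pow p (X n) - l powr p *\<^sub>R X n) \<longlonglongrightarrow> 0" by (simp add: \<kappa>P)
  have norm_lim: "(\<lambda>n. norm (Y n)) \<longlonglongrightarrow> k" if "(\<lambda>n. Y n - k *\<^sub>R X n) \<longlonglongrightarrow> 0" "0 \<le> k" for Y k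
  proof -
    have "(\<lambda>n. norm (Y n) - k) \<longlonglongrightarrow> 0"
    proof (rule Lim_null_comparison)
      show "\<forall>\<^sub>F n in sequentially. norm (norm (Y n) - k) \<le> norm (Y n - k *\<^sub>R X n)"
      proof (intro always_eventually allI)
        fix n
        have "norm (k *\<^sub>R X n) = k" using X(1) that by simp
        then show "norm (norm (Y n) - k) \<le> norm (Y n - k *\<^sub>R X n)"
          using norm_triangle_ineq3[of "Y n" "k *\<^sub>R X n"] by simp
      qed
      show "(\<lambda>n. norm (Y n - k *\<^sub>R X n)) \<longlonglongrightarrow> 0" using that(1) by (rule tendsto_norm_zero)
    qed
    then show ?thesis by (simp add: LIM_zero_iff)
  qed
  show "ennreal (E * psi_inv \<rho> a p (\<delta> / (M * E)) powr p) \<le> worst_case_error A (source_set G x0 p E) \<delta> R"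
  proof (rule ccontr)
    assume "\<not> ?thesis"
    then have less: "worst_case_error A (source_set G x0 p E) \<delta> R < ennreal (E * l powr p)"
      by (simp add: l_def t_def)
    then obtain r where r: "0 \<le> r" "worst_case_error A (source_set G x0 p E) \<delta> R = ennreal r"
      by (metis ennreal_cases ennreal_less_top not_less_iff_gr_or_eq order_less_trans)
    have El: "0 < E * l powr p" using E l by simp
    have rEl: "r < E * l powr p" using less r El by (simp add: ennreal_less_iff)
    define q where "q = (r / (E * l powr p) + 1) / 2"
    have q: "0 < q" "q < 1" "r < q * E * l powr p"
      using rEl r(1) El by (auto simp: q_def field_simps add_pos_nonneg)
    have "(\<lambda>n. q * E * norm (Pow p (X n))) \<longlonglongrightarrow> q * E * l powr p"
      using norm_lim[OF lim'] by (intro tendsto_intros) simp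
    then have ev1: "\<forall>\<^sub>F n in sequentially. r < q * E * norm (Pow p (X n))"
      using q(3) by (rule order_tendstoD)
    have "(\<lambda>n. M * (q * E * norm (?P (X n)))) \<longlonglongrightarrow> M * (q * E * t)"
      using norm_lim[OF lim] t by (intro tendsto_intros) simp
    moreover have "M * (q * E * t) < \<delta>" using q \<delta>(1) E M by (simp add: t_def)
    ultimately have "\<forall>\<^sub>F n in sequentially. M * (q * E * norm (?P (X n))) < \<delta>" by (rule order_tendstoD)
    with ev1 have "\<forall>\<^sub>F n in sequentially. r < q * E * norm (Pow p (X n)) \<and> M * (q * E * norm (?P (X n))) < \<delta>"
      by (rule eventually_conj)
    then obtain n where n: "r < q * E * norm (Pow p (X n))" "M * (q * E * norm (?P (X n))) < \<delta>"
      by (metis (no_types, lifting) eventually_sequentially order_refl)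
    have pp: "0 \<le> p" using p by simp
    note linP = bounded_linear.linear[OF bounded_linear_Pow[OF pp]]
    define w where "w = (q * E) *\<^sub>R X n"
    define d where "d = Pow p w"
    have w: "norm w \<le> E" using q E X(1) by (simp add: w_def abs_mult mult_left_le_one_le)
    have d: "norm d = q * E * norm (Pow p (X n))"
      using q(1) E by (simp add: d_def w_def linear_scale[OF linP] abs_mult)
    have "norm (A d) \<le> M * norm (fun_calc (ext0 \<rho>) G (Pow p w))" unfolding d_def by (rule link_upper)
    also have "fun_calc (ext0 \<rho>) G (Pow p w) = ?P w"
    proof -
      have "fun_calc (\<lambda>u. ext0 \<rho> u * pow0 p u) G = ?P"
        by (rule fun_calc_cong[OF G]) (auto simp: ext0_def psi_def pow0_pos)
      then show ?thesis using fun_calc_mult[OF G cont_\<rho> continuous_on_pow0_Icc[OF pp], of w] by simp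
    qed
    also have "?P w = (q * E) *\<^sub>R ?P (X n)"
      by (simp add: w_def linear_scale[OF bounded_linear.linear[OF bounded_linear_fun_calc[OF G cont]]])
    also have "M * norm ((q * E) *\<^sub>R ?P (X n)) < \<delta>" using n(2) q(1) E by (simp add: abs_mult)
    finally have Ad: "norm (A d) \<le> \<delta>" by simp
    have linA: "linear A" using A by (rule bounded_linear.linear)
    have bound: "norm (R (A x0) - x) \<le> r" if x: "x \<in> source_set G x0 p E" "norm (A x - A x0) \<le> \<delta>" for x
    proof -
      have "ennreal (norm (R (A x0) - x)) \<le> worst_case_error A (source_set G x0 p E) \<delta> R"
        unfolding worst_case_error_def by (rule SUP_upper2[OF x(1)], rule SUP_upper2[where i = "A x0"]) (use x in auto)
      then show ?thesis using r by simp
    qed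
    have "norm (R (A x0) - (x0 + d)) \<le> r"
      by (rule bound) (use w Ad in \<open>auto simp: mem_source_set_iff d_def linear_add[OF linA]\<close>)
    moreover have "norm (R (A x0) - (x0 - d)) \<le> r"
    proof (rule bound)
      have "x0 - d - x0 = Pow p (- w)" by (simp add: d_def linear_neg[OF linP])
      then show "x0 - d \<in> source_set G x0 p E" using w by (auto simp: mem_source_set_iff)
    qed (use Ad in \<open>auto simp: linear_diff[OF linA]\<close>)
    moreover have "2 *\<^sub>R d = (R (A x0) - (x0 - d)) - (R (A x0) - (x0 + d))" by (simp add: scaleR_2)
    then have "2 * norm d \<le> norm (R (A x0) - (x0 - d)) + norm (R (A x0) - (x0 + d))"
      using norm_triangle_ineq4[of "R (A x0) - (x0 - d)" "R (A x0) - (x0 + d)"] norm_scaleR[of 2 d] by simp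
    ultimately show False using n(1) d by simp
  qed
qed

definition ratio_const :: "real \<Rightarrow> real" where "ratio_const K = K * (M / m)\<^sup>2"

lemma ratio_const_ge_1: "1 \<le> K \<Longrightarrow> 1 \<le> ratio_const K"
proof -
  assume K: "1 \<le> K"
  have "1 \<le> (M / m)\<^sup>2" using m mM by simp
  then show ?thesis using K mult_mono[of 1 K 1 "(M / m)\<^sup>2"] by (simp add: ratio_const_def)
qed

context
  fixes K :: real
  assumes mono: "operator_monotone TYPE('a) c F" and K: "1 \<le> K"
    and quot: "\<And>t \<tau>. 0 < t \<Longrightarrow> t \<le> \<tau> \<Longrightarrow> \<tau> \<le> c \<Longrightarrow> t * F \<tau> \<le> K * \<tau> * F t"
begin

abbreviation C :: real where "C \<equiv> ratio_const K"

lemmas C_ge_1 = ratio_const_ge_1[OF K]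

lemma quot0: "0 \<le> t \<Longrightarrow> t \<le> \<tau> \<Longrightarrow> \<tau> \<le> c \<Longrightarrow> t * F \<tau> \<le> K * \<tau> * F t"
  using quot[of t \<tau>] K F_nonneg by (cases "t = 0") auto

lemma F_le_scaled: 
  assumes "0 \<le> t" "t \<le> c" shows "F t \<le> C * F ((m / M)\<^sup>2 * t)"
proof (cases "t = 0")
  case True
  then show ?thesis using mult_right_mono[OF C_ge_1 F_nonneg[of 0]] by simp
next
  case False
  have "(m / M)\<^sup>2 * t \<le> 1 * t" using m mM assms M by (intro mult_right_mono) (auto simp: power_le_one)
  then have "(m / M)\<^sup>2 * t * F t \<le> K * t * F ((m / M)\<^sup>2 * t)" using False assms m M by (intro quot) auto
  then have "(m / M)\<^sup>2 * F t \<le> K * F ((m / M)\<^sup>2 * t)" using False assms by (simp add: mult_ac)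
  then show ?thesis using m M by (simp add: ratio_const_def power_divide field_simps)
qed

text \<open>Operator monotonicity is applied to \<open>(m / M)\<^sup>2 \<Psi>\<^sup>2 \<le> T\<^sup>*T / M\<^sup>2 \<le> \<Psi>\<^sup>2\<close>; dividing by
  \<open>M\<^sup>2\<close> keeps the spectrum of \<open>T\<^sup>*T\<close> inside the domain of \<open>F\<close>.\<close>

lemma normal_operator_T: "normal_operator T Q (M\<^sup>2 * c) C (\<lambda>t. F (t / M\<^sup>2))"
proof -
  let ?P2 = "fun_calc (\<lambda>t. (ext0 (psi \<rho> s) t)\<^sup>2) G" and ?N = "adjoint T \<circ> T"
  let ?S = "fun_calc (\<lambda>t. t / M\<^sup>2) ?N" and ?P2' = "fun_calc (\<lambda>t. (m / M)\<^sup>2 * t) (fun_calc (\<lambda>t. (ext0 (psi \<rho> s) t)\<^sup>2) G)"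
  have sq: "continuous_on {0..a} (\<lambda>t. (ext0 (psi \<rho> s) t)\<^sup>2)" by (intro continuous_intros cont_psi_s)
  have P2: "selfadjoint_between 0 c ?P2"
    by (rule selfadjoint_between_fun_calc[OF G sq]) (use psi_sq_maps in auto)
  have div: "continuous_on {0..M\<^sup>2 * c} (\<lambda>t. t / M\<^sup>2)" using M by (intro continuous_intros) auto
  have div_maps: "t / M\<^sup>2 \<in> {0..c}" if "t \<in> {0..M\<^sup>2 * c}" for t
    using that M by (auto simp: field_simps)
  have S: "selfadjoint_between 0 c ?S"
    by (rule selfadjoint_between_fun_calc[OF N_between div]) (use div_maps in auto)
  have mul: "continuous_on {0..c} (\<lambda>t. (m / M)\<^sup>2 * t)" by (intro continuous_intros)
  have mM2: "(m / M)\<^sup>2 \<le> 1" using m mM M by (auto simp: power_le_one)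
  have mul_maps: "(m / M)\<^sup>2 * t \<in> {0..c}" if "t \<in> {0..c}" for t
    using that mM2 mult_mono[of "(m / M)\<^sup>2" 1 t c] by auto
  have P2': "selfadjoint_between 0 c ?P2'"
    by (rule selfadjoint_between_fun_calc[OF P2 mul]) (use mul_maps in auto)
  have inner_P2: "?P2 z \<bullet> z = (norm (\<Psi> z))\<^sup>2" for z
    by (simp add: norm_fun_calc_square[OF G cont_psi_s])
  have inner_S: "?S z \<bullet> z = (norm (T z) / M)\<^sup>2" for z
  proof -
    have "?S z = (1 / M\<^sup>2) *\<^sub>R ?N z"
      using fun_calc_scale[OF N_between continuous_on_id, of "1 / M\<^sup>2" z] fun_calc_ident[OF N_between, of z] by simp
    then show ?thesis using N_inner[of z] by (simp add: power_divide del: comp_apply)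
  qed
  have inner_P2': "?P2' z \<bullet> z = (m / M * norm (\<Psi> z))\<^sup>2" for z
    using fun_calc_scale[OF P2 continuous_on_id, of "(m / M)\<^sup>2" z] fun_calc_ident[OF P2, of z] inner_P2[of z]
    by (simp add: power_mult_distrib power_divide)
  have "op_le ?S ?P2"
    unfolding op_le_def inner_S inner_P2
  proof
    fix z
    have "norm (T z) / M \<le> norm (\<Psi> z)" using T_link[of z] M by (simp add: field_simps)
    then show "(norm (T z) / M)\<^sup>2 \<le> (norm (\<Psi> z))\<^sup>2" using M by (intro power_mono) auto
  qed
  then have below: "fun_calc F ?S z \<bullet> z \<le> (norm (Q z))\<^sup>2" for z
    unfolding norm_Q_square using operator_monotone_closed_interval[OF mono cont_F c_pos S P2]
    by (simp add: op_le_def)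
  have "op_le ?P2' ?S"
    unfolding op_le_def inner_S inner_P2'
  proof
    fix z
    have "m / M * norm (\<Psi> z) \<le> norm (T z) / M" using T_link[of z] M by (simp add: field_simps)
    then show "(m / M * norm (\<Psi> z))\<^sup>2 \<le> (norm (T z) / M)\<^sup>2" using m M by (intro power_mono) auto
  qed
  then have "fun_calc F ?P2' z \<bullet> z \<le> fun_calc F ?S z \<bullet> z" for z
    using operator_monotone_closed_interval[OF mono cont_F c_pos P2' S] by (simp add: op_le_def)
  moreover have "(norm (Q z))\<^sup>2 \<le> C * (fun_calc F ?P2' z \<bullet> z)" for z
  proof -
    have comp: "continuous_on {0..c} (\<lambda>t. F ((m / M)\<^sup>2 * t))"
      by (rule continuous_on_compose2[OF cont_F mul]) (use mul_maps in auto)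
    have "(norm (Q z))\<^sup>2 \<le> fun_calc (\<lambda>t. C * F ((m / M)\<^sup>2 * t)) ?P2 z \<bullet> z"
      unfolding norm_Q_square by (rule fun_calc_mono[OF P2 cont_F])
        (use F_le_scaled in \<open>auto intro!: continuous_intros comp\<close>)
    then show ?thesis
      using fun_calc_scale[OF P2 comp, of C z] fun_calc_compose[OF P2 mul mul_maps cont_F, of z] by simp
  qed
  moreover have "C * (fun_calc F ?P2' z \<bullet> z) \<le> C * (fun_calc F ?S z \<bullet> z)" for z
    using calculation(1) C_ge_1 by (intro mult_left_mono) auto
  ultimately have above: "(norm (Q z))\<^sup>2 \<le> C * (fun_calc F ?S z \<bullet> z)" for z
    using order_trans by blast
  have FS: "fun_calc F ?S z = fun_calc (\<lambda>t. F (t / M\<^sup>2)) ?N z" for z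
    by (rule fun_calc_compose[OF N_between div div_maps cont_F])
  have "continuous_on {0..M\<^sup>2 * c} (\<lambda>t. F (t / M\<^sup>2))"
    by (rule continuous_on_compose2[OF cont_F div]) (use div_maps in auto)
  then show ?thesis
    using T N_between F_nonneg below above C_ge_1 by (intro normal_operator.intro) (simp_all only: FS)
qed

lemma regularization_error_in_source_scale:
  assumes E: "0 < E" and \<delta>: "0 < \<delta>" "\<delta> / (m * E) \<le> psi \<rho> p a"
    and \<alpha>: "\<And>k. 1 \<le> k \<Longrightarrow> k \<le> n \<Longrightarrow> 0 < \<alpha> k"
    and \<sigma>: "1 / sigma_reg \<alpha> n = \<delta>\<^sup>2 / E\<^sup>2 * psi_inv \<rho> a p (\<delta> / (m * E)) powr (2 * (s - p))"
    and xd: "xd - x0 = Pow p v" "norm v \<le> E" and y: "norm (A xd - y) \<le> \<delta>"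
  obtains w where "x_reg A G s x0 \<alpha> n y - xd = Pow p w" "norm w \<le> 2 * (K * C) * E"
    "norm (A (Pow p w)) \<le> 2 * (K * C) * \<delta>"
proof -
  define l where "l = psi_inv \<rho> a p (\<delta> / (m * E))"
  define D where "D = \<delta> / E"
  define \<theta> where "\<theta> = 1 / sigma_reg \<alpha> n"
  define F0 where "F0 = F (\<theta> / M\<^sup>2)"
  define F1 where "F1 = l powr (2 * \<bar>p - s\<bar>)"
  define e where "e = y - A xd"
  have D: "0 < D" using E \<delta> by (simp add: D_def)
  have l: "0 < l" "l \<le> a" "psi \<rho> p l = \<delta> / (m * E)"
    using psi_inv_p[of "\<delta> / (m * E)"] \<delta> E m by (simp_all add: l_def)
  have psi_pos: "0 < psi \<rho> s l" "psi \<rho> s l \<le> psi \<rho> s a"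
    using index_function_pos[OF psi_s] index_function_mono[OF psi_s, of l a] l by auto
  have sq: "(l powr x)\<^sup>2 = l powr (2 * x)" for x
    using l by (simp add: power2_eq_square flip: powr_add)
  have D_eq: "D\<^sup>2 = m\<^sup>2 * (psi \<rho> s l)\<^sup>2 * l powr (2 * (p - s))"
  proof -
    have "D = m * psi \<rho> p l" using m E l(3) by (simp add: D_def field_simps)
    also have "psi \<rho> p l = psi \<rho> s l * l powr (p - s)"
    proof -
      have "l powr p = l powr s * l powr (p - s)" using l by (simp flip: powr_add)
      then show ?thesis by (simp add: psi_def)
    qed
    finally show ?thesis by (simp add: power_mult_distrib sq mult.assoc)
  qed
  have \<theta>_eq: "\<theta> = m\<^sup>2 * (psi \<rho> s l)\<^sup>2"
  proof -
    have "\<theta> = D\<^sup>2 * l powr (2 * (s - p))" using \<sigma> by (simp add: \<theta>_def D_def l_def power_divide)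
    also have "\<dots> = m\<^sup>2 * (psi \<rho> s l)\<^sup>2 * (l powr (2 * (p - s)) * l powr (2 * (s - p)))"
      by (simp add: D_eq mult.assoc)
    also have "l powr (2 * (p - s)) * l powr (2 * (s - p)) = 1" using l by (simp flip: powr_add)
    finally show ?thesis by simp
  qed
  have \<theta>_pos: "0 < \<theta>" using \<theta>_eq m psi_pos by simp
  have \<theta>M: "\<theta> / M\<^sup>2 = (m / M)\<^sup>2 * (psi \<rho> s l)\<^sup>2" by (simp add: \<theta>_eq power_divide)
  have psi_c: "(psi \<rho> s l)\<^sup>2 \<le> c" using psi_pos by (intro power_mono) auto
  have \<theta>M_le: "\<theta> / M\<^sup>2 \<le> (psi \<rho> s l)\<^sup>2"
    unfolding \<theta>M using m mM M by (intro mult_left_le_one_le) (auto simp: power_le_one)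
  have \<theta>_le: "\<theta> \<le> M\<^sup>2 * c" using order_trans[OF \<theta>M_le psi_c] M by (simp add: field_simps)
  have F1: "F ((psi \<rho> s l)\<^sup>2) = F1" using F_psi[of l] l by (simp add: F1_def)
  have F1_pos: "0 < F1" using l by (simp add: F1_def)
  have F0_pos: "0 < F0" unfolding F0_def using \<theta>_pos M \<theta>M_le psi_c by (intro F_pos) auto
  have F01: "F0 \<le> F1" unfolding F0_def F1[symmetric] using \<theta>_pos M \<theta>M_le psi_c by (intro F_mono) auto
  have F10: "F1 \<le> C * F0"
    unfolding F0_def F1[symmetric] \<theta>M by (rule F_le_scaled) (use psi_c in auto)
  have KC: "1 \<le> K * C" "0 < K * C" "C \<le> K * C" "0 < C"
    using K C_ge_1 mult_mono[of 1 K 1 C] by (auto simp: mult_le_cancel_right1)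
  have KC2: "K * C \<le> (K * C)\<^sup>2"
    using mult_left_mono[OF KC(1) less_imp_le[OF KC(2)]] by (simp add: power2_eq_square)
  interpret normal_operator T Q "M\<^sup>2 * c" C "\<lambda>t. F (t / M\<^sup>2)" by (rule normal_operator_T)
  have \<theta>': "1 / sigma_reg \<alpha> n = \<theta>" by (simp add: \<theta>_def)
  have mono': "F (t / M\<^sup>2) \<le> F (u / M\<^sup>2)" if "0 \<le> t" "t \<le> u" "u \<le> M\<^sup>2 * c" for t u
    using that M by (intro F_mono) (auto simp: field_simps)
  have quot': "t * F (\<tau> / M\<^sup>2) \<le> K * \<tau> * F (t / M\<^sup>2)" if "0 \<le> t" "t \<le> \<tau>" "\<tau> \<le> M\<^sup>2 * c" for t \<tau>
    using quot0[of "t / M\<^sup>2" "\<tau> / M\<^sup>2"] that M by (simp add: field_simps)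
  have dense: "closure (range Q) = UNIV" and Q: "bounded_selfadjoint Q"
    by (rule Pow_dense bounded_selfadjoint_Pow, simp)+
  have a1: "0 \<le> K * C / D" and b1: "0 \<le> K * C * D" using KC D by (simp_all add: less_imp_le)
  note prems = \<alpha> \<theta>' \<theta>_pos \<theta>_le mono' F0_pos[unfolded F0_def] quot' K dense Q a1 b1
  have e: "norm e \<le> \<delta>" using y by (simp add: e_def norm_minus_commute)
  have linA: "linear A" using A by (rule bounded_linear.linear)
  have pp: "0 \<le> p" using p by simp
  note linP = bounded_linear.linear[OF bounded_linear_Pow[OF pp]]
  have res: "y - A x0 = e + A (Pow p v)"
    using xd(1) by (simp add: e_def linear_diff[OF linA] flip: xd(1))
  let ?u = "fun_calc (g_reg \<alpha> n) (adjoint T \<circ> T) (adjoint T (e + A (Pow p v)))"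
  have x_reg: "x_reg A G s x0 \<alpha> n y - xd = op_powr G s ?u - Pow p v"
    by (simp add: x_reg_def Let_def res flip: xd(1))
  note conclude = that
  have fin: thesis
    if "x_reg A G s x0 \<alpha> n y - xd = Pow p w" "norm w \<le> C * norm v + K * C / D * norm e"
      "norm (A (Pow p w)) \<le> norm e + K * C * D * norm v" for w
  proof (rule conclude)
    show "x_reg A G s x0 \<alpha> n y - xd = Pow p w" by fact
    have "C * norm v + K * C / D * norm e \<le> (K * C) * E + K * C / D * \<delta>"
      using KC xd(2) e a1 by (intro add_mono mult_mono) auto
    also have "K * C / D * \<delta> = K * C * E" using E \<delta> by (simp add: D_def)
    finally show "norm w \<le> 2 * (K * C) * E" using that(2) by (simp add: mult_ac)
    have "1 * \<delta> \<le> K * C * \<delta>" using KC(1) \<delta>(1) by (intro mult_right_mono) auto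
    then have "norm e \<le> K * C * \<delta>" using e by linarith
    moreover have "K * C * D * norm v \<le> K * C * D * E" using xd(2) b1 by (rule mult_left_mono)
    ultimately have "norm e + K * C * D * norm v \<le> (K * C) * \<delta> + K * C * D * E" by (rule add_mono)
    also have "K * C * D * E = K * C * \<delta>" using E by (simp add: D_def)
    finally show "norm (A (Pow p w)) \<le> 2 * (K * C) * \<delta>" using that(3) by (simp add: mult_ac)
  qed
  show thesis
  proof (cases "p \<le> s")
    case True
    have DF: "\<theta> = D\<^sup>2 * F1"
    proof -
      have "l powr (2 * (p - s)) * F1 = 1" using True l by (simp add: F1_def flip: powr_add)
      then show ?thesis by (simp add: D_eq \<theta>_eq mult.assoc)
    qed
    have 1: "C * (K / \<theta> * F (\<theta> / M\<^sup>2)) \<le> (K * C / D)\<^sup>2"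
    proof -
      have "C * (K / \<theta> * F0) \<le> C * (K / \<theta> * F1)"
        using F01 K KC \<theta>_pos by (intro mult_left_mono) (auto simp: less_imp_le)
      also have "\<dots> = K * C / D\<^sup>2" using F1_pos D by (simp add: DF field_simps)
      also have "\<dots> \<le> (K * C)\<^sup>2 / D\<^sup>2" using KC2 by (intro divide_right_mono) auto
      finally show ?thesis by (simp add: F0_def power_divide)
    qed
    have 2: "K * \<theta> / F (\<theta> / M\<^sup>2) \<le> (K * C * D)\<^sup>2"
    proof -
      have "F1 / F0 \<le> C" using F10 F0_pos by (simp add: field_simps)
      then have "K * D\<^sup>2 * (F1 / F0) \<le> K * D\<^sup>2 * C" using K by (intro mult_left_mono) auto
      also have "\<dots> \<le> (K * C)\<^sup>2 * D\<^sup>2" using mult_right_mono[OF KC2, of "D\<^sup>2"] by (simp add: mult_ac)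
      finally show ?thesis by (simp add: F0_def DF power_mult_distrib mult_ac)
    qed
    have L: "bounded_linear (\<lambda>x. A (Pow p x))" by (rule bounded_linear_compose[OF A bounded_linear_Pow[OF pp]])
    define w where "w = Q ?u - v"
    have w: "norm w \<le> C * norm v + K * C / D * norm e" "norm (A (Pow p w)) \<le> norm e + K * C * D * norm v"
      unfolding w_def using high_order_error[OF prems L T_Q_high[OF True] 1 2, where v = v and e = e] by auto
    show thesis
    proof (rule fin[OF _ w])
      show "x_reg A G s x0 \<alpha> n y - xd = Pow p w"
        by (simp add: x_reg op_powr_Q_high[OF True] w_def linear_diff[OF linP])
    qed
  next
    case False
    then have sp: "s \<le> p" by simp
    have DF: "\<theta> * F1 = D\<^sup>2" using sp by (simp add: F1_def D_eq \<theta>_eq)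
    have 1: "K / (\<theta> * F (\<theta> / M\<^sup>2)) \<le> (K * C / D)\<^sup>2"
    proof -
      have "D\<^sup>2 \<le> C * (\<theta> * F0)" unfolding DF[symmetric] using mult_left_mono[OF F10, of \<theta>] \<theta>_pos by (simp add: mult_ac)
      then have "K / (\<theta> * F0) \<le> K * C / D\<^sup>2"
        using mult_left_mono[of "D\<^sup>2" "C * (\<theta> * F0)" K] K \<theta>_pos F0_pos D by (simp add: field_simps)
      also have "\<dots> \<le> (K * C)\<^sup>2 / D\<^sup>2" using KC2 by (intro divide_right_mono) auto
      finally show ?thesis by (simp add: F0_def power_divide)
    qed
    have 2: "C * (K * \<theta> * F (\<theta> / M\<^sup>2)) \<le> (K * C * D)\<^sup>2"
    proof -
      have "\<theta> * F0 \<le> D\<^sup>2" unfolding DF[symmetric] using F01 \<theta>_pos by (intro mult_left_mono) auto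
      then have "K * C * (\<theta> * F0) \<le> K * C * D\<^sup>2" using KC by (intro mult_left_mono) auto
      also have "\<dots> \<le> (K * C)\<^sup>2 * D\<^sup>2" using KC2 by (intro mult_right_mono) auto
      finally show ?thesis by (simp add: F0_def power_mult_distrib mult_ac)
    qed
    obtain w where w: "fun_calc (g_reg \<alpha> n) (adjoint T \<circ> T) (adjoint T (e + T (Q v))) - Q v = Q w"
      "norm w \<le> C * norm v + K * C / D * norm e" "norm (T (Q w)) \<le> norm e + K * C * D * norm v"
      using low_order_error[OF prems 1 2, where v = v and e = e] by blast
    have "?u = Q (v + w)"
      using w(1) bounded_selfadjoint_linear[OF Q]
      by (simp add: T_Q_low[OF sp] bounded_linear.linear linear_add algebra_simps)
    then have "x_reg A G s x0 \<alpha> n y - xd = Pow p w"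
      by (simp add: x_reg op_powr_Q_low[OF sp] linear_add[OF linP])
    then show thesis using w by (intro fin) (auto simp: T_Q_low[OF sp])
  qed
qed

lemma regularization_error:
  assumes E: "0 < E" and \<delta>: "0 < \<delta>" "\<delta> / (m * E) \<le> psi \<rho> p a"
    and \<alpha>: "\<And>k. 1 \<le> k \<Longrightarrow> k \<le> n \<Longrightarrow> 0 < \<alpha> k"
    and \<sigma>: "1 / sigma_reg \<alpha> n = \<delta>\<^sup>2 / E\<^sup>2 * psi_inv \<rho> a p (\<delta> / (m * E)) powr (2 * (s - p))"
    and xd: "xd - x0 = Pow p v" "norm v \<le> E" and y: "norm (A xd - y) \<le> \<delta>"
  shows "norm (x_reg A G s x0 \<alpha> n y - xd) \<le> 4 * (K * C) * E * psi_inv \<rho> a p (\<delta> / (m * E)) powr p"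
proof -
  define l where "l = psi_inv \<rho> a p (\<delta> / (m * E))"
  define H where "H = 2 * (K * C)"
  have l: "0 < l" "l \<le> a" "psi \<rho> p l = \<delta> / (m * E)"
    using psi_inv_p[of "\<delta> / (m * E)"] \<delta> E m by (simp_all add: l_def)
  have \<rho>l: "0 < \<rho> l" using index_function_pos[OF \<rho>] l by simp
  obtain w where w: "x_reg A G s x0 \<alpha> n y - xd = Pow p w" "norm w \<le> H * E" "norm (A (Pow p w)) \<le> H * \<delta>"
    using regularization_error_in_source_scale[OF assms] unfolding H_def by blast
  have H: "0 \<le> H" using K C_ge_1 by (simp add: H_def)
  have "\<delta> = m * E * (l powr p * \<rho> l)" using l(3) m E by (simp add: psi_def field_simps)
  then have \<delta>_eq: "H * \<delta> / (m * \<rho> l) = H * E * l powr p" using m \<rho>l by simp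
  have "(norm (Pow p w))\<^sup>2 \<le> (l powr p)\<^sup>2 * (norm w)\<^sup>2 + (norm (A (Pow p w)) / (m * \<rho> l))\<^sup>2"
    by (rule scale_interpolation[OF l(1,2)])
  also have "\<dots> \<le> (l powr p)\<^sup>2 * (H * E)\<^sup>2 + (H * \<delta> / (m * \<rho> l))\<^sup>2"
    using w(2,3) m \<rho>l by (intro add_mono mult_left_mono power_mono divide_right_mono) auto
  also have "\<dots> = 2 * (H * E * l powr p)\<^sup>2" unfolding \<delta>_eq by (simp add: power_mult_distrib)
  also have "\<dots> \<le> (2 * (H * E * l powr p))\<^sup>2" by (simp add: power_mult_distrib)
  finally have "norm (Pow p w) \<le> 2 * (H * E * l powr p)"
    by (rule power2_le_imp_le) (use H E in simp)
  then show ?thesis by (simp add: w(1) H_def l_def mult_ac)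
qed

end

end

theorem theorem3p6:
  fixes A :: "'a::{real_inner, complete_space} \<Rightarrow> 'b::{real_inner, complete_space}"
    and D :: "'a set" and B G :: "'a \<Rightarrow> 'a" and x0 :: 'a
    and \<rho> :: "real \<Rightarrow> real" and a s p E m M :: real
  assumes A: "bounded_linear A" "inj A" "\<not> closed (range A)"
    and B: "selfadjoint_on D B" "strictly_positive_on D B" "unbounded_on D B"
    and G: "G = inv_into D B"
    and a: "a = onorm G"
    and \<rho>: "index_function a \<rho>"
    and psi_s: "index_function a (psi \<rho> s)"
    and m: "0 < m" and mM: "m \<le> M"
    and link: "\<And>x. m * norm (fun_calc (ext0 \<rho>) G x) \<le> norm (A x) \<and>
                    norm (A x) \<le> M * norm (fun_calc (ext0 \<rho>) G x)"
    and p: "0 < p" and E: "0 < E"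
    and high: "p \<le> s \<Longrightarrow>
      operator_monotone TYPE('a) ((psi \<rho> s a)\<^sup>2) (\<lambda>t. (w_fun \<rho> a s p t)\<^sup>2)"
    and low: "s \<le> p \<Longrightarrow>
      operator_monotone TYPE('a) ((psi \<rho> s a)\<^sup>2) (\<lambda>t. (h_fun \<rho> a s p t)\<^sup>2) \<and>
      antimono_on {0<..(psi \<rho> s a)\<^sup>2} (\<lambda>t. h_fun \<rho> a s p t / sqrt t)"
    and xi: "convex_on {0<..a powr (2 * p)} (\<lambda>t. (psi \<rho> p (t powr (1 / (2 * p))))\<^sup>2)"
  shows "(\<exists>C>0. \<forall>\<delta> n \<alpha>.
            0 < \<delta> \<and> \<delta> / (m * E) \<le> psi \<rho> p a \<and>
            1 \<le> n \<and> (\<forall>k\<in>{1..n}. 0 < \<alpha> k) \<and>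
            1 / sigma_reg \<alpha> n
              = \<delta>\<^sup>2 / E\<^sup>2 * psi_inv \<rho> a p (\<delta> / (m * E)) powr (2 * (s - p)) \<longrightarrow>
            worst_case_error A (source_set G x0 p E) \<delta> (x_reg A G s x0 \<alpha> n)
              \<le> ennreal (C * (E * psi_inv \<rho> a p (\<delta> / (M * E)) powr p)) \<and>
            (\<delta> / (M * E) \<in> spectrum_op (fun_calc (ext0 (psi \<rho> p)) G) \<longrightarrow>
             worst_case_error A (source_set G x0 p E) \<delta> (x_reg A G s x0 \<alpha> n)
               \<le> ennreal C * best_worst_case_error A (source_set G x0 p E) \<delta>))
       \<and> (\<exists>c1>0. \<exists>c2>0. \<forall>\<delta> n \<alpha> xd v y y\<delta>.
            0 < \<delta> \<and> \<delta> / (m * E) \<le> psi \<rho> p a \<and>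
            1 \<le> n \<and> (\<forall>k\<in>{1..n}. 0 < \<alpha> k) \<and>
            1 / sigma_reg \<alpha> n
              = \<delta>\<^sup>2 / E\<^sup>2 * psi_inv \<rho> a p (\<delta> / (m * E)) powr (2 * (s - p)) \<and>
            A xd = y \<and> norm (y - y\<delta>) \<le> \<delta> \<and>
            xd - x0 = op_powr G p v \<and> norm v \<le> E \<longrightarrow>
            c2 * \<delta> \<le> psi \<rho> p a \<and>
            norm (x_reg A G s x0 \<alpha> n y\<delta> - xd) \<le> c1 * psi_inv \<rho> a p (c2 * \<delta>) powr p)"
proof -
  obtain e1 e2 :: 'a where e: "norm e1 = 1" "norm e2 = 1" "e1 \<bullet> e2 = 0"
    using unbounded_on_orthonormal_pair[OF B(1,3)] .
  obtain \<gamma> where "selfadjoint_between 0 \<gamma> G" using selfadjoint_inverse(1)[OF B(1,2)] G by blast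
  then have Ga: "selfadjoint_between 0 a G" unfolding a by (rule selfadjoint_between_onorm)
  have dense: "closure (range G) = UNIV" using selfadjoint_inverse(2)[OF B(1,2)] G by simp
  have bl: "bounded_linear G" using Ga by (simp add: selfadjoint_between_def bounded_selfadjoint_def)
  have a0: "0 < a"
  proof -
    have "onorm G \<noteq> 0"
    proof
      assume "onorm G = 0"
      then have "G = (\<lambda>x. 0)" using onorm_eq_0[OF bl] by auto
      then have "closure {0 :: 'a} = UNIV" using dense by simp
      then have "e1 \<in> closure {0}" by simp
      then show False using e(1) by auto
    qed
    then show ?thesis using onorm_pos_le[OF bl] a by simp
  qed
  interpret linked_scale G a A \<rho> s p m M
    using Ga dense a0 A \<rho> psi_s m mM p link
    by (intro linked_scale.intro positive_dense.intro linked_scale_axioms.intro) auto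
  have mono: "operator_monotone TYPE('a) c F"
  proof (cases "p \<le> s")
    case True
    show ?thesis by (rule operator_monotone_cong[OF high[OF True]]) (use True in \<open>simp add: w_fun_square\<close>)
  next
    case False
    then have sp: "s \<le> p" by simp
    show ?thesis by (rule operator_monotone_cong[OF conjunct1[OF low[OF sp]]]) (use sp in \<open>simp add: h_fun_square\<close>)
  qed
  obtain K where K: "1 \<le> K" "\<And>t \<tau>. 0 < t \<Longrightarrow> t \<le> \<tau> \<Longrightarrow> \<tau> \<le> c \<Longrightarrow> t * F \<tau> \<le> K * \<tau> * F t"
    by (rule operator_monotone_quotient[OF mono F_pos F_mono e c_pos]) auto
  define H where "H = 4 * (K * ratio_const K)"
  have H: "0 < H" using K(1) ratio_const_ge_1[OF K(1)] by (simp add: H_def)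
  have bound: "norm (x_reg A G s x0 \<alpha> n y - xd) \<le> H * E * psi_inv \<rho> a p (\<delta> / (m * E)) powr p"
    if "0 < \<delta>" "\<delta> / (m * E) \<le> psi \<rho> p a" "\<forall>k\<in>{1..n}. 0 < \<alpha> k"
      "1 / sigma_reg \<alpha> n = \<delta>\<^sup>2 / E\<^sup>2 * psi_inv \<rho> a p (\<delta> / (m * E)) powr (2 * (s - p))"
      "xd - x0 = Pow p v" "norm v \<le> E" "norm (A xd - y) \<le> \<delta>" for \<delta> n \<alpha> xd v y
    unfolding H_def using that by (intro regularization_error[OF mono K E]) auto
  show ?thesis
  proof (rule conjI, goal_cases)
    case 1
    show ?case
    proof (intro exI[of _ "H * (M / m)"] conjI allI impI)
      show "0 < H * (M / m)" using H m M by simp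
      fix \<delta> n \<alpha>
      assume asm: "0 < \<delta> \<and> \<delta> / (m * E) \<le> psi \<rho> p a \<and>
            1 \<le> n \<and> (\<forall>k\<in>{1..n}. 0 < \<alpha> k) \<and>
            1 / sigma_reg \<alpha> n
              = \<delta>\<^sup>2 / E\<^sup>2 * psi_inv \<rho> a p (\<delta> / (m * E)) powr (2 * (s - p))"
      then have \<delta>: "0 < \<delta>" "\<delta> / (m * E) \<le> psi \<rho> p a" by auto
      let ?l = "psi_inv \<rho> a p (\<delta> / (M * E)) powr p"
      show upper: "worst_case_error A (source_set G x0 p E) \<delta> (x_reg A G s x0 \<alpha> n)
              \<le> ennreal (H * (M / m) * (E * ?l))"
        unfolding worst_case_error_def
      proof (intro SUP_least)
        fix x y assume x: "x \<in> source_set G x0 p E" and y: "y \<in> {z. norm (A x - z) \<le> \<delta>}"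
        obtain v where v: "x - x0 = Pow p v" "norm v \<le> E" using x mem_source_set_iff by blast
        have "norm (x_reg A G s x0 \<alpha> n y - x) \<le> H * E * psi_inv \<rho> a p (\<delta> / (m * E)) powr p"
          using asm v y by (intro bound) auto
        also have "\<dots> \<le> H * E * (M / m * ?l)"
          using psi_inv_p_ratio(2)[OF E \<delta>] H E by (intro mult_left_mono) auto
        finally show "ennreal (norm (x_reg A G s x0 \<alpha> n y - x)) \<le> ennreal (H * (M / m) * (E * ?l))"
          by (simp add: ennreal_leI mult_ac)
      qed
      assume spec: "\<delta> / (M * E) \<in> spectrum_op (fun_calc (ext0 (psi \<rho> p)) G)"
      note upper
      also have "ennreal (H * (M / m) * (E * ?l)) = ennreal (H * (M / m)) * ennreal (E * ?l)"
        using H m M E by (intro ennreal_mult) auto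
      also have "\<dots> \<le> ennreal (H * (M / m)) * best_worst_case_error A (source_set G x0 p E) \<delta>"
        by (intro mult_left_mono best_worst_case_error_lower_bound[OF E \<delta>(1) psi_inv_p_ratio(1)[OF E \<delta>] spec]) simp
      finally show "worst_case_error A (source_set G x0 p E) \<delta> (x_reg A G s x0 \<alpha> n)
               \<le> ennreal (H * (M / m)) * best_worst_case_error A (source_set G x0 p E) \<delta>" .
    qed
  next
    case 2
    show ?case
      by (rule exI[of _ "H * E"], rule conjI, use H E in simp,
          rule exI[of _ "1 / (m * E)"], rule conjI, use m E in simp)
        (auto simp: op_powr_p intro!: bound)
  qed
qed

end
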